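(* Assume that $(\Omega,\mathcal F)$ is a Polish space and that $\mathcal A\colon\Omega\times\mathbb N\to\mathcal L(X)$ is a compact linear cocycle over $\sigma$, with generator $A$, satisfying $\log^+\|A(\cdot)\|\in L^1(\Omega,\mathbb R)$ and having a zero Lyapunov exponent (i.e. $0$ is one of its Lyapunov exponents). Then there is a measurable map $v\colon\Omega\to X$ such that for $\mathbb P$-a.e. $\omega\in\Omega$ we have $\|v(\omega)\|=1$ and $$\liminf_{n\to\infty}\|\mathcal A(\omega,n)v(\omega)\|\le 1,\qquad \limsup_{n\to\infty}\|\mathcal A(\omega,n)v(\omega)\|\ge 1.$$
   Context: Setting. $X$ is a separable Banach space, $\mathcal L(X)$ the space of bounded linear operators on $X$ with the operator norm. $(\Omega,\mathcal F,\mathbb P)$ is a probability space with $(\Omega,\mathcal F)$ a Polish space (with its Borel $\sigma$-algebra). $\sigma\colon\Omega\to\Omega$ is invertible, measurable with measurable inverse, preserves $\mathbb P$, $\mathbb P$ is ergodic for $\sigma$, and $\sigma$ is aperiodic (the set of periodic points is $\mathbb P$-null). $\mathbb N=\{0,1,2,\dots\}$. Cocycle. A map $\mathcal A\colon\Omega\times\mathbb N\to\mathcal L(X)$ is a (strongly measurable) linear cocycle if $\mathcal A(\omega,0)=\mathrm{Id}$; $\mathcal A(\omega,n+m)=\mathcal A(\sigma^m\omega,n)\mathcal A(\omega,m)$ for all $\omega\in\Omega$, $n,m\in\mathbb N$; and for each $x\in X$ the map $\omega\mapsto A(\omega)x$ is measurable, where $A(\omega):=\mathcal A(\omega,1)$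 is the generator. It is compact if $A(\omega)$ is a compact operator for all $\omega\in\Omega$. Lyapunov exponents. For a compact cocycle with $\log^+\|A(\cdot)\|\in L^1(\Omega,\mathbb R)$, the multiplicative ergodic theorem (González-Tokman and Quas) gives a finite or infinite sequence $\lambda_1>\lambda_2>\dots>-\infty$, the Lyapunov exponents, and a $\sigma$-invariant full-measure set $\Omega'\subset\Omega$ such that for each $\lambda_i$ and $\omega\in\Omega'$ there are a (nonzero) finite-dimensional Oseledets space $E_i(\omega)$ and a finite-codimensional space $V_i(\omega)$ with: $X=(\oplus_{k=1}^iE_k(\omega))\oplus V_i(\omega)$; $A(\omega)E_i(\omega)=E_i(\sigma\omega)$ and $A(\omega)V_i(\omega)\subset V_i(\sigma\omega)$; $\lim_{n\to\infty}\frac1n\log\|\mathcal A(\omega,n)v\|=\lambda_i$ for all nonzero $v\in E_i(\omega)$; $\lim_{n\to\infty}\frac1n\log\|\mathcal A(\omega,n)|_{V_i(\omega)}\|<\lambda_i$. As usual, the list of exponents is complete: the last limit equals $\lambda_{i+1}$, or $-\infty$ if $\lambda_i$ is the last exponent, and $\lambda_i\to-\infty$ if there are infinitely many. *)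

theory Defs
  imports "HOL-Probability.Probability"
begin

text \<open>The class \<open>polish_space\<close> carries a chosen complete metric, but only the Borel
  \<open>\<sigma>\<close>-algebra of its topology is used.\<close>

locale ergodic_automorphism = prob_space M
  for M :: "'w::polish_space measure" +
  fixes \<sigma> :: "'w \<Rightarrow> 'w"
  assumes sets_M: "sets M = sets borel"
    and bij: "bij \<sigma>"
    and measurable_fwd: "\<sigma> \<in> measurable M M"
    and measurable_bwd: "inv \<sigma> \<in> measurable M M"
    and preserving: "distr M M \<sigma> = M"
    and ergodic: "\<And>S. S \<in> sets M \<Longrightarrow> \<sigma> -` S = S \<Longrightarrow> prob S = 0 \<or> prob S = 1"

definition aperiodic :: "'w measure \<Rightarrow> ('w \<Rightarrow> 'w) \<Rightarrow> bool" where
  "aperiodic M \<sigma> \<longleftrightarrow> {w \<in> space M. \<exists>n>0. (\<sigma> ^^ n) w = w} \<in> null_sets M"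

locale linear_cocycle =
  fixes M :: "'w measure" and \<sigma> :: "'w \<Rightarrow> 'w"
    and \<A> :: "'w \<Rightarrow> nat \<Rightarrow> 'x::{banach, second_countable_topology} \<Rightarrow>\<^sub>L 'x"
  assumes cocycle_0: "\<A> w 0 = id_blinfun"
    and cocycle_add: "\<A> w (n + m) = \<A> ((\<sigma> ^^ m) w) n o\<^sub>L \<A> w m"
    and strongly_measurable: "(\<lambda>w. \<A> w 1 x) \<in> borel_measurable M"

definition compact_operator :: "('a::real_normed_vector \<Rightarrow>\<^sub>L 'b::real_normed_vector) \<Rightarrow> bool" where
  "compact_operator T \<longleftrightarrow> (\<forall>S. bounded S \<longrightarrow> compact (closure (T ` S)))"

definition compact_cocycle :: "('w \<Rightarrow> nat \<Rightarrow> 'x::real_normed_vector \<Rightarrow>\<^sub>L 'x) \<Rightarrow> bool" where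
  "compact_cocycle \<A> \<longleftrightarrow> (\<forall>w. compact_operator (\<A> w 1))"

definition log_plus :: "real \<Rightarrow> real" where
  "log_plus t = ln (max 1 t)"

text \<open>Logarithm with \<open>log 0 = -\<infinity>\<close>; the library has \<open>ln 0 = 0\<close>, which would turn the growth rate
  of a vanishing orbit into 0.\<close>

definition elog :: "real \<Rightarrow> ereal" where
  "elog t = (if t \<le> 0 then -\<infinity> else ereal (ln t))"

definition finite_dimensional :: "'x::real_vector set \<Rightarrow> bool" where
  "finite_dimensional S \<longleftrightarrow> (\<exists>B. finite B \<and> S = span B)"

definition finite_codimensional :: "'x::real_vector set \<Rightarrow> bool" where
  "finite_codimensional S \<longleftrightarrow> subspace S \<and> (\<exists>B. finite B \<and> span (S \<union> B) = UNIV)"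

text \<open>The whole space is the internal direct sum of the \<open>W k\<close>, \<open>k \<in> I\<close>, and \<open>V\<close>: every vector is
  uniquely of the form \<open>(\<Sum>k\<in>I. e k) + v\<close> with \<open>e k \<in> W k\<close> and \<open>v \<in> V\<close>. The extensional product
  makes the family \<open>e\<close> unique as a function.\<close>

definition direct_sum_UNIV :: "'i set \<Rightarrow> ('i \<Rightarrow> 'x::real_vector set) \<Rightarrow> 'x set \<Rightarrow> bool" where
  "direct_sum_UNIV I W V \<longleftrightarrow>
     bij_betw (\<lambda>(e, v). (\<Sum>k\<in>I. e k) + v) (Pi\<^sub>E I W \<times> V) UNIV"

definition norm_on :: "('x::real_normed_vector \<Rightarrow>\<^sub>L 'x) \<Rightarrow> 'x set \<Rightarrow> real" where
  "norm_on T V = (SUP v \<in> V \<inter> cball 0 1. norm (T v))"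

text \<open>The conclusion of the multiplicative ergodic theorem. The exponents are \<open>lam i\<close> for
  \<open>enat i < N\<close>, counted from 0, so \<open>N\<close> is their (possibly infinite) number. The exponents are
  real, and the list is complete: the growth rate on \<open>V i w\<close> is the next exponent, or \<open>-\<infinity>\<close> after
  the last one (in particular it is strictly less than \<open>lam i\<close>), and infinitely many exponents
  tend to \<open>-\<infinity>\<close>.\<close>

definition oseledets_splitting ::
  "'w measure \<Rightarrow> ('w \<Rightarrow> 'w) \<Rightarrow> ('w \<Rightarrow> nat \<Rightarrow> 'x::real_normed_vector \<Rightarrow>\<^sub>L 'x) \<Rightarrow>
   enat \<Rightarrow> (nat \<Rightarrow> real) \<Rightarrow> 'w set \<Rightarrow> (nat \<Rightarrow> 'w \<Rightarrow> 'x set) \<Rightarrow> (nat \<Rightarrow> 'w \<Rightarrow> 'x set) \<Rightarrow> bool"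
where
  "oseledets_splitting M \<sigma> \<A> N lam \<Omega>' E V \<longleftrightarrow>
     (\<forall>i j. i < j \<and> enat j < N \<longrightarrow> lam j < lam i) \<and>
     (N = \<infinity> \<longrightarrow> filterlim lam at_bot sequentially) \<and>
     \<Omega>' \<in> sets M \<and> emeasure M \<Omega>' = 1 \<and> \<sigma> -` \<Omega>' = \<Omega>' \<and>
     (\<forall>i w. enat i < N \<and> w \<in> \<Omega>' \<longrightarrow>
        finite_dimensional (E i w) \<and> E i w \<noteq> {0} \<and>
        finite_codimensional (V i w) \<and>
        direct_sum_UNIV {..i} (\<lambda>k. E k w) (V i w) \<and>
        \<A> w 1 ` E i w = E i (\<sigma> w) \<and>
        \<A> w 1 ` V i w \<subseteq> V i (\<sigma> w) \<and>
        (\<forall>v \<in> E i w - {0}.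
           (\<lambda>n. elog (norm (\<A> w n v)) / ereal (real n)) \<longlonglongrightarrow> ereal (lam i)) \<and>
        (\<lambda>n. elog (norm_on (\<A> w n) (V i w)) / ereal (real n))
          \<longlonglongrightarrow> (if enat (Suc i) < N then ereal (lam (Suc i)) else -\<infinity>))"

text \<open>A splitting determines the set of its exponents: they are the growth rates of vectors
  other than \<open>-\<infinity>\<close>. So it does not matter which splitting is used.\<close>

definition lyapunov_exponent ::
  "'w measure \<Rightarrow> ('w \<Rightarrow> 'w) \<Rightarrow> ('w \<Rightarrow> nat \<Rightarrow> 'x::real_normed_vector \<Rightarrow>\<^sub>L 'x) \<Rightarrow> real \<Rightarrow> bool"
where
  "lyapunov_exponent M \<sigma> \<A> l \<longleftrightarrow>
     (\<exists>N lam \<Omega>' E V. oseledets_splitting M \<sigma> \<A> N lam \<Omega>' E V \<and> (\<exists>i. enat i < N \<and> lam i = l))"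

end

theory Submission
  imports Defs
begin

text \<open>Put \<open>T (w, u) = (\<sigma> w, sgn (\<A> w 1 u))\<close>. The norms of the orbits of a vector form a
  multiplicative cocycle over \<open>T\<close>, and on vectors in the zero-exponent part this cocycle grows
  subexponentially. If it were bounded away from 1, from above or from below, on all orbits
  starting over a set \<open>Y\<close> of positive measure, then every return to \<open>Y\<close> would multiply the norm by
  a definite factor, and a \<open>T\<close>-invariant mean with mass over \<open>Y\<close> would give positive frequency of
  returns, hence exponential growth. The measurable choice of the vector is a selection theorem
  for random \<open>G\<^sub>\<delta>\<close> sets, proved with the outer measure.

  The Oseledets spaces \<open>E i\<close> are not assumed to depend measurably on the base point, so no
  measure on the bundle of their unit spheres is available. Instead the mean is a limit of the
  orbit averages of one measurable neutral vector field, and only its part carried by the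
  compact sets \<open>Q C\<close> is kept; compactness of the operators enters there.\<close>

subsection \<open>Measurable selection\<close>

text \<open>The neutral directions are described by norm bounds alone: with \<eta> smaller than the
  distance from 0 to the other exponents, a unit vector whose orbit stays between multiples of
  \<open>exp (- \<eta> n)\<close> and \<open>exp (\<eta> n)\<close> has growth rate 0. Such bounds
  are closed in the vector and measurable in the base point. Two difficulties follow. One is to keep
  mass: orbit averages may drift towards vectors with ever worse constants. A lower bound with rate
  \<eta> / 2 on the starting field leaves a margin against \<eta>, and a lemma of Pliss type then
  brings the orbit back to a fixed constant with positive frequency. The other is that the mean is
  only finitely additive. Its base marginal is dominated by \<open>M\<close> and the fibres of
  \<open>Q C\<close> are compact; together these facts give a Dini theorem, hence bounded
  convergence for random sets with closed fibres. By ergodicity such a mean charges every base set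
  of positive measure, so one field that is neutral over some set is enough to find balanced vectors
  over almost all base points.\<close>

definition random_open :: "'w measure \<Rightarrow> ('w \<times> 'x::topological_space) set \<Rightarrow> bool" where
  "random_open M B \<longleftrightarrow>
     (\<exists>C. countable C \<and> C \<subseteq> {R \<times> D |R D. R \<in> sets M \<and> open D} \<and> B = \<Union>C)"

text \<open>The base carries only a \<sigma>-algebra, so openness is asked for through countably
  many rectangles. Membership then takes the form: for every \<open>m\<close> there is an index
  \<open>j\<close> with \<open>w \<in> R m j\<close> and \<open>x \<in> D m j\<close>. This is a
  Souslin scheme, and the selection works on its index sequences.\<close>

definition random_gdelta :: "'w measure \<Rightarrow> ('w \<times> 'x::topological_space) set \<Rightarrow> bool" where
  "random_gdelta M B \<longleftrightarrow>
     (\<exists>C. countable C \<and> C \<subseteq> Collect (random_open M) \<and> B = \<Inter>C)"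

lemma random_open_rect:
  assumes "R \<in> sets M" "open D"
  shows "random_open M (R \<times> D)"
  unfolding random_open_def using assms
  by (intro exI[of _ "{R \<times> D}"]) auto

lemma random_open_UN:
  assumes "countable I" "\<And>i. i \<in> I \<Longrightarrow> random_open M (U i)"
  shows "random_open M (\<Union>i\<in>I. U i)"
proof -
  have "\<forall>i\<in>I. \<exists>C. countable C \<and> C \<subseteq> {R \<times> D |R D. R \<in> sets M \<and> open D} \<and> U i = \<Union>C"
    using assms(2) unfolding random_open_def by simp
  from bchoice[OF this] obtain C where
    C: "\<forall>i\<in>I. countable (C i) \<and> C i \<subseteq> {R \<times> D |R D. R \<in> sets M \<and> open D} \<and> U i = \<Union>(C i)" ..
  have "(\<Union>i\<in>I. U i) = \<Union>(\<Union>i\<in>I. C i)" using C by auto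
  moreover have "countable (\<Union>i\<in>I. C i)" using C assms(1) by auto
  moreover have "(\<Union>i\<in>I. C i) \<subseteq> {R \<times> D |R D. R \<in> sets M \<and> open D}" using C by (auto 0 3)
  ultimately show ?thesis unfolding random_open_def by (intro exI conjI)
qed

lemma random_open_Un:
  assumes "random_open M A" "random_open M B"
  shows "random_open M (A \<union> B)"
  using random_open_UN[of "{A, B}" M "\<lambda>A. A"] assms by auto

lemma random_open_measurable:
  assumes "random_open M B"
  shows "B \<in> sets (M \<Otimes>\<^sub>M borel)"
proof -
  obtain C where C: "countable C" "C \<subseteq> {R \<times> D |R D. R \<in> sets M \<and> open D}" "B = \<Union>C"
    using assms unfolding random_open_def by auto
  show ?thesis unfolding C(3)
    using C(1)
  proof (rule sets.countable_Union)
    show "C \<subseteq> sets (M \<Otimes>\<^sub>M borel)" by (rule order_trans[OF C(2)]) auto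
  qed
qed

lemma random_gdelta_measurable:
  assumes "random_gdelta M B" "space M = UNIV"
  shows "B \<in> sets (M \<Otimes>\<^sub>M borel)"
proof -
  obtain C where C: "countable C" "C \<subseteq> Collect (random_open M)" "B = \<Inter>C"
    using assms(1) unfolding random_gdelta_def by auto
  have "(\<Inter>c\<in>C. c) \<in> sets (M \<Otimes>\<^sub>M borel)"
  \<comment> \<open>The empty intersection is \<open>UNIV\<close>, which is measurable because
    \<open>space M = UNIV\<close>.\<close>
  proof (cases "C = {}")
    case True
    then show ?thesis using sets.top[of "M \<Otimes>\<^sub>M borel"] assms(2) by (simp add: space_pair_measure)
  next
    case False
    then show ?thesis
      using C(1,2) by (intro sets.countable_INT') (auto intro: random_open_measurable)
  qed
  then show ?thesis using C(3) by simp
qed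

lemma random_open_gdelta:
  assumes "random_open M B"
  shows "random_gdelta M B"
  unfolding random_gdelta_def using assms by (intro exI[of _ "{B}"]) auto

lemma random_gdelta_INT:
  assumes "countable I" "\<And>i. i \<in> I \<Longrightarrow> random_gdelta M (B i)"
  shows "random_gdelta M (\<Inter>i\<in>I. B i)"
proof -
  have "\<forall>i\<in>I. \<exists>C. countable C \<and> C \<subseteq> Collect (random_open M) \<and> B i = \<Inter>C"
    using assms(2) unfolding random_gdelta_def by simp
  from bchoice[OF this] obtain C where
    C: "\<forall>i\<in>I. countable (C i) \<and> C i \<subseteq> Collect (random_open M) \<and> B i = \<Inter>(C i)" ..
  have "(\<Inter>i\<in>I. B i) = \<Inter>(\<Union>i\<in>I. C i)" using C by auto
  moreover have "countable (\<Union>i\<in>I. C i)" using C assms(1) by auto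
  moreover have "(\<Union>i\<in>I. C i) \<subseteq> Collect (random_open M)" using C by (auto 0 3)
  ultimately show ?thesis unfolding random_gdelta_def by (intro exI conjI)
qed

lemma random_gdelta_Int:
  assumes "random_gdelta M A" "random_gdelta M B"
  shows "random_gdelta M (A \<inter> B)"
  using random_gdelta_INT[of "{A, B}" M "\<lambda>A. A"] assms by auto

lemma random_gdelta_Un:
  assumes "random_gdelta M A" "random_gdelta M B"
  shows "random_gdelta M (A \<union> B)"
proof -
  obtain C where C: "countable C" "C \<subseteq> Collect (random_open M)" "A = \<Inter>C"
    using assms(1) unfolding random_gdelta_def by auto
  obtain C' where C': "countable C'" "C' \<subseteq> Collect (random_open M)" "B = \<Inter>C'"
    using assms(2) unfolding random_gdelta_def by auto
  have "A \<union> B = (\<Inter>c\<in>C. \<Inter>c'\<in>C'. c \<union> c')" unfolding C(3) C'(3) by auto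
  also have "random_gdelta M \<dots>"
    by (intro random_gdelta_INT random_open_gdelta random_open_Un C C') (use C C' in auto)
  finally show ?thesis .
qed

lemma random_gdelta_UN_finite:
  assumes "finite I" "\<And>i. i \<in> I \<Longrightarrow> random_gdelta M (B i)"
  shows "random_gdelta M (\<Union>i\<in>I. B i)"
  using assms
proof (induction I rule: finite_induct)
  case empty
  have "random_gdelta M ({} \<times> UNIV)"
    by (intro random_open_gdelta random_open_rect) auto
  then show ?case by simp
next
  case (insert i I) then show ?case by (auto intro: random_gdelta_Un)
qed

section \<open>Outer measure of arbitrary sets\<close>

definition outer :: "'w measure \<Rightarrow> 'w set \<Rightarrow> real" where
  "outer M A = (INF S\<in>{S \<in> sets M. A \<subseteq> S}. measure M S)"

context finite_measure
begin

lemma outer_le: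
  assumes "A \<subseteq> S" "S \<in> sets M"
  shows "outer M A \<le> measure M S"
  unfolding outer_def using assms by (intro cINF_lower bdd_belowI[of _ 0]) auto

lemma outer_hull:
  assumes "A \<subseteq> space M"
  obtains H where "H \<in> sets M" "A \<subseteq> H" "measure M H = outer M A"
proof -
  let ?C = "{S \<in> sets M. A \<subseteq> S}"
  have ne: "?C \<noteq> {}" using assms by auto
  have "\<exists>S\<in>?C. measure M S < outer M A + 1 / real (Suc n)" for n
  proof -
    have "(INF S\<in>?C. measure M S) < outer M A + 1 / real (Suc n)"
      unfolding outer_def by simp
    then show ?thesis using cINF_less_iff[OF ne, of "measure M"] bdd_belowI2[of ?C 0 "measure M"] by simp
  qed
  then have "\<forall>n. \<exists>S. S \<in> ?C \<and> measure M S < outer M A + 1 / real (Suc n)" by blast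
  from choice[OF this] obtain S where
    S: "\<And>n. S n \<in> sets M" "\<And>n. A \<subseteq> S n" "\<And>n. measure M (S n) < outer M A + 1 / real (Suc n)"
    by auto
  let ?H = "\<Inter>n. S n"
  have H: "?H \<in> sets M" using S(1) by auto
  have "measure M ?H \<le> outer M A + 1 / real (Suc n)" for n
    using finite_measure_mono[of ?H "S n"] S(1,3)[of n] by (meson INT_lower UNIV_I less_le order_trans)
  then have "measure M ?H \<le> outer M A"
    by (intro LIMSEQ_le_const[of "\<lambda>n. outer M A + 1 / real (Suc n)"])
      (use tendsto_add[OF tendsto_const LIMSEQ_inverse_real_of_nat] in \<open>auto simp: inverse_eq_divide\<close>)
  moreover have "outer M A \<le> measure M ?H" using S(2) H by (intro outer_le) auto
  ultimately show ?thesis using that[of ?H] H S(2) by auto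
qed

text \<open>Measurable hulls of the \<open>A n\<close> need not increase, but the tail intersections
  of the hulls do; they still cover and have no larger measure, so continuity from below for
  measurable sets applies to them.\<close>

lemma outer_incseq:
  assumes "incseq A" "\<And>n. A n \<subseteq> space M" "0 < e"
  shows "\<exists>n. outer M (\<Union>n. A n) - e < outer M (A n)"
proof (rule ccontr)
  assume "\<not> ?thesis"
  then have le: "\<And>n. outer M (A n) \<le> outer M (\<Union>n. A n) - e" by (auto simp: not_less)
  have "\<forall>n. \<exists>H. H \<in> sets M \<and> A n \<subseteq> H \<and> measure M H = outer M (A n)"
    using outer_hull[OF assms(2)] by metis
  from choice[OF this] obtain H where
    H: "\<And>n. H n \<in> sets M" "\<And>n. A n \<subseteq> H n" "\<And>n. measure M (H n) = outer M (A n)"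
    by auto
  let ?G = "\<lambda>n. \<Inter>k\<in>{n..}. H k"
  have G: "?G n \<in> sets M" for n using H(1) by (intro sets.countable_INT') auto
  have "A n \<subseteq> ?G n" for n
  proof (rule INT_greatest)
    fix k assume "k \<in> {n..}"
    then show "A n \<subseteq> H k" using H(2)[of k] assms(1) unfolding incseq_def by auto
  qed
  then have "(\<Union>n. A n) \<subseteq> (\<Union>n. ?G n)" by (intro UN_mono) auto
  then have "outer M (\<Union>n. A n) \<le> measure M (\<Union>n. ?G n)" using G by (intro outer_le) auto
  also have "\<dots> \<le> outer M (\<Union>n. A n) - e"
  proof (rule LIMSEQ_le_const2)
    show "(\<lambda>n. measure M (?G n)) \<longlonglongrightarrow> measure M (\<Union>n. ?G n)"
      using G by (intro finite_Lim_measure_incseq) (auto simp: incseq_def)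
    have "measure M (?G n) \<le> measure M (H n)" for n using H(1) by (intro finite_measure_mono) auto
    then have "measure M (?G n) \<le> outer M (\<Union>n. A n) - e" for n
      using le[of n] H(3)[of n] by (metis order_trans)
    then show "\<exists>N. \<forall>n\<ge>N. measure M (?G n) \<le> outer M (\<Union>n. A n) - e" by auto
  qed
  finally show False using assms(3) by simp
qed

end

text \<open>Projections of random sets are measurable only for the completion. This trades them for
  covers in \<open>M\<close> itself at no cost in measure.\<close>

lemma (in finite_measure) measurable_covers_tendsto_0:
  assumes P: "\<And>k::nat. P k \<in> sets (completion M)" and dec: "decseq P" and null: "AE w in M. w \<notin> (\<Inter>k. P k)"
  obtains H where "\<And>k. H k \<in> sets M" "\<And>k. P k \<subseteq> H k" "(\<lambda>k. measure M (H k)) \<longlonglongrightarrow> 0"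
proof -
  interpret cm: finite_measure "completion M"
    by standard (use emeasure_completion[OF sets.top, of M] in simp)
  have "(\<Inter>k. P k) \<in> null_sets (completion M)"
    using AE_completion[OF null] P by (subst AE_iff_null_sets) auto
  then have lim: "(\<lambda>k. measure (completion M) (P k)) \<longlonglongrightarrow> 0"
    using cm.finite_Lim_measure_decseq[OF _ dec] P by (simp add: image_subset_iff measure_eq_0_null_sets)
  have "\<forall>k. \<exists>H. H \<in> sets M \<and> P k \<subseteq> H \<and> measure (completion M) (P k) = measure M H"
  proof
    fix k
    obtain H where "P k \<subseteq> H" "H \<in> sets M" "emeasure (completion M) (P k) = emeasure M H"
      using completion_upper[OF P[of k]] by metis
    then show "\<exists>H. H \<in> sets M \<and> P k \<subseteq> H \<and> measure (completion M) (P k) = measure M H"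
      by (auto simp: measure_def)
  qed
  from choice[OF this] obtain H where
    H: "\<And>k. H k \<in> sets M" "\<And>k. P k \<subseteq> H k" "\<And>k. measure (completion M) (P k) = measure M (H k)" by auto
  show ?thesis using that[of H] H lim by simp
qed

text \<open>Closed pieces of small diameter are wanted so that a sequence running through one piece
  of each level is Cauchy and its limit stays in all of them.\<close>

lemma random_open_small_closed:
  fixes B :: "('w \<times> 'x::{metric_space, second_countable_topology}) set"
  assumes "random_open M B" "0 < e"
  shows "\<exists>R D. (\<forall>j::nat. R j \<in> sets M \<and> closed (D j) \<and> (\<forall>x\<in>D j. \<forall>y\<in>D j. dist x y \<le> e)) \<and>
           B = (\<Union>j. R j \<times> D j)"
proof -
  obtain C where C: "countable C" "C \<subseteq> {R \<times> D |R D. R \<in> sets M \<and> open D}" "B = \<Union>C"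
    using assms(1) unfolding random_open_def by auto
  have "\<forall>c\<in>C. \<exists>p. c = fst p \<times> snd p \<and> fst p \<in> sets M \<and> open (snd p)"
  proof
    fix c assume "c \<in> C"
    then obtain R D where "c = R \<times> D" "R \<in> sets M" "open D" using subsetD[OF C(2)] by blast
    then show "\<exists>p. c = fst p \<times> snd p \<and> fst p \<in> sets M \<and> open (snd p)"
      by (intro exI[of _ "(R, D)"]) simp
  qed
  from bchoice[OF this] obtain p where
    p: "\<And>c. c \<in> C \<Longrightarrow> c = fst (p c) \<times> snd (p c)" "\<And>c. c \<in> C \<Longrightarrow> fst (p c) \<in> sets M"
       "\<And>c. c \<in> C \<Longrightarrow> open (snd (p c))"
    by auto
  obtain Q :: "'x set" where Q: "countable Q" "\<And>X. open X \<Longrightarrow> X \<noteq> {} \<Longrightarrow> \<exists>d\<in>Q. d \<in> X"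
    using countable_dense_exists by blast
  define K where "K = {(c, q, n). c \<in> C \<and> q \<in> Q \<and> cball q (inverse (real (Suc n))) \<subseteq> snd (p c) \<and>
      2 * inverse (real (Suc n)) \<le> e}"
  \<comment> \<open>The empty rectangle makes \<open>P\<close> nonempty, so that
    \<open>from_nat_into\<close> enumerates it even when \<open>B\<close> is empty.\<close>
  define P where "P = insert ({}, {}) ((\<lambda>(c, q, n). (fst (p c), cball q (inverse (real (Suc n))))) ` K)"
  have "K \<subseteq> C \<times> Q \<times> UNIV" unfolding K_def by auto
  then have "countable K" using C(1) Q(1) by (meson countable_SIGMA countable_subset uncountable_def countableI_type)
  then have P: "countable P" "P \<noteq> {}" unfolding P_def by auto
  have Pprop: "R \<in> sets M \<and> closed D \<and> (\<forall>x\<in>D. \<forall>y\<in>D. dist x y \<le> e)" if RD: "(R, D) \<in> P" for R D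
  proof (cases "D = {}")
    case True
    then show ?thesis using RD p unfolding P_def K_def by auto
  next
    case False
    then obtain c q n where cqn: "(c, q, n) \<in> K" "R = fst (p c)" "D = cball q (inverse (real (Suc n)))"
      using RD unfolding P_def by auto
    have "dist x y \<le> e" if "x \<in> D" "y \<in> D" for x y
    proof -
      have "dist x y \<le> dist q x + dist q y" by (metis dist_commute dist_triangle)
      also have "\<dots> \<le> 2 * inverse (real (Suc n))" using that cqn(3) by auto
      also have "\<dots> \<le> e" using cqn(1) unfolding K_def by simp
      finally show ?thesis .
    qed
    then show ?thesis using cqn p unfolding K_def by auto
  qed
  have B: "B = (\<Union>(R, D)\<in>P. R \<times> D)"
  proof (rule set_eqI, rule iffI)
    fix z assume "z \<in> B"
    then obtain c where c: "c \<in> C" "z \<in> c" using C(3) by auto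
    obtain w x where z: "z = (w, x)" by (cases z)
    have wx: "w \<in> fst (p c)" "x \<in> snd (p c)" using p(1)[OF c(1)] c(2) z by auto
    obtain d where d: "0 < d" "ball x d \<subseteq> snd (p c)" using p(3)[OF c(1)] wx(2) open_contains_ball by blast
    obtain n where n: "inverse (real (Suc n)) < min d e / 2" using reals_Archimedean[of "min d e / 2"] d(1) assms(2) by auto
    obtain q where q: "q \<in> Q" "q \<in> ball x (inverse (real (Suc n)))"
      using Q(2)[of "ball x (inverse (real (Suc n)))"] by auto
    have "cball q (inverse (real (Suc n))) \<subseteq> ball x d"
    proof
      fix y assume "y \<in> cball q (inverse (real (Suc n)))"
      then have "dist x y < 2 * inverse (real (Suc n))"
        using q(2) dist_triangle[of x y q] by auto
      then show "y \<in> ball x d" using n by simp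
    qed
    then have "(c, q, n) \<in> K" unfolding K_def using c q d n by auto
    then have "(fst (p c), cball q (inverse (real (Suc n)))) \<in> P" unfolding P_def by force
    moreover have "z \<in> fst (p c) \<times> cball q (inverse (real (Suc n)))"
      using z wx q(2) by (auto simp: dist_commute)
    ultimately show "z \<in> (\<Union>(R, D)\<in>P. R \<times> D)" by blast
  next
    fix z assume "z \<in> (\<Union>(R, D)\<in>P. R \<times> D)"
    then obtain c q n where cqn: "(c, q, n) \<in> K" "z \<in> fst (p c) \<times> cball q (inverse (real (Suc n)))"
      unfolding P_def by auto
    then have "c \<in> C" "z \<in> fst (p c) \<times> snd (p c)" unfolding K_def by auto
    then show "z \<in> B" using p(1) C(3) by auto
  qed
  also have "\<dots> = (\<Union>z\<in>range (from_nat_into P). fst z \<times> snd z)"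
    unfolding range_from_nat_into[OF P(2,1)] by auto
  also have "\<dots> = (\<Union>j. fst (from_nat_into P j) \<times> snd (from_nat_into P j))"
    by (simp only: image_image)
  finally have "B = (\<Union>j. fst (from_nat_into P j) \<times> snd (from_nat_into P j))" .
  moreover have "fst (from_nat_into P j) \<in> sets M \<and> closed (snd (from_nat_into P j)) \<and>
     (\<forall>x\<in>snd (from_nat_into P j). \<forall>y\<in>snd (from_nat_into P j). dist x y \<le> e)" for j
    using Pprop[of "fst (from_nat_into P j)" "snd (from_nat_into P j)"] from_nat_into[OF P(2)] by simp
  ultimately show ?thesis
    by (intro exI[of _ "\<lambda>j. fst (from_nat_into P j)"] exI[of _ "\<lambda>j. snd (from_nat_into P j)"]) simp
qed


text \<open>Bounding the indices one after the other costs little outer measure, and the resulting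
  finitely branching tree of closed sets has an infinite branch.\<close>

lemma (in finite_measure) section_on_large_set:
  fixes D :: "nat \<Rightarrow> nat \<Rightarrow> 'x::{complete_space, second_countable_topology} set"
  assumes R: "\<And>m j. R m j \<in> sets M"
    and closed_D: "\<And>m j. closed (D m j)"
    and small: "\<And>m j x y. x \<in> D m j \<Longrightarrow> y \<in> D m j \<Longrightarrow> dist x y \<le> inverse (real (Suc m))"
    and A: "A = {w \<in> space M. \<exists>x. \<forall>m. \<exists>j. w \<in> R m j \<and> x \<in> D m j}"
    and "0 < e"
  shows "\<exists>K\<in>sets M. \<exists>v\<in>borel_measurable M. K \<subseteq> A \<and> outer M A - e \<le> measure M K \<and>
           (\<forall>w\<in>K. \<forall>m. \<exists>j. w \<in> R m j \<and> v w \<in> D m j)"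
proof -
  \<comment> \<open>The points that have a full index sequence whose first \<open>n\<close> entries
    are bounded by \<open>N\<close>. These sets need not be measurable, hence the outer
    measure.\<close>
  define A' where "A' n N = {w \<in> space M. \<exists>x s. (\<forall>m. w \<in> R m (s m) \<and> x \<in> D m (s m)) \<and> (\<forall>m<n. s m \<le> N m)}"
    for n and N :: "nat \<Rightarrow> nat"
  have A'0: "A' 0 N = A" for N
  proof -
    have "(\<exists>s. \<forall>m. w \<in> R m (s m) \<and> x \<in> D m (s m)) \<longleftrightarrow> (\<forall>m. \<exists>j. w \<in> R m j \<and> x \<in> D m j)" for w x
      by (rule choice_iff[symmetric])
    then show ?thesis unfolding A'_def A by simp
  qed
  have A'_cong: "A' n N = A' n N'" if "\<And>m. m < n \<Longrightarrow> N m = N' m" for n N N'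
    unfolding A'_def using that by auto
  have step: "\<exists>k. outer M (A' n N) - d < outer M (A' (Suc n) (N(n := k)))" if "0 < d" for n N d
  proof -
    have inc: "incseq (\<lambda>k. A' (Suc n) (N(n := k)))"
    proof (rule incseq_SucI, rule subsetI)
      fix k w assume "w \<in> A' (Suc n) (N(n := k))"
      then obtain x s where "w \<in> space M" "\<And>m. w \<in> R m (s m) \<and> x \<in> D m (s m)" "\<forall>m<Suc n. s m \<le> (N(n := k)) m"
        unfolding A'_def by blast
      then show "w \<in> A' (Suc n) (N(n := Suc k))"
        unfolding A'_def by (auto intro!: exI[of _ x] exI[of _ s] simp: less_Suc_eq_le split: if_splits)
    qed
    have "(\<Union>k. A' (Suc n) (N(n := k))) = A' n N"
    proof (rule set_eqI, rule iffI)
      fix w assume "w \<in> (\<Union>k. A' (Suc n) (N(n := k)))"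
      then obtain k x s where "w \<in> space M" "\<And>m. w \<in> R m (s m) \<and> x \<in> D m (s m)" "\<forall>m<Suc n. s m \<le> (N(n := k)) m"
        unfolding A'_def by blast
      then show "w \<in> A' n N" unfolding A'_def
        by (auto intro!: exI[of _ x] exI[of _ s] simp: less_Suc_eq split: if_splits)
    next
      fix w assume "w \<in> A' n N"
      then obtain x s where "w \<in> space M" "\<And>m. w \<in> R m (s m) \<and> x \<in> D m (s m)" "\<forall>m<n. s m \<le> N m"
        unfolding A'_def by blast
      then have "w \<in> A' (Suc n) (N(n := s n))" unfolding A'_def
        by (auto intro!: exI[of _ x] exI[of _ s] simp: less_Suc_eq)
      then show "w \<in> (\<Union>k. A' (Suc n) (N(n := k)))" by auto
    qed
    then show ?thesis using outer_incseq[OF inc _ that] unfolding A'_def by auto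
  qed
  define d where "d n = e * (1/2) ^ Suc n" for n
  have d_pos: "0 < d n" for n unfolding d_def using \<open>0 < e\<close> by simp
  define next_bound where "next_bound n N = (SOME k. outer M (A' n N) - d n < outer M (A' (Suc n) (N(n := k))))" for n N
  \<comment> \<open>Stage \<open>n\<close> chooses the bound at index \<open>n\<close> only, so the
    bounds below \<open>n\<close> never change again and the diagonal \<open>N\<close> agrees with
    all stages.\<close>
  define NN where "NN = rec_nat (\<lambda>_. 0::nat) (\<lambda>n N. N(n := next_bound n N))"
  have NN_Suc: "NN (Suc n) = (NN n)(n := next_bound n (NN n))" for n unfolding NN_def by simp
  define N where "N n = NN (Suc n) n" for n
  have NN_stable: "NN n m = N m" if "m < n" for n m
    using that by (induction n) (auto simp: NN_Suc N_def less_Suc_eq)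
  have A'_NN: "A' n (NN n) = A' n N" for n by (rule A'_cong) (rule NN_stable)
  have outer_step: "outer M (A' n N) - d n < outer M (A' (Suc n) N)" for n
  proof -
    have "outer M (A' n (NN n)) - d n < outer M (A' (Suc n) ((NN n)(n := next_bound n (NN n))))"
      unfolding next_bound_def by (rule someI_ex[OF step[OF d_pos]])
    then show ?thesis unfolding NN_Suc[symmetric] A'_NN .
  qed
  have sum_d: "(\<Sum>i<n. d i) = e * (1 - (1/2) ^ n)" for n
    by (induction n) (auto simp: d_def algebra_simps)
  have outer_n: "outer M A - e \<le> outer M (A' n N)" for n
  proof -
    have "outer M A - (\<Sum>i<n. d i) \<le> outer M (A' n N)"
    proof (induction n)
      case 0 then show ?case by (simp add: A'0)
    next
      case (Suc n) then show ?case using outer_step[of n] by simp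
    qed
    moreover have "(\<Sum>i<n. d i) \<le> e" unfolding sum_d using \<open>0 < e\<close> by (simp add: algebra_simps)
    ultimately show ?thesis by linarith
  qed
  \<comment> \<open>A common point is asked for the closed pieces of a finite word, not of a whole
    branch; completeness supplies the point of an infinite branch.\<close>
  define compat where "compat s \<longleftrightarrow> (\<exists>x. \<forall>i<length s. x \<in> D i (s ! i))" for s :: "nat list"
  define adm where "adm s = {w \<in> space M. \<forall>i<length s. w \<in> R i (s ! i)}" for s :: "nat list"
  define Bd where "Bd n = {s. length s = n \<and> (\<forall>i<n. s ! i \<le> N i) \<and> compat s}" for n
  have adm: "adm s \<in> sets M" for s
  proof -
    have "adm s = space M \<inter> (\<Inter>i\<in>{..<length s}. R i (s ! i) \<inter> space M)" unfolding adm_def by auto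
    moreover have "(\<Inter>i\<in>{..<length s}. R i (s ! i) \<inter> space M) \<inter> space M \<in> sets M"
      using R by (cases "length s = 0") (auto intro!: sets.Int sets.countable_INT')
    ultimately show ?thesis by (simp add: Int_commute)
  qed
  have fin_Bd: "finite (Bd n)" for n
  proof (rule finite_subset)
    show "Bd n \<subseteq> {s. set s \<subseteq> {..Max (N ` {..<n})} \<and> length s = n}"
    proof (rule subsetI, rule CollectI, rule conjI)
      fix s assume s: "s \<in> Bd n"
      then show "length s = n" unfolding Bd_def by simp
      show "set s \<subseteq> {..Max (N ` {..<n})}"
      proof
        fix y assume "y \<in> set s"
        then obtain i where "i < n" "y = s ! i" using s unfolding Bd_def by (auto simp: in_set_conv_nth)
        then have "y \<le> N i" "N i \<le> Max (N ` {..<n})" using s unfolding Bd_def by auto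
        then show "y \<in> {..Max (N ` {..<n})}" by simp
      qed
    qed
    show "finite {s. set s \<subseteq> {..Max (N ` {..<n})} \<and> length s = n}" by (rule finite_lists_length_eq) simp
  qed
  have take_Bd: "take m s \<in> Bd m" if s: "s \<in> Bd n" "m \<le> n" for s m n
  proof -
    obtain x where "\<forall>i<length s. x \<in> D i (s ! i)" using s unfolding Bd_def compat_def by auto
    then have "compat (take m s)" unfolding compat_def by (intro exI[of _ x]) simp
    then show ?thesis using s unfolding Bd_def by simp
  qed
  have take_adm: "adm s \<subseteq> adm (take m s)" for s m
    unfolding adm_def by auto
  \<comment> \<open>Base points over which \<open>s\<close> has admissible extensions of every
    length. Finiteness of \<open>Bd n\<close> makes this a countable combination of measurable
    sets.\<close>
  define ext where "ext s = {w \<in> space M. \<forall>n\<ge>length s. \<exists>t\<in>Bd n. take (length s) t = s \<and> w \<in> adm t}" for s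
  have ext: "ext s \<in> sets M" for s
  proof -
    have "ext s = (\<Inter>n\<in>{length s..}. \<Union>t\<in>{t\<in>Bd n. take (length s) t = s}. adm t)"
      unfolding ext_def adm_def by (auto 0 3)
    also have "\<dots> \<in> sets M"
      using adm fin_Bd by (intro sets.countable_INT' sets.finite_UN) auto
    finally show ?thesis .
  qed
  define K where "K = ext []"
  \<comment> \<open>Koenig's lemma: the entries allowed after \<open>s\<close> are bounded by
    \<open>N (length s)\<close>. If each child failed at some length, a word beyond the largest of
    these finitely many lengths would pass through a child that does not fail.\<close>
  have extend: "\<exists>j. w \<in> ext (s @ [j])" if w: "w \<in> ext s" for w s
  proof (rule ccontr)
    assume "\<not> ?thesis"
    then have "\<forall>j. \<exists>n. Suc (length s) \<le> n \<and> (\<forall>t\<in>Bd n. take (Suc (length s)) t = s @ [j] \<longrightarrow> w \<notin> adm t)"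
      using w unfolding ext_def by auto
    from choice[OF this] obtain n where
      n: "\<And>j. Suc (length s) \<le> n j" "\<And>j t. t \<in> Bd (n j) \<Longrightarrow> take (Suc (length s)) t = s @ [j] \<Longrightarrow> w \<notin> adm t"
      by auto
    define nn where "nn = Max (n ` {..N (length s)})"
    have nn: "n j \<le> nn" if "j \<le> N (length s)" for j unfolding nn_def using that by auto
    have "length s \<le> nn" using nn[of 0] n(1)[of 0] by simp
    then obtain t where t: "t \<in> Bd nn" "take (length s) t = s" "w \<in> adm t"
      using w unfolding ext_def by auto
    define j where "j = t ! length s"
    have len: "length s < nn" "length t = nn" using nn[of 0] n(1)[of 0] t(1) unfolding Bd_def by auto
    then have j: "j \<le> N (length s)" using t(1) unfolding Bd_def j_def by auto
    have "take (Suc (length s)) t = s @ [j]"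
      using t(2) len unfolding j_def by (simp add: take_Suc_conv_app_nth)
    then have "take (Suc (length s)) (take (n j) t) = s @ [j]" using n(1)[of j] by (simp add: min_absorb1)
    then show False
      using n(2)[of "take (n j) t" j] take_Bd[OF t(1) nn[OF j]] take_adm t(3) by blast
  qed
  \<comment> \<open>The leftmost infinite branch; taking the least index makes it depend measurably
    on \<open>w\<close>.\<close>
  define br where "br w = rec_nat [] (\<lambda>_ s. s @ [LEAST j. w \<in> ext (s @ [j])])" for w
  have br_Suc: "br w (Suc n) = br w n @ [LEAST j. w \<in> ext (br w n @ [j])]" for w n
    unfolding br_def by simp
  have br_0: "br w 0 = []" for w unfolding br_def by simp
  have br_ext: "w \<in> ext (br w n)" if "w \<in> K" for w n
  proof (induction n)
    case 0 then show ?case using that by (simp add: br_0 K_def)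
  next
    case (Suc n) then show ?case unfolding br_Suc
      by (intro LeastI_ex[of "\<lambda>j. w \<in> ext (br w n @ [j])"]) (rule extend)
  qed
  have len_br: "length (br w n) = n" for w n by (induction n) (auto simp: br_0 br_Suc)
  have br_take: "take m (br w n) = br w m" if "m \<le> n" for w m n
    using that by (induction n) (auto simp: br_0 br_Suc len_br le_Suc_eq)
  have br_meas: "{w \<in> K. br w n = s} \<in> sets M" for n s
  proof (induction n arbitrary: s)
    case 0
    have "{w \<in> K. br w 0 = s} = (if s = [] then K else {})" by (auto simp: br_0)
    then show ?case using ext K_def by simp
  next
    case (Suc n)
    show ?case
    proof (cases "s = []")
      case True
      then have "{w \<in> K. br w (Suc n) = s} = {}" by (simp add: br_Suc)
      then show ?thesis by (simp only: sets.empty_sets)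
    next
      case False
      then obtain s' j where s: "s = s' @ [j]" by (metis rev_exhaust)
      have "{w \<in> K. br w (Suc n) = s} = {w \<in> K. br w n = s'} \<inter> (ext (s' @ [j]) - (\<Union>i<j. ext (s' @ [i])))"
      proof (rule set_eqI, rule iffI)
        fix w assume w: "w \<in> {w \<in> K. br w (Suc n) = s}"
        then have *: "br w n = s'" "j = (LEAST j. w \<in> ext (s' @ [j]))" using s unfolding br_Suc by auto
        have "w \<in> ext (s' @ [j])" unfolding *(2)
          using LeastI_ex[OF extend[OF br_ext[of w n]]] w *(1) by simp
        then show "w \<in> {w \<in> K. br w n = s'} \<inter> (ext (s' @ [j]) - (\<Union>i<j. ext (s' @ [i])))"
          using w *(1) not_less_Least[of _ "\<lambda>j. w \<in> ext (s' @ [j])"] unfolding *(2)[symmetric] by auto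
      next
        fix w assume w: "w \<in> {w \<in> K. br w n = s'} \<inter> (ext (s' @ [j]) - (\<Union>i<j. ext (s' @ [i])))"
        then have "(LEAST j. w \<in> ext (s' @ [j])) = j"
          by (intro Least_equality) (auto simp: not_less[symmetric])
        then show "w \<in> {w \<in> K. br w (Suc n) = s}" using w s by (simp add: br_Suc)
      qed
      then show ?thesis using Suc[of s'] ext by auto
    qed
  qed
  define pt where "pt s = (SOME x. \<forall>i<length s. x \<in> D i (s ! i))" for s
  define vn where "vn n w = (if w \<in> K then pt (br w n) else undefined)" for n w
  have K_sets: "K \<in> sets M" unfolding K_def by (rule ext)
  have Bd_br: "br w n \<in> Bd n" "w \<in> adm (br w n)" if "w \<in> K" for w n
    using br_ext[OF that, of n] unfolding ext_def by (auto simp: len_br Bd_def)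
  have pt_in: "vn n w \<in> D i (br w n ! i)" if "w \<in> K" "i < n" for w n i
  proof -
    have "compat (br w n)" using Bd_br(1)[OF that(1)] unfolding Bd_def by simp
    then have "\<forall>i<length (br w n). pt (br w n) \<in> D i (br w n ! i)"
      unfolding compat_def pt_def by (rule someI_ex)
    then show ?thesis using that unfolding vn_def len_br by simp
  qed
  have br_nth: "br w n ! i = br w (Suc i) ! i" if "i < n" for w n i
    using br_take[of "Suc i" n w] that by (metis Suc_leI lessI nth_take)
  have pt_in': "vn n w \<in> D i (br w (Suc i) ! i)" if "w \<in> K" "i < n" for w n i
    using pt_in[OF that] br_nth[OF that(2)] by simp
  have vn_meas: "vn n \<in> borel_measurable M" for n
  proof (rule measurableI)
    fix U :: "'x set" assume "U \<in> sets borel"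
    have "vn n -` U \<inter> space M = (\<Union>s\<in>{s. pt s \<in> U}. {w \<in> K. br w n = s}) \<union> (if undefined \<in> U then space M - K else {})"
      using sets.sets_into_space[OF K_sets] unfolding vn_def by (auto split: if_splits)
    also have "\<dots> \<in> sets M"
      using br_meas K_sets by (intro sets.Un sets.countable_UN') auto
    finally show "vn n -` U \<inter> space M \<in> sets M" .
  qed simp
  have cauchy: "Cauchy (\<lambda>n. vn n w)" if "w \<in> K" for w
  proof (rule metric_CauchyI)
    fix r :: real assume "0 < r"
    then obtain m where m: "inverse (real (Suc m)) < r" using reals_Archimedean by blast
    have "dist (vn i w) (vn j w) < r" if "i > m" "j > m" for i j
      using small[OF pt_in'[OF \<open>w \<in> K\<close> that(1)] pt_in'[OF \<open>w \<in> K\<close> that(2)]] m by simp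
    then show "\<exists>M. \<forall>i\<ge>M. \<forall>j\<ge>M. dist (vn i w) (vn j w) < r" by (intro exI[of _ "Suc m"]) auto
  qed
  have conv: "convergent (\<lambda>n. vn n w)" for w
    using cauchy[of w] Cauchy_convergent by (cases "w \<in> K") (auto simp: vn_def convergent_const)
  define v where "v w = lim (\<lambda>n. vn n w)" for w
  have v: "(\<lambda>n. vn n w) \<longlonglongrightarrow> v w" for w using conv unfolding v_def by (simp add: convergent_LIMSEQ_iff)
  have v_meas: "v \<in> borel_measurable M" by (rule borel_measurable_LIMSEQ_metric[OF vn_meas v])
  have v_in: "w \<in> R m (br w (Suc m) ! m) \<and> v w \<in> D m (br w (Suc m) ! m)" if "w \<in> K" for w m
  proof
    show "w \<in> R m (br w (Suc m) ! m)" using Bd_br(2)[OF that, of "Suc m"] unfolding adm_def by (simp add: len_br)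
    show "v w \<in> D m (br w (Suc m) ! m)"
      by (rule Lim_in_closed_set[OF closed_D _ _ v])
        (use pt_in'[OF that] in \<open>auto intro!: eventually_sequentiallyI[of "Suc m"]\<close>)
  qed
  have KA: "K \<subseteq> A"
    unfolding A using v_in sets.sets_into_space[OF K_sets] by blast
  have "outer M A - e \<le> measure M K"
  proof -
    \<comment> \<open>The sets \<open>Kn n\<close> are measurable, decrease to \<open>K\<close> and
      contain \<open>A' n N\<close>; this passes the bound on outer measures to
      \<open>measure M K\<close>.\<close>
    define Kn where "Kn n = (\<Union>t\<in>Bd n. adm t)" for n
    have Kn_sets: "Kn n \<in> sets M" for n unfolding Kn_def using adm fin_Bd by auto
    have dec: "decseq Kn"
    proof (rule decseq_SucI, rule subsetI)
      fix n w assume "w \<in> Kn (Suc n)"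
      then obtain t where "t \<in> Bd (Suc n)" "w \<in> adm t" unfolding Kn_def by auto
      then show "w \<in> Kn n" unfolding Kn_def using take_Bd[of t "Suc n" n] take_adm[of t n] by auto
    qed
    have "K = (\<Inter>n. Kn n)" unfolding K_def ext_def Kn_def adm_def by (auto 0 3)
    then have lim: "(\<lambda>n. measure M (Kn n)) \<longlonglongrightarrow> measure M K"
      using finite_Lim_measure_decseq[OF _ dec] Kn_sets by (auto simp: image_subset_iff)
    have "A' n N \<subseteq> Kn n" for n
    proof
      fix w assume "w \<in> A' n N"
      then obtain x s where xs: "w \<in> space M" "\<And>m. w \<in> R m (s m) \<and> x \<in> D m (s m)" "\<forall>m<n. s m \<le> N m"
        unfolding A'_def by blast
      have "map s [0..<n] \<in> Bd n" "w \<in> adm (map s [0..<n])"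
        using xs unfolding Bd_def compat_def adm_def by auto
      then show "w \<in> Kn n" unfolding Kn_def by blast
    qed
    then have "outer M A - e \<le> measure M (Kn n)" for n
      using outer_n[of n] outer_le[OF _ Kn_sets] order_trans by blast
    then show ?thesis by (intro LIMSEQ_le_const[OF lim]) auto
  qed
  then show ?thesis using K_sets v_meas KA v_in by blast
qed

text \<open>Sections over measurable sets that miss outer measure at most \<open>1 / (n + 1)\<close>
  are glued by the least index. Their domains exhaust the outer measure of the projection, so the
  projection is squeezed between \<open>S\<close> and a hull of the same measure.\<close>

theorem (in finite_measure) measurable_section:
  fixes B :: "('a \<times> 'x::{complete_space, second_countable_topology}) set"
  assumes "random_gdelta M B" and UNIV: "space M = UNIV"
  obtains v S where "v \<in> borel_measurable M" "S \<in> sets M" "S \<subseteq> fst ` B"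
    "\<And>w. w \<in> S \<Longrightarrow> (w, v w) \<in> B" "outer M (fst ` B) = measure M S"
proof -
  obtain C where C: "countable C" "C \<subseteq> Collect (random_open M)" "B = \<Inter>C"
    using assms(1) unfolding random_gdelta_def by auto
  define C' where "C' = insert UNIV C"
  have "random_open M (UNIV \<times> UNIV :: ('a \<times> 'x) set)"
    using sets.top[of M] UNIV by (intro random_open_rect) auto
  then have C': "countable C'" "C' \<noteq> {}" "\<And>c. c \<in> C' \<Longrightarrow> random_open M c" "B = \<Inter>C'"
    using C unfolding C'_def by auto
  define U where "U = from_nat_into C'"
  have U: "random_open M (U m)" for m unfolding U_def by (intro C' from_nat_into)
  have B: "B = (\<Inter>m. U m)" unfolding U_def C'(4) using range_from_nat_into[OF C'(2,1)] by simp
  have "\<forall>m. \<exists>p. (\<forall>j::nat. fst p j \<in> sets M \<and> closed (snd p j) \<and>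
      (\<forall>x\<in>snd p j. \<forall>y\<in>snd p j. dist x y \<le> inverse (real (Suc m)))) \<and> U m = (\<Union>j. fst p j \<times> snd p j)"
  proof
    fix m
    obtain R D where "\<forall>j::nat. R j \<in> sets M \<and> closed (D j) \<and> (\<forall>x\<in>D j. \<forall>y\<in>D j. dist x y \<le> inverse (real (Suc m)))"
      "U m = (\<Union>j. R j \<times> D j)"
      using random_open_small_closed[OF U, of "inverse (real (Suc m))" m] by auto
    then show "\<exists>p. (\<forall>j::nat. fst p j \<in> sets M \<and> closed (snd p j) \<and>
      (\<forall>x\<in>snd p j. \<forall>y\<in>snd p j. dist x y \<le> inverse (real (Suc m)))) \<and> U m = (\<Union>j. fst p j \<times> snd p j)"
      by (intro exI[of _ "(R, D)"]) simp
  qed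
  from choice[OF this] obtain p where
    pp: "\<forall>m. (\<forall>j::nat. fst (p m) j \<in> sets M \<and> closed (snd (p m) j) \<and>
      (\<forall>x\<in>snd (p m) j. \<forall>y\<in>snd (p m) j. dist x y \<le> inverse (real (Suc m)))) \<and>
      U m = (\<Union>j. fst (p m) j \<times> snd (p m) j)" ..
  have p: "\<And>m j. fst (p m) j \<in> sets M" "\<And>m j. closed (snd (p m) j)"
    "\<And>m j x y. x \<in> snd (p m) j \<Longrightarrow> y \<in> snd (p m) j \<Longrightarrow> dist x y \<le> inverse (real (Suc m))"
    "\<And>m. U m = (\<Union>j. fst (p m) j \<times> snd (p m) j)"
    using pp by simp_all
  have B_iff: "(w, x) \<in> B \<longleftrightarrow> (\<forall>m. \<exists>j. w \<in> fst (p m) j \<and> x \<in> snd (p m) j)" for w x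
    unfolding B p(4) by auto
  define A where "A = fst ` B"
  have A: "A = {w \<in> space M. \<exists>x. \<forall>m. \<exists>j. w \<in> fst (p m) j \<and> x \<in> snd (p m) j}"
    unfolding A_def by (auto simp: UNIV B_iff[symmetric] intro: rev_image_eqI)
  have "\<forall>n. \<exists>q. fst q \<in> sets M \<and> snd q \<in> borel_measurable M \<and> fst q \<subseteq> A \<and>
      outer M A - inverse (real (Suc n)) \<le> measure M (fst q) \<and> (\<forall>w\<in>fst q. (w, snd q w) \<in> B)"
  proof
    fix n
    obtain K v where "K \<in> sets M" "v \<in> borel_measurable M" "K \<subseteq> A" "outer M A - inverse (real (Suc n)) \<le> measure M K"
      "\<forall>w\<in>K. \<forall>m. \<exists>j. w \<in> fst (p m) j \<and> v w \<in> snd (p m) j"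
    proof -
      have "\<exists>K\<in>sets M. \<exists>v\<in>borel_measurable M. K \<subseteq> A \<and> outer M A - inverse (real (Suc n)) \<le> measure M K \<and>
           (\<forall>w\<in>K. \<forall>m. \<exists>j. w \<in> fst (p m) j \<and> v w \<in> snd (p m) j)"
      proof (rule section_on_large_set[OF p(1,2) _ A])
        show "dist x y \<le> inverse (real (Suc m))" if "x \<in> snd (p m) j" "y \<in> snd (p m) j" for m j x y
          using that by (rule p(3))
      qed simp
      then show ?thesis using that by blast
    qed
    then show "\<exists>q. fst q \<in> sets M \<and> snd q \<in> borel_measurable M \<and> fst q \<subseteq> A \<and>
      outer M A - inverse (real (Suc n)) \<le> measure M (fst q) \<and> (\<forall>w\<in>fst q. (w, snd q w) \<in> B)"
      by (intro exI[of _ "(K, v)"]) (simp add: B_iff)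
  qed
  from choice[OF this] obtain q where
    qq: "\<forall>n. fst (q n) \<in> sets M \<and> snd (q n) \<in> borel_measurable M \<and> fst (q n) \<subseteq> A \<and>
      outer M A - inverse (real (Suc n)) \<le> measure M (fst (q n)) \<and> (\<forall>w\<in>fst (q n). (w, snd (q n) w) \<in> B)" ..
  have q: "\<And>n. fst (q n) \<in> sets M" "\<And>n. snd (q n) \<in> borel_measurable M"
    "\<And>n. fst (q n) \<subseteq> A" "\<And>n. outer M A - inverse (real (Suc n)) \<le> measure M (fst (q n))"
    "\<And>n w. w \<in> fst (q n) \<Longrightarrow> (w, snd (q n) w) \<in> B"
    using qq by simp_all
  define S where "S = (\<Union>n. fst (q n))"
  define k where "k w = (LEAST n. w \<in> fst (q n))" for w
  define v where "v w = snd (q (k w)) w" for w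
  have S: "S \<in> sets M" "S \<subseteq> A" unfolding S_def using q(1,3) by auto
  have "k \<in> measurable M (count_space UNIV)"
    unfolding k_def using q(1) by (intro measurable_Least) (auto simp: UNIV vimage_def)
  then have "v \<in> borel_measurable M"
    unfolding v_def by (rule measurable_compose_countable[OF q(2)])
  moreover have "(w, v w) \<in> B" if "w \<in> S" for w
  proof -
    have "w \<in> fst (q (k w))" unfolding k_def using that unfolding S_def by (auto intro: LeastI)
    then show ?thesis unfolding v_def by (rule q(5))
  qed
  moreover have "outer M A = measure M S"
  proof (rule antisym)
    have "outer M A - inverse (real (Suc n)) \<le> measure M S" for n
      using q(4)[of n] finite_measure_mono[of "fst (q n)" S] S(1) unfolding S_def by fastforce
    then show "outer M A \<le> measure M S"
      by (intro LIMSEQ_le_const2[of "\<lambda>n. outer M A - inverse (real (Suc n))"])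
        (use tendsto_diff[OF tendsto_const LIMSEQ_inverse_real_of_nat] in auto)
    obtain H where "H \<in> sets M" "A \<subseteq> H" "measure M H = outer M A" using outer_hull[of A] UNIV by auto
    then show "measure M S \<le> outer M A" using S finite_measure_mono[of S H] by auto
  qed
  ultimately show ?thesis using that[of v S] S unfolding A_def by blast
qed

corollary (in finite_measure) projection_completion:
  fixes B :: "('a \<times> 'x::{complete_space, second_countable_topology}) set"
  assumes "random_gdelta M B" and UNIV: "space M = UNIV"
  shows "fst ` B \<in> sets (completion M)"
proof -
  obtain S where S: "S \<in> sets M" "S \<subseteq> fst ` B" "outer M (fst ` B) = measure M S"
    using measurable_section[OF assms] by metis
  obtain H where H: "H \<in> sets M" "fst ` B \<subseteq> H" "measure M H = outer M (fst ` B)"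
    using outer_hull[of "fst ` B"] UNIV by auto
  have "measure M (H - S) = 0" using finite_measure_Diff[of H S] S H by auto
  then have "H - S \<in> null_sets M" using S H by (intro null_setsI) (auto simp: emeasure_eq_measure)
  then show ?thesis using S H by (intro sets_completionI[of _ S "fst ` B - S" "H - S"]) auto
qed

section \<open>Random sets given by Caratheodory functions\<close>

text \<open>A strict inequality at a point holds with a margin on a ball around some point of a
  countable dense set. On the dense points of the ball the margin amounts to countably many
  measurable conditions on \<open>w\<close>, and continuity extends it to the whole ball.\<close>

lemma caratheodory_random_open:
  fixes f :: "'w \<Rightarrow> 'x::{metric_space, second_countable_topology} \<Rightarrow> real"
  assumes meas: "\<And>x. (\<lambda>w. f w x) \<in> borel_measurable M"
    and cont: "\<And>w. continuous_on UNIV (f w)" and UNIV: "space M = UNIV"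
  shows "random_open M {(w, x). c < f w x}"
proof -
  obtain Q :: "'x set" where Q: "countable Q" "\<And>X. open X \<Longrightarrow> X \<noteq> {} \<Longrightarrow> \<exists>d\<in>Q. d \<in> X"
    using countable_dense_exists by blast
  define R where "R q n = {w \<in> space M. \<forall>d\<in>Q \<inter> ball q (inverse (real (Suc n))). c + inverse (real (Suc n)) \<le> f w d}"
    for q n
  have R: "R q n \<in> sets M" for q n
  proof -
    have "countable (Q \<inter> ball q (inverse (real (Suc n))))" using Q(1) by auto
    then show ?thesis unfolding R_def using meas by measurable
  qed
  have "{(w, x). c < f w x} = (\<Union>q\<in>Q. \<Union>n. R q n \<times> ball q (inverse (real (Suc n))))"
  proof (intro set_eqI iffI; clarify)
    fix w x assume "c < f w x"
    have "isCont (f w) x" using cont[of w] by (simp add: continuous_on_eq_continuous_at)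
    then obtain d where d: "0 < d" "\<And>y. dist y x < d \<Longrightarrow> dist (f w y) (f w x) < (f w x - c) / 2"
      using \<open>c < f w x\<close> unfolding continuous_at_eps_delta by (meson diff_gt_0_iff_gt half_gt_zero)
    obtain n where n: "inverse (real (Suc n)) < min (d / 2) ((f w x - c) / 2)"
      using reals_Archimedean[of "min (d / 2) ((f w x - c) / 2)"] d(1) \<open>c < f w x\<close> by auto
    obtain q where q: "q \<in> Q" "q \<in> ball x (inverse (real (Suc n)))"
      using Q(2)[of "ball x (inverse (real (Suc n)))"] by auto
    have "c + inverse (real (Suc n)) \<le> f w y" if "y \<in> ball q (inverse (real (Suc n)))" for y
    proof -
      have "dist y x \<le> dist y q + dist q x" by (rule dist_triangle)
      also have "\<dots> < d" using that q(2) n by (simp add: dist_commute)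
      finally have "\<bar>f w y - f w x\<bar> < (f w x - c) / 2" using d(2)[of y] by (simp only: dist_real_def)
      moreover have "inverse (real (Suc n)) < (f w x - c) / 2" using n by simp
      moreover have "f w x - f w y \<le> \<bar>f w y - f w x\<bar>" by simp
      ultimately show ?thesis by argo
    qed
    then have "(w, x) \<in> R q n \<times> ball q (inverse (real (Suc n)))"
      using q(2) unfolding R_def UNIV by (auto simp: dist_commute)
    then show "(w, x) \<in> (\<Union>q\<in>Q. \<Union>n. R q n \<times> ball q (inverse (real (Suc n))))" using q(1) by blast
  next
    fix w x q n assume *: "q \<in> Q" "w \<in> R q n" "x \<in> ball q (inverse (real (Suc n)))"
    let ?U = "{y. f w y < c + inverse (real (Suc n))}"
    have "open ?U" using cont[of w] by (intro open_Collect_less) (auto intro: continuous_intros)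
    then have "open (?U \<inter> ball q (inverse (real (Suc n))))" by (rule open_Int) simp
    moreover have "\<not> (\<exists>d\<in>Q. d \<in> ?U \<inter> ball q (inverse (real (Suc n))))"
      using *(2) unfolding R_def Int_iff mem_Collect_eq by (meson Int_iff not_le)
    ultimately have "?U \<inter> ball q (inverse (real (Suc n))) = {}" using Q(2) by blast
    then have "c + inverse (real (Suc n)) \<le> f w x" using *(3) by (auto simp: not_less[symmetric])
    moreover have "0 < inverse (real (Suc n))" by simp
    ultimately show "c < f w x" by linarith
  qed
  also have "random_open M \<dots>" using Q(1) R by (intro random_open_UN random_open_rect) auto
  finally show ?thesis .
qed

lemma caratheodory_random_gdelta:
  fixes f :: "'w \<Rightarrow> 'x::{metric_space, second_countable_topology} \<Rightarrow> real"
  assumes meas: "\<And>x. (\<lambda>w. f w x) \<in> borel_measurable M"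
    and cont: "\<And>w. continuous_on UNIV (f w)" and UNIV: "space M = UNIV"
  shows "random_gdelta M {(w, x). c \<le> f w x}"
proof -
  have "{(w, x). c \<le> f w x} = (\<Inter>n. {(w, x). c - inverse (real (Suc n)) < f w x})"
  proof -
    have "c \<le> f w x \<longleftrightarrow> (\<forall>n. c - inverse (real (Suc n)) < f w x)" for w x
    proof
      assume "c \<le> f w x"
      then show "\<forall>n. c - inverse (real (Suc n)) < f w x"
        using inverse_positive_iff_positive[of "real (Suc n)" for n] by (smt (verit) of_nat_0_less_iff zero_less_Suc)
    next
      assume "\<forall>n. c - inverse (real (Suc n)) < f w x"
      then have "c - inverse (real (Suc n)) \<le> f w x" for n using less_imp_le by blast
      then show "c \<le> f w x"
        by (intro LIMSEQ_le_const2[of "\<lambda>n. c - inverse (real (Suc n))"])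
          (use tendsto_diff[OF tendsto_const LIMSEQ_inverse_real_of_nat] in auto)
    qed
    then show ?thesis by auto
  qed
  also have "random_gdelta M \<dots>"
    by (intro random_gdelta_INT random_open_gdelta caratheodory_random_open assms) auto
  finally show ?thesis .
qed

section \<open>Simultaneous limits, uniform boundedness, a counting bound\<close>

text \<open>Tychonoff: the \<open>L n\<close> lie in a product of compact intervals, and a cluster
  point \<open>l\<close> yields a filter finer than \<open>sequentially\<close> along which all
  coordinates converge at once. The filter serves in place of a Banach limit.\<close>

lemma simultaneous_limit_filter:
  fixes L :: "nat \<Rightarrow> 'i \<Rightarrow> real"
  assumes "\<And>n i. \<bar>L n i\<bar> \<le> b i"
  obtains F l where "F \<noteq> bot" "F \<le> sequentially" "\<And>i. ((\<lambda>n. L n i) \<longlongrightarrow> l i) F"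
proof -
  have "compactin (product_topology (\<lambda>i. euclidean) UNIV) (Pi\<^sub>E UNIV (\<lambda>i. {- b i..b i}))"
    unfolding compactin_PiE by auto
  then have cpt: "compact (Pi\<^sub>E UNIV (\<lambda>i. {- b i..b i}))"
    by (simp add: euclidean_product_topology)
  have ev: "eventually (\<lambda>x. x \<in> Pi\<^sub>E UNIV (\<lambda>i. {- b i..b i})) (filtermap L sequentially)"
    using assms by (auto simp: eventually_filtermap PiE_iff abs_le_iff minus_le_iff intro!: always_eventually)
  have "filtermap L sequentially \<noteq> bot" by (simp add: filtermap_bot_iff)
  then obtain l where l: "inf (nhds l) (filtermap L sequentially) \<noteq> bot"
    using cpt ev unfolding compact_filter by blast
  define F where "F = inf (filtercomap L (nhds l)) sequentially"
  have "F \<noteq> bot"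
  proof
    assume "F = bot"
    then have "eventually (\<lambda>_. False) (inf (filtercomap L (nhds l)) sequentially)" unfolding F_def by simp
    then obtain P Q where PQ: "eventually P (filtercomap L (nhds l))" "eventually Q sequentially" "\<forall>n. P n \<and> Q n \<longrightarrow> False"
      unfolding eventually_inf by auto
    obtain P' where P': "eventually P' (nhds l)" "\<And>n. P' (L n) \<Longrightarrow> P n"
      using PQ(1) unfolding eventually_filtercomap by auto
    have "eventually (\<lambda>x. \<not> P' x) (filtermap L sequentially)"
      unfolding eventually_filtermap using PQ(2) by (rule eventually_mono) (use PQ(3) P'(2) in blast)
    then have "eventually (\<lambda>_. False) (inf (nhds l) (filtermap L sequentially))"
      unfolding eventually_inf using P'(1) by blast
    then show False using l by (simp add: eventually_False)
  qed
  moreover have "F \<le> sequentially" unfolding F_def by simp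
  moreover have "((\<lambda>n. L n i) \<longlongrightarrow> l i) F" for i
  proof -
    have "filterlim L (nhds l) F"
      unfolding F_def filterlim_iff_le_filtercomap by simp
    moreover have "((\<lambda>x. x i) \<longlongrightarrow> l i) (nhds l)"
    proof (rule topological_tendstoI)
      fix S :: "real set" assume "open S" "l i \<in> S"
      then have "open {x. x i \<in> S}" "l \<in> {x. x i \<in> S}"
        using product_topology_basis'[of "{()}" "\<lambda>_. S" "\<lambda>_. i"] by auto
      then show "eventually (\<lambda>x. x i \<in> S) (nhds l)" unfolding eventually_nhds by blast
    qed
    ultimately show ?thesis by (rule filterlim_compose[rotated])
  qed
  ultimately show ?thesis using that by blast
qed

text \<open>Baire category. This serves the case that 0 is the largest exponent, where slow growth
  is known vector by vector and a common constant is wanted on all of \<open>X\<close>.\<close>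

lemma uniform_boundedness:
  fixes T :: "'i::countable \<Rightarrow> 'x::banach \<Rightarrow>\<^sub>L 'y::real_normed_vector"
  assumes "\<And>x. \<exists>C. \<forall>i. norm (T i x) \<le> C"
  obtains C where "\<And>i. norm (T i) \<le> C"
proof -
  define G where "G n = {x. \<forall>i. norm (T i x) \<le> real n}" for n
  have closed: "closed (G n)" for n
    unfolding G_def by (intro closed_Collect_all closed_Collect_le continuous_intros)
  have "(\<Union>n. G n) = UNIV"
  proof (rule set_eqI, simp)
    fix x
    obtain C where "\<forall>i. norm (T i x) \<le> C" using assms by auto
    then have "x \<in> G (nat \<lceil>C\<rceil>)" unfolding G_def by (auto intro: order_trans real_nat_ceiling_ge)
    then show "\<exists>n. x \<in> G n" ..
  qed
  have "\<exists>n. interior (G n) \<noteq> {}"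
  proof (rule ccontr)
    assume "\<not> ?thesis"
    then have "euclidean interior_of \<Union>(range G) = {}"
      using closed completely_metrizable_space_euclidean by (intro Baire_category_alt) auto
    then show False using \<open>(\<Union>n. G n) = UNIV\<close> by simp
  qed
  then obtain n z where "z \<in> interior (G n)" by auto
  then obtain r where r: "0 < r" "cball z r \<subseteq> G n"
    by (meson interior_subset mem_interior_cball)
  have "norm (T i) \<le> 2 * real n / r" for i
  proof (rule norm_blinfun_bound)
    show "0 \<le> 2 * real n / r" using r(1) by simp
    fix x
    show "norm (T i x) \<le> 2 * real n / r * norm x"
    proof (cases "x = 0")
      case False
      define y where "y = (r / norm x) *\<^sub>R x"
      have "norm y = r" using False r(1) unfolding y_def by simp
      then have "z + y \<in> G n" "z \<in> G n" using r by (auto simp: dist_norm subset_iff)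
      then have "norm (T i (z + y)) \<le> real n" "norm (T i z) \<le> real n" unfolding G_def by auto
      moreover have "norm (T i y) \<le> norm (T i (z + y)) + norm (T i z)"
        using norm_triangle_ineq4[of "T i (z + y)" "T i z"] by (simp add: blinfun.add_right)
      ultimately have "norm (T i y) \<le> 2 * real n" by linarith
      moreover have "norm (T i y) = r / norm x * norm (T i x)"
        using r(1) unfolding y_def by (simp add: blinfun.scaleR_right)
      ultimately show ?thesis using False r(1) by (simp add: field_simps)
    qed simp
  qed
  then show ?thesis by (rule that)
qed

text \<open>Each level set of width \<open>e\<close> of \<open>a\<close> contains at most \<open>N\<close> elements of \<open>J\<close>.\<close>

lemma card_le_of_increments:
  fixes a :: "nat \<Rightarrow> real"
  assumes fin: "finite J" and "0 < e" and L: "0 \<le> L"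
    and inc: "\<And>i j. i \<in> J \<Longrightarrow> j \<in> J \<Longrightarrow> i + N \<le> j \<Longrightarrow> a i + e \<le> a j"
    and bd: "\<And>j. j \<in> J \<Longrightarrow> \<bar>a j\<bar> \<le> L"
  shows "real (card J) \<le> real N * (2 * L / e + 2)"
proof -
  define lev where "lev j = nat \<lfloor>(a j + L) / e\<rfloor>" for j
  have le: "lev j \<le> nat \<lfloor>2 * L / e\<rfloor>" if "j \<in> J" for j
    unfolding lev_def using bd[OF that] \<open>0 < e\<close>
    by (intro nat_mono floor_mono divide_right_mono) auto
  have card_lev: "card {j \<in> J. lev j = k} \<le> N" for k
  proof (cases "{j \<in> J. lev j = k} = {}")
    case False
    define m where "m = Min {j \<in> J. lev j = k}"
    have fin': "finite {j \<in> J. lev j = k}" using fin by simp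
    have m: "m \<in> J" "lev m = k" using Min_in[OF fin' False] unfolding m_def by auto
    have "{j \<in> J. lev j = k} \<subseteq> {m..<m + N}"
    proof
      fix j assume j: "j \<in> {j \<in> J. lev j = k}"
      then have "m \<le> j" unfolding m_def using fin' by (intro Min_le)
      moreover have "j < m + N"
      proof (rule ccontr)
        assume "\<not> j < m + N"
        then have "a m + e \<le> a j" using inc[of m j] j m by simp
        then have "(a m + L + e) / e \<le> (a j + L) / e" using \<open>0 < e\<close> by (intro divide_right_mono) auto
        then have "(a m + L) / e + 1 \<le> (a j + L) / e" using \<open>0 < e\<close> by (simp add: add_divide_distrib)
        then have "\<lfloor>(a m + L) / e\<rfloor> + 1 \<le> \<lfloor>(a j + L) / e\<rfloor>" by linarith
        moreover have "0 \<le> (a m + L) / e" using bd[OF m(1)] \<open>0 < e\<close> by auto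
        ultimately have "lev m < lev j" unfolding lev_def by linarith
        then show False using j m by simp
      qed
      ultimately show "j \<in> {m..<m + N}" by simp
    qed
    then have "card {j \<in> J. lev j = k} \<le> card {m..<m + N}" by (intro card_mono) auto
    then show ?thesis by simp
  next
    case True
    then show ?thesis unfolding True by simp
  qed
  have "J = (\<Union>k\<in>{..nat \<lfloor>2 * L / e\<rfloor>}. {j \<in> J. lev j = k})" using le by auto
  then have "card J \<le> (\<Sum>k\<in>{..nat \<lfloor>2 * L / e\<rfloor>}. card {j \<in> J. lev j = k})"
    using card_UN_le[of "{..nat \<lfloor>2 * L / e\<rfloor>}" "\<lambda>k. {j \<in> J. lev j = k}"] by simp
  also have "\<dots> \<le> (\<Sum>k\<in>{..nat \<lfloor>2 * L / e\<rfloor>}. N)" by (intro sum_mono card_lev)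
  also have "\<dots> = N * Suc (nat \<lfloor>2 * L / e\<rfloor>)" by simp
  finally have "real (card J) \<le> real N * (real (nat \<lfloor>2 * L / e\<rfloor>) + 1)"
    by (metis of_nat_le_iff of_nat_mult of_nat_Suc add.commute)
  also have "\<dots> \<le> real N * (2 * L / e + 2)"
  proof (rule mult_left_mono)
    have "real (nat \<lfloor>2 * L / e\<rfloor>) \<le> 2 * L / e" using L \<open>0 < e\<close> by (intro of_nat_floor) auto
    then show "real (nat \<lfloor>2 * L / e\<rfloor>) + 1 \<le> 2 * L / e + 2" by linarith
  qed simp
  finally show ?thesis .
qed

subsection \<open>Growth rates in an Oseledets splitting\<close>

lemma elog_rate_lower:
  assumes "(\<lambda>n. elog (x n) / ereal (real n)) \<longlonglongrightarrow> ereal l" "a < l"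
  shows "eventually (\<lambda>n. exp (a * real n) \<le> x n) sequentially"
proof -
  have "eventually (\<lambda>n. ereal a < elog (x n) / ereal (real n)) sequentially"
    using order_tendstoD(1)[OF assms(1), of "ereal a"] assms(2) by simp
  then show ?thesis using eventually_gt_at_top[of 0]
  proof eventually_elim
    case (elim n)
    show ?case
    proof (cases "x n \<le> 0")
      case True
      then show ?thesis using elim by (simp add: elog_def)
    next
      case False
      then have "a < ln (x n) / real n" using elim by (simp add: elog_def)
      then have "a * real n \<le> ln (x n)" using elim(2) by (simp add: field_simps)
      then show ?thesis using False by (metis exp_le_cancel_iff exp_ln not_le)
    qed
  qed
qed

lemma elog_rate_upper:
  assumes "(\<lambda>n. elog (x n) / ereal (real n)) \<longlonglongrightarrow> l" "l < ereal b"
  shows "eventually (\<lambda>n. x n \<le> exp (b * real n)) sequentially"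
proof -
  have "eventually (\<lambda>n. elog (x n) / ereal (real n) < ereal b) sequentially"
    using order_tendstoD(2)[OF assms] .
  then show ?thesis using eventually_gt_at_top[of 0]
  proof eventually_elim
    case (elim n)
    show ?case
    proof (cases "x n \<le> 0")
      case True
      then show ?thesis by (rule order_trans) simp
    next
      case False
      then have "ln (x n) / real n < b" using elim by (simp add: elog_def)
      then have "ln (x n) \<le> b * real n" using elim(2) by (simp add: field_simps)
      then show ?thesis using False by (metis exp_le_cancel_iff exp_ln not_le)
    qed
  qed
qed

lemma eventually_le_imp_le_mult:
  fixes x y :: "nat \<Rightarrow> real"
  assumes "eventually (\<lambda>n. x n \<le> y n) sequentially" "\<And>n. 0 < y n"
  obtains C where "1 \<le> C" "\<And>n. x n \<le> C * y n"
proof -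
  obtain n0 where n0: "\<And>n. n0 \<le> n \<Longrightarrow> x n \<le> y n" using assms(1) unfolding eventually_sequentially by auto
  define C where "C = 1 + (\<Sum>n<n0. \<bar>x n\<bar> / y n)"
  have nn: "0 \<le> \<bar>x n\<bar> / y n" for n using less_imp_le[OF assms(2)[of n]] by simp
  have S: "0 \<le> (\<Sum>n<n0. \<bar>x n\<bar> / y n)" by (intro sum_nonneg nn)
  have "x n \<le> C * y n" for n
  proof (cases "n < n0")
    case True
    have "\<bar>x n\<bar> / y n \<le> (\<Sum>n<n0. \<bar>x n\<bar> / y n)"
      using True by (intro member_le_sum nn) auto
    then have "\<bar>x n\<bar> / y n \<le> C" unfolding C_def by simp
    then show ?thesis using assms(2)[of n] by (simp add: field_simps)
  next
    case False
    then have "x n \<le> 1 * y n" using n0 by simp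
    also have "\<dots> \<le> C * y n" using S assms(2)[of n] unfolding C_def by (intro mult_right_mono) auto
    finally show ?thesis .
  qed
  then show ?thesis using that[of C] S unfolding C_def by simp
qed

lemma eventually_exp_gap:
  fixes a b c :: real
  assumes "b < a"
  shows "eventually (\<lambda>n. c * exp (b * real n) \<le> exp (a * real n)) sequentially"
proof -
  have "filterlim (\<lambda>n. exp ((a - b) * real n)) at_top sequentially"
    using assms by (intro filterlim_compose[OF exp_at_top] filterlim_tendsto_pos_mult_at_top[OF tendsto_const _ filterlim_real_sequentially]) auto
  then have "eventually (\<lambda>n. c \<le> exp ((a - b) * real n)) sequentially" by (simp add: filterlim_at_top)
  then show ?thesis
  proof eventually_elim
    case (elim n)
    have "c * exp (b * real n) \<le> exp ((a - b) * real n) * exp (b * real n)"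
      using elim by (intro mult_right_mono) auto
    also have "\<dots> = exp (a * real n)" by (simp add: exp_add[symmetric] algebra_simps)
    finally show ?case .
  qed
qed

lemma norm_le_norm_on:
  assumes "subspace V" "v \<in> V"
  shows "norm (blinfun_apply T v) \<le> norm_on T V * norm v"
proof (cases "v = 0")
  case True
  then show ?thesis by (simp add: blinfun.zero_right)
next
  case False
  have bdd: "bdd_above ((\<lambda>v. norm (blinfun_apply T v)) ` (V \<inter> cball 0 1))"
  proof (rule bdd_aboveI2)
    fix x assume "x \<in> V \<inter> cball 0 1"
    then show "norm (blinfun_apply T x) \<le> norm T"
      using norm_blinfun[of T x] mult_left_le[of "norm x" "norm T"] by simp
  qed
  have "v /\<^sub>R norm v \<in> V \<inter> cball 0 1" using assms False by (simp add: subspace_scale)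
  then have "norm (blinfun_apply T (v /\<^sub>R norm v)) \<le> norm_on T V"
    unfolding norm_on_def using bdd by (intro cSUP_upper)
  then show ?thesis using False by (simp add: blinfun.scaleR_right field_simps)
qed

text \<open>Only norms occur, so the Oseledets spaces, whose measurability is unknown, disappear
  from the later proof. The lower rate \<eta> / 2 in the first clause against \<eta> in the second
  is the margin for the argument with future minima. The constant of the third clause depends on the
  base point alone, which lets the failure of an upper bound be estimated by the probability of a
  base set.\<close>

definition neutral_growth :: "real \<Rightarrow> (nat \<Rightarrow> 'x::real_normed_vector \<Rightarrow>\<^sub>L 'x) \<Rightarrow> bool" where
  "neutral_growth \<eta> B \<longleftrightarrow>
   (\<exists>u C. norm u = 1 \<and> 1 \<le> C \<and>
    (\<forall>n. exp (- (\<eta> / 2) * real n) \<le> C * norm (B n u) \<and> norm (B n u) \<le> C * exp (\<eta> * real n))) \<and>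
   (\<forall>u C. norm u = 1 \<longrightarrow>
    (\<forall>n. exp (- \<eta> * real n) \<le> C * norm (B n u) \<and> norm (B n u) \<le> C * exp (\<eta> * real n)) \<longrightarrow>
    (\<lambda>n. ln (norm (B n u)) / real n) \<longlonglongrightarrow> 0) \<and>
   (\<exists>C. \<forall>u. (\<exists>C'. \<forall>n. norm (B n u) \<le> C' * exp (\<eta> * real n)) \<longrightarrow>
    (\<forall>n. norm (B n u) \<le> C * exp (\<eta> * real n) * norm u))"

locale splitting =
  fixes M :: "'w measure" and \<sigma> :: "'w \<Rightarrow> 'w" and \<A> :: "'w \<Rightarrow> nat \<Rightarrow> 'x::banach \<Rightarrow>\<^sub>L 'x"
    and N :: enat and lam :: "nat \<Rightarrow> real" and \<Omega>' E V
  assumes os: "oseledets_splitting M \<sigma> \<A> N lam \<Omega>' E V"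
begin

lemma decreasing: "i < j \<Longrightarrow> enat j < N \<Longrightarrow> lam j < lam i"
  using os[unfolded oseledets_splitting_def, THEN conjunct1] by simp

lemma splitting_facts:
  assumes "enat i < N" "w \<in> \<Omega>'"
  shows "finite_dimensional (E i w) \<and> E i w \<noteq> {0} \<and>
        finite_codimensional (V i w) \<and>
        direct_sum_UNIV {..i} (\<lambda>k. E k w) (V i w) \<and>
        \<A> w 1 ` E i w = E i (\<sigma> w) \<and>
        \<A> w 1 ` V i w \<subseteq> V i (\<sigma> w) \<and>
        (\<forall>v \<in> E i w - {0}.
           (\<lambda>n. elog (norm (\<A> w n v)) / ereal (real n)) \<longlonglongrightarrow> ereal (lam i)) \<and>
        (\<lambda>n. elog (norm_on (\<A> w n) (V i w)) / ereal (real n))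
          \<longlonglongrightarrow> (if enat (Suc i) < N then ereal (lam (Suc i)) else -\<infinity>)"
  by (rule mp[OF spec[OF spec[OF
    os[unfolded oseledets_splitting_def, THEN conjunct2, THEN conjunct2, THEN conjunct2, THEN conjunct2, THEN conjunct2]]]
    conjI[OF assms]])

lemma E_growth:
  assumes "enat i < N" "w \<in> \<Omega>'" "v \<in> E i w" "v \<noteq> 0"
  shows "(\<lambda>n. elog (norm (\<A> w n v)) / ereal (real n)) \<longlonglongrightarrow> ereal (lam i)"
  using splitting_facts[OF assms(1,2)] assms(3,4) by simp

lemma V_subspace:
  assumes "enat i < N" "w \<in> \<Omega>'"
  shows "subspace (V i w)"
  using splitting_facts[OF assms] unfolding finite_codimensional_def by simp

lemma V_growth:
  assumes "enat i < N" "w \<in> \<Omega>'"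
    "(if enat (Suc i) < N then ereal (lam (Suc i)) else -\<infinity>) < ereal b"
  shows "eventually (\<lambda>n. norm_on (\<A> w n) (V i w) \<le> exp (b * real n)) sequentially"
  by (rule elog_rate_upper[OF _ assms(3)]) (use splitting_facts[OF assms(1,2)] in simp)

lemma V_growth_vector:
  assumes "enat i < N" "w \<in> \<Omega>'" "v \<in> V i w"
    "(if enat (Suc i) < N then ereal (lam (Suc i)) else -\<infinity>) < ereal b"
  shows "eventually (\<lambda>n. norm (\<A> w n v) \<le> exp (b * real n)) sequentially"
proof -
  obtain b' where b': "(if enat (Suc i) < N then ereal (lam (Suc i)) else -\<infinity>) < ereal b'" "b' < b"
    using ereal_dense2[OF assms(4)] by auto
  show ?thesis
    using V_growth[OF assms(1,2) b'(1)] eventually_exp_gap[OF b'(2), of "norm v"]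
  proof eventually_elim
    case (elim n)
    have "norm (\<A> w n v) \<le> norm_on (\<A> w n) (V i w) * norm v"
      by (rule norm_le_norm_on[OF V_subspace[OF assms(1,2)] assms(3)])
    also have "\<dots> \<le> exp (b' * real n) * norm v" using elim(1) by (intro mult_right_mono) auto
    also have "\<dots> \<le> exp (b * real n)" using elim(2) by (simp add: mult.commute)
    finally show ?case .
  qed
qed

lemma E_growth_upper:
  assumes "enat i < N" "w \<in> \<Omega>'" "v \<in> E i w" "lam i < b"
  shows "eventually (\<lambda>n. norm (\<A> w n v) \<le> exp (b * real n)) sequentially"
proof (cases "v = 0")
  case True
  then show ?thesis by (simp add: blinfun.zero_right)
next
  case False
  show ?thesis by (rule elog_rate_upper[OF E_growth[OF assms(1-3) False]]) (simp add: assms(4))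
qed

lemma decompose:
  assumes "enat j < N" "w \<in> \<Omega>'"
  obtains e v where "u = (\<Sum>k\<le>j. e k) + v" "\<And>k. k \<le> j \<Longrightarrow> e k \<in> E k w" "v \<in> V j w"
proof -
  have "bij_betw (\<lambda>(e, v). (\<Sum>k\<in>{..j}. e k) + v) (Pi\<^sub>E {..j} (\<lambda>k. E k w) \<times> V j w) UNIV"
    using splitting_facts[OF assms] unfolding direct_sum_UNIV_def by simp
  then have "u \<in> (\<lambda>(e, v). (\<Sum>k\<in>{..j}. e k) + v) ` (Pi\<^sub>E {..j} (\<lambda>k. E k w) \<times> V j w)"
    unfolding bij_betw_def by simp
  then obtain e v where "e \<in> Pi\<^sub>E {..j} (\<lambda>k. E k w)" "v \<in> V j w" "u = (\<Sum>k\<in>{..j}. e k) + v"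
    by auto
  then show ?thesis using that[of e v] by (auto simp: PiE_iff)
qed

lemma rest_growth:
  assumes "enat j < N" "w \<in> \<Omega>'" "\<And>k. k \<in> K \<Longrightarrow> k \<le> j \<and> lam k < b \<and> e k \<in> E k w" "finite K" "v \<in> V j w"
    "(if enat (Suc j) < N then ereal (lam (Suc j)) else -\<infinity>) < ereal b"
  shows "eventually (\<lambda>n. norm (\<A> w n ((\<Sum>k\<in>K. e k) + v)) \<le> (real (card K) + 1) * exp (b * real n)) sequentially"
proof -
  have "eventually (\<lambda>n. \<forall>k\<in>K. norm (\<A> w n (e k)) \<le> exp (b * real n)) sequentially"
  proof (rule eventually_ball_finite[OF assms(4)], rule ballI)
    fix k assume k: "k \<in> K"
    then have "enat k < N" using assms(1,3) by (meson enat_ord_simps(1) order_le_less_trans)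
    then show "eventually (\<lambda>n. norm (\<A> w n (e k)) \<le> exp (b * real n)) sequentially"
      using assms(2,3) k by (intro E_growth_upper) auto
  qed
  then show ?thesis using V_growth_vector[OF assms(1,2,5,6)]
  proof eventually_elim
    case (elim n)
    have "norm (\<A> w n ((\<Sum>k\<in>K. e k) + v)) \<le> norm (\<Sum>k\<in>K. \<A> w n (e k)) + norm (\<A> w n v)"
      by (simp add: blinfun.add_right blinfun.sum_right norm_triangle_ineq)
    also have "norm (\<Sum>k\<in>K. \<A> w n (e k)) \<le> (\<Sum>k\<in>K. norm (\<A> w n (e k)))" by (rule norm_sum)
    also have "\<dots> \<le> (\<Sum>k\<in>K. exp (b * real n))" using elim(1) by (intro sum_mono) auto
    also have "\<dots> = real (card K) * exp (b * real n)" by simp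
    finally show ?case using elim(2) by (simp add: algebra_simps)
  qed
qed

text \<open>The exponents decrease, so the first nonzero component has the largest rate and the
  remaining terms are exponentially smaller.\<close>

lemma leading_growth:
  assumes j: "enat j < N" and w: "w \<in> \<Omega>'" and e: "\<And>k. k \<le> j \<Longrightarrow> e k \<in> E k w" and v: "v \<in> V j w"
    and i: "i \<le> j" "e i \<noteq> 0" "\<And>k. k < i \<Longrightarrow> e k = 0" and a: "a < lam i"
  shows "eventually (\<lambda>n. exp (a * real n) \<le> norm (\<A> w n ((\<Sum>k\<le>j. e k) + v))) sequentially"
proof -
  have iN: "enat i < N" using i(1) j by (meson enat_ord_simps(1) order_le_less_trans)
  have lt: "lam k < lam i" if "k \<in> {i<..j}" for k
    using that j by (intro decreasing) (auto intro: le_less_trans[of _ "enat j"])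
  have "(if enat (Suc j) < N then ereal (lam (Suc j)) else -\<infinity>) < ereal (lam i)"
    using i(1) decreasing[of i "Suc j"] by simp
  then obtain b1 where b1: "(if enat (Suc j) < N then ereal (lam (Suc j)) else -\<infinity>) < ereal b1" "b1 < lam i"
    using ereal_dense2 by (metis ereal_less_eq(3) linorder_not_le)
  define b where "b = Max (insert a (insert b1 (lam ` {i<..j})))"
  have b: "a \<le> b" "b1 \<le> b" "\<And>k. k \<in> {i<..j} \<Longrightarrow> lam k \<le> b" "b < lam i"
  proof -
    let ?S = "insert a (insert b1 (lam ` {i<..j}))"
    have fin: "finite ?S" by simp
    show "a \<le> b" "b1 \<le> b" "\<And>k. k \<in> {i<..j} \<Longrightarrow> lam k \<le> b"
      unfolding b_def by (rule Max_ge[OF fin], blast)+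
    have "\<forall>s\<in>?S. s < lam i" using a b1(2) lt by auto
    then show "b < lam i" unfolding b_def using Max_in[OF fin] by blast
  qed
  \<comment> \<open>Thirds of the gap between \<open>b\<close> and \<open>lam i\<close>: the rest
    grows at most with rate \<open>b'\<close>, the leading term at least with rate
    \<open>a'\<close>, and the difference of the two absorbs the constant
    \<open>card {i<..j} + 2\<close>.\<close>
  define b' where "b' = (2 * b + lam i) / 3"
  define a' where "a' = (b + 2 * lam i) / 3"
  have b': "b < b'" "b' < a'" "a' < lam i" unfolding a'_def b'_def using b(4) by auto
  have b1': "(if enat (Suc j) < N then ereal (lam (Suc j)) else -\<infinity>) < ereal b'"
    using b1(1) b(2) b'(1) by (meson ereal_less(2) ereal_less_eq(3) less_ereal.simps(1) less_imp_le order_less_le_trans)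
  have rest: "eventually (\<lambda>n. norm (\<A> w n ((\<Sum>k\<in>{i<..j}. e k) + v)) \<le> (real (card {i<..j}) + 1) * exp (b' * real n)) sequentially"
    using b(3) b'(1) e by (intro rest_growth[OF j w _ _ v b1']) (auto intro: le_less_trans)
  have split: "(\<Sum>k\<le>j. e k) = e i + (\<Sum>k\<in>{i<..j}. e k)"
  proof -
    have "{..j} = {..<i} \<union> insert i {i<..j}" using i(1) by auto
    then have "(\<Sum>k\<le>j. e k) = (\<Sum>k\<in>{..<i}. e k) + (\<Sum>k\<in>insert i {i<..j}. e k)"
      by (simp only:) (intro sum.union_disjoint; auto)
    then show ?thesis using i(3) by simp
  qed
  have "eventually (\<lambda>n. exp (a' * real n) \<le> norm (\<A> w n (e i))) sequentially"
    by (rule elog_rate_lower[OF E_growth[OF iN w e[OF i(1)] i(2)] b'(3)])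
  then show ?thesis
    using rest eventually_exp_gap[OF b'(2), of "real (card {i<..j}) + 2"]
  proof eventually_elim
    case (elim n)
    let ?r = "(\<Sum>k\<in>{i<..j}. e k) + v"
    have "\<A> w n ((\<Sum>k\<le>j. e k) + v) = \<A> w n (e i) + \<A> w n ?r"
      unfolding split by (simp add: blinfun.add_right)
    then have "norm (\<A> w n (e i)) - norm (\<A> w n ?r) \<le> norm (\<A> w n ((\<Sum>k\<le>j. e k) + v))"
      by (metis norm_diff_ineq)
    then have "exp (b' * real n) \<le> norm (\<A> w n ((\<Sum>k\<le>j. e k) + v))"
      using elim by (simp add: algebra_simps)
    moreover have "exp (a * real n) \<le> exp (b' * real n)" using b(1) b'(1) by (simp add: mult_right_mono)
    ultimately show ?case by linarith
  qed
qed


text \<open>The first nonzero component has an index at most \<open>k\<close>, hence an exponent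
  above \<eta>, and by \<open>leading_growth\<close> the vector would outgrow the assumed
  bound.\<close>

lemma fast_components_vanish:
  assumes j: "enat j < N" and w: "w \<in> \<Omega>'" and e: "\<And>k. k \<le> j \<Longrightarrow> e k \<in> E k w" and v: "v \<in> V j w"
    and bd: "\<And>n. norm (\<A> w n ((\<Sum>k\<le>j. e k) + v)) \<le> C * exp (\<eta> * real n)"
    and k: "k \<le> j" "\<eta> < lam k"
  shows "e k = 0"
proof (rule ccontr)
  let ?u = "(\<Sum>k\<le>j. e k) + v"
  assume "e k \<noteq> 0"
  define i where "i = (LEAST k. e k \<noteq> 0)"
  have i: "e i \<noteq> 0" "i \<le> k"
    unfolding i_def using LeastI[of "\<lambda>k. e k \<noteq> 0", OF \<open>e k \<noteq> 0\<close>] Least_le[of "\<lambda>k. e k \<noteq> 0", OF \<open>e k \<noteq> 0\<close>] by simp_all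
  have less: "e l = 0" if "l < i" for l using not_less_Least[of l "\<lambda>k. e k \<noteq> 0"] that unfolding i_def by auto
  have ij: "i \<le> j" using i(2) k(1) by simp
  have "enat k < N" using k(1) j by (meson enat_ord_simps(1) order_le_less_trans)
  then have "\<eta> < lam i" using decreasing[of i k] k(2) i(2) by (cases "i = k") auto
  then obtain a where a: "\<eta> < a" "a < lam i" using dense by blast
  have "eventually (\<lambda>n. exp (a * real n) \<le> norm (\<A> w n ?u)) sequentially"
    by (rule leading_growth[OF j w e v ij i(1) less a(2)])
  moreover have "eventually (\<lambda>n. (C + 1) * exp (\<eta> * real n) \<le> exp (a * real n)) sequentially"
    by (rule eventually_exp_gap[OF a(1)])
  ultimately have "eventually (\<lambda>n::nat. False) sequentially"
  proof eventually_elim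
    case (elim n)
    then have "(C + 1) * exp (\<eta> * real n) \<le> C * exp (\<eta> * real n)" using bd[of n] by linarith
    then show False by (simp add: algebra_simps)
  qed
  then show False by simp
qed

theorem growth_near_zero_exponent:
  assumes cocycle_add: "\<And>w n m. \<A> w (n + m) = \<A> ((\<sigma> ^^ m) w) n o\<^sub>L \<A> w m"
    and i: "enat i < N" "lam i = 0"
  obtains \<eta> where "0 < \<eta>" "\<And>w. w \<in> \<Omega>' \<Longrightarrow> neutral_growth \<eta> (\<A> w)"
proof -
  \<comment> \<open>Half the distance from 0 to the neighbouring exponents, with 1 standing in for a
    neighbour that does not exist. The case \<open>i = 0\<close> is separate because there
    \<open>i - 1\<close> is again 0.\<close>
  define \<eta> where "\<eta> = min (if 0 < i then lam (i - 1) else 1) (if enat (Suc i) < N then - lam (Suc i) else 1) / 2"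
  have up: "0 < lam (i - 1)" if "0 < i" using decreasing[of "i - 1" i] i that by simp
  have down: "lam (Suc i) < 0" if "enat (Suc i) < N" using decreasing[of i "Suc i"] i that by simp
  have \<eta>: "0 < \<eta>" unfolding \<eta>_def using up down by simp
  have \<eta>_up: "\<eta> < lam k" if "k < i" for k
  proof -
    have "\<eta> < lam (i - 1)" unfolding \<eta>_def using up that by (auto simp: min_def split: if_splits)
    also have "lam (i - 1) \<le> lam k"
    proof (cases "k = i - 1")
      case False
      have "enat (i - 1) < N" using i(1) by (meson diff_le_self enat_ord_simps(1) order_le_less_trans)
      moreover have "k < i - 1" using False that by simp
      ultimately show ?thesis using decreasing[of k "i - 1"] by simp
    qed simp
    finally show ?thesis .
  qed
  have \<eta>_down: "(if enat (Suc i) < N then ereal (lam (Suc i)) else -\<infinity>) < ereal (- \<eta>)"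
    unfolding \<eta>_def using down by (auto simp: min_def)
  have P1: "\<exists>u C. norm u = 1 \<and> 1 \<le> C \<and>
       (\<forall>n. exp (- (\<eta> / 2) * real n) \<le> C * norm (\<A> w n u) \<and> norm (\<A> w n u) \<le> C * exp (\<eta> * real n))"
    if w: "w \<in> \<Omega>'" for w
  proof -
    have fd: "finite_dimensional (E i w)" "E i w \<noteq> {0}" using splitting_facts[OF i(1) w] by simp_all
    obtain B where B: "E i w = span B" using fd(1) unfolding finite_dimensional_def by auto
    then have "0 \<in> E i w" by (simp add: span_zero)
    then obtain e where e: "e \<in> E i w" "e \<noteq> 0" using fd(2) by blast
    define u where "u = e /\<^sub>R norm e"
    have u: "u \<in> E i w" "norm u = 1" "u \<noteq> 0" using e B unfolding u_def by (simp_all add: span_scale)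
    note lim = E_growth[OF i(1) w u(1,3), unfolded i(2)]
    \<comment> \<open>A vanishing iterate would stay zero, contradicting the lower rate -1.\<close>
    have pos: "0 < norm (\<A> w n u)" for n
    proof (rule ccontr)
      assume "\<not> 0 < norm (\<A> w n u)"
      then have "\<A> w n u = 0" by simp
      then have zero: "\<A> w (m + n) u = 0" for m using cocycle_add[of w m n] by (simp add: blinfun.zero_right)
      have "eventually (\<lambda>k. exp (-1 * real k) \<le> norm (\<A> w k u)) sequentially"
        by (rule elog_rate_lower[OF lim]) simp
      then obtain k0 where "\<And>k. k0 \<le> k \<Longrightarrow> exp (-1 * real k) \<le> norm (\<A> w k u)"
        unfolding eventually_sequentially by blast
      from this[of "k0 + n"] show False using zero[of k0] by (simp add: not_le[symmetric])
    qed
    have "eventually (\<lambda>n. exp (- (\<eta> / 2) * real n) \<le> norm (\<A> w n u)) sequentially"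
      by (rule elog_rate_lower[OF lim]) (use \<eta> in simp)
    then obtain C1 where C1: "1 \<le> C1" "\<And>n. exp (- (\<eta> / 2) * real n) \<le> C1 * norm (\<A> w n u)"
      by (rule eventually_le_imp_le_mult) (use pos in auto)
    have "eventually (\<lambda>n. norm (\<A> w n u) \<le> exp (\<eta> * real n)) sequentially"
      by (rule elog_rate_upper[OF lim]) (use \<eta> in simp)
    then obtain C2 where C2: "1 \<le> C2" "\<And>n. norm (\<A> w n u) \<le> C2 * exp (\<eta> * real n)"
      by (rule eventually_le_imp_le_mult) auto
    have "exp (- (\<eta> / 2) * real n) \<le> max C1 C2 * norm (\<A> w n u)" for n
      using C1(2)[of n] by (rule order_trans) (simp add: mult_right_mono)
    moreover have "norm (\<A> w n u) \<le> max C1 C2 * exp (\<eta> * real n)" for n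
      using C2(2)[of n] by (rule order_trans) (simp add: mult_right_mono)
    ultimately show ?thesis using u(2) C1(1) by (intro exI[of _ u] exI[of _ "max C1 C2"]) auto
  qed
  have sum_growth: "eventually (\<lambda>n. norm (\<A> w n (e + v)) \<le> exp (b * real n)) sequentially"
    if w: "w \<in> \<Omega>'" and e: "e \<in> E i w" and v: "v \<in> V i w" and b: "0 < b" for w e v b
  proof -
    have bb: "0 < b / 2" "b / 2 < b" using b by auto
    have *: "(if enat (Suc i) < N then ereal (lam (Suc i)) else -\<infinity>) < ereal (b / 2)"
      using \<eta>_down \<eta> bb(1) by (smt (verit, ccfv_SIG) ereal_less_eq(3) order_less_le_trans)
    have "eventually (\<lambda>n. norm (\<A> w n ((\<Sum>k\<in>{i}. e) + v)) \<le> (real (card {i}) + 1) * exp (b / 2 * real n)) sequentially"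
      using e i(2) bb(1) by (intro rest_growth[OF i(1) w _ _ v *]) auto
    then show ?thesis
      using eventually_exp_gap[OF bb(2), of "real (card {i}) + 1"] by eventually_elim simp
  qed
  have P2: "(\<lambda>n. ln (norm (\<A> w n u)) / real n) \<longlonglongrightarrow> 0"
    if w: "w \<in> \<Omega>'" and u: "norm u = 1"
      and bd: "\<And>n. exp (- \<eta> * real n) \<le> C * norm (\<A> w n u) \<and> norm (\<A> w n u) \<le> C * exp (\<eta> * real n)"
    for w u C
  proof -
    obtain e v where d: "u = (\<Sum>k\<le>i. e k) + v" and e: "\<And>k. k \<le> i \<Longrightarrow> e k \<in> E k w" and v: "v \<in> V i w"
      using decompose[OF i(1) w] by metis
    have zero: "e k = 0" if "k < i" for k
      using fast_components_vanish[OF i(1) w e v, where C = C and \<eta> = \<eta>] bd \<eta>_up[OF that] that d by simp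
    then have d': "u = e i + v"
      unfolding d by (subst sum.remove[of _ i]) (auto intro!: sum.neutral)
    \<comment> \<open>Otherwise \<open>u\<close> lies in \<open>V i w\<close> and decays faster than
      \<open>exp (- \<eta> n)\<close>, against the assumed lower bound.\<close>
    have "e i \<noteq> 0"
    proof
      assume "e i = 0"
      then have "u \<in> V i w" using d' v by simp
      obtain b where b: "(if enat (Suc i) < N then ereal (lam (Suc i)) else -\<infinity>) < ereal b" "b < - \<eta>"
        using ereal_dense2[OF \<eta>_down] by auto
      have "eventually (\<lambda>n::nat. False) sequentially"
        using V_growth_vector[OF i(1) w \<open>u \<in> V i w\<close> b(1)] eventually_exp_gap[OF b(2), of "\<bar>C\<bar> + 1"]
      proof eventually_elim
        case (elim n)
        have "exp (- \<eta> * real n) \<le> \<bar>C\<bar> * norm (\<A> w n u)"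
          using bd[of n] by (meson abs_ge_self mult_right_mono norm_ge_zero order_trans)
        also have "\<dots> \<le> \<bar>C\<bar> * exp (b * real n)" using elim(1) by (intro mult_left_mono) auto
        finally have "(\<bar>C\<bar> + 1) * exp (b * real n) \<le> \<bar>C\<bar> * exp (b * real n)" using elim(2) by linarith
        then show False by (simp add: algebra_simps)
      qed
      then show False by simp
    qed
    have lower: "eventually (\<lambda>n. exp (a * real n) \<le> norm (\<A> w n u)) sequentially" if "a < 0" for a
      unfolding d by (rule leading_growth[OF i(1) w e v order_refl \<open>e i \<noteq> 0\<close> zero]) (use that i(2) in auto)
    have upper: "eventually (\<lambda>n. norm (\<A> w n u) \<le> exp (b * real n)) sequentially" if "0 < b" for b
      unfolding d' by (rule sum_growth[OF w e[OF order_refl] v that])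
    show ?thesis
    proof (rule order_tendstoI)
      fix a :: real assume "a < 0"
      then have "a / 2 < 0" by simp
      from lower[OF this] eventually_gt_at_top[of 0]
      show "eventually (\<lambda>n. a < ln (norm (\<A> w n u)) / real n) sequentially"
      proof eventually_elim
        case (elim n)
        have "0 < exp (a / 2 * real n)" by simp
        then have "a / 2 * real n \<le> ln (norm (\<A> w n u))"
          using elim(1) by (metis exp_gt_zero ln_exp ln_le_cancel_iff order_less_le_trans)
        moreover have "a * real n < a / 2 * real n" using \<open>a < 0\<close> elim(2) by simp
        ultimately show ?case using elim(2) by (simp add: field_simps)
      qed
    next
      fix b :: real assume "0 < b"
      then have "0 < b / 2" "-1 < (0::real)" by simp_all
      from upper[OF this(1)] lower[OF this(2)] eventually_gt_at_top[of 0]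
      show "eventually (\<lambda>n. ln (norm (\<A> w n u)) / real n < b) sequentially"
      proof eventually_elim
        case (elim n)
        have "0 < norm (\<A> w n u)" using elim(2) by (meson exp_gt_zero order_less_le_trans)
        then have "ln (norm (\<A> w n u)) \<le> b / 2 * real n"
          using elim(1) by (metis exp_gt_zero ln_exp ln_le_cancel_iff)
        moreover have "b / 2 * real n < b * real n" using \<open>0 < b\<close> elim(3) by simp
        ultimately show ?case using elim(3) by (simp add: field_simps)
      qed
    qed
  qed
  have P3: "\<exists>C. \<forall>u. (\<exists>C'. \<forall>n. norm (\<A> w n u) \<le> C' * exp (\<eta> * real n)) \<longrightarrow>
       (\<forall>n. norm (\<A> w n u) \<le> C * exp (\<eta> * real n) * norm u)"
    if w: "w \<in> \<Omega>'" for w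
  \<comment> \<open>With no exponent above 0 every vector is slow, and uniform boundedness supplies
    the constant. Otherwise slow vectors have no component with positive exponent, so they lie in
    \<open>V (i - 1) w\<close>, where the operator norms have growth rate 0.\<close>
  proof (cases "i = 0")
    case True
    define T where "T n = exp (- \<eta> * real n) *\<^sub>R \<A> w n" for n
    have "\<exists>C. \<forall>n. norm (T n u) \<le> C" for u
    proof -
      obtain e v where d: "u = (\<Sum>k\<le>i. e k) + v" and e: "\<And>k. k \<le> i \<Longrightarrow> e k \<in> E k w" and v: "v \<in> V i w"
        using decompose[OF i(1) w] by metis
      have "eventually (\<lambda>n. norm (\<A> w n u) \<le> exp (\<eta> * real n)) sequentially"
        using sum_growth[OF w e[OF order_refl] v \<eta>] d True by simp
      then obtain C where "\<And>n. norm (\<A> w n u) \<le> C * exp (\<eta> * real n)"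
        by (rule eventually_le_imp_le_mult) auto
      then have "norm (T n u) \<le> C" for n
        unfolding T_def by (simp add: blinfun.scaleR_left exp_minus field_simps)
      then show ?thesis by blast
    qed
    then obtain C where C: "\<And>n. norm (T n) \<le> C" using uniform_boundedness[of T] by metis
    have "norm (\<A> w n u) \<le> C * exp (\<eta> * real n) * norm u" for n u
    proof -
      have "norm (T n u) \<le> C * norm u"
        using norm_blinfun[of "T n" u] C[of n] by (meson mult_right_mono norm_ge_zero order_trans)
      then show ?thesis
        unfolding T_def by (simp add: blinfun.scaleR_left exp_minus field_simps)
    qed
    then show ?thesis by blast
  next
    case False
    then have j: "enat (i - 1) < N" "\<And>k. k \<le> i - 1 \<Longrightarrow> \<eta> < lam k" "enat (Suc (i - 1)) < N" "lam (Suc (i - 1)) = 0"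
      using i \<eta>_up by (auto intro: le_less_trans[of _ "enat i"])
    have "eventually (\<lambda>n. norm_on (\<A> w n) (V (i - 1) w) \<le> exp (\<eta> * real n)) sequentially"
      by (rule V_growth[OF j(1) w]) (use j(3,4) \<eta> in simp)
    then obtain C where C: "\<And>n. norm_on (\<A> w n) (V (i - 1) w) \<le> C * exp (\<eta> * real n)"
      by (rule eventually_le_imp_le_mult) auto
    have "norm (\<A> w n u) \<le> C * exp (\<eta> * real n) * norm u"
      if C': "\<And>n. norm (\<A> w n u) \<le> C' * exp (\<eta> * real n)" for u C' n
    proof -
      have "u \<in> V (i - 1) w"
      proof -
        obtain e v where d: "u = (\<Sum>k\<le>i-1. e k) + v" and e: "\<And>k. k \<le> i-1 \<Longrightarrow> e k \<in> E k w" and v: "v \<in> V (i-1) w"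
          using decompose[OF j(1) w] by metis
        have "e k = 0" if "k \<le> i - 1" for k
          using fast_components_vanish[OF j(1) w e v, where C = C' and \<eta> = \<eta>] C' j(2)[OF that] that d by simp
        then show ?thesis using d v by simp
      qed
      then have "norm (\<A> w n u) \<le> norm_on (\<A> w n) (V (i - 1) w) * norm u"
        by (rule norm_le_norm_on[OF V_subspace[OF j(1) w]])
      also have "\<dots> \<le> C * exp (\<eta> * real n) * norm u" using C by (intro mult_right_mono) auto
      finally show ?thesis .
    qed
    then show ?thesis by blast
  qed
  have "neutral_growth \<eta> (\<A> w)" if w: "w \<in> \<Omega>'" for w
    unfolding neutral_growth_def
    by (intro conjI P1[OF w] P3[OF w]) (intro allI impI P2[OF w], blast+)
  with \<eta> show ?thesis by (rule that)
qed

end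

subsection \<open>Compact sets of neutral directions\<close>

lemma caratheodory_measurable:
  fixes f :: "'w \<Rightarrow> 'x::{metric_space, second_countable_topology} \<Rightarrow> 'y::metric_space"
  assumes meas: "\<And>x. (\<lambda>w. f w x) \<in> borel_measurable M"
    and cont: "\<And>w. continuous_on UNIV (f w)" and UNIV: "space M = UNIV"
  shows "(\<lambda>(w, x). f w x) \<in> borel_measurable (M \<Otimes>\<^sub>M borel)"
proof (rule borel_measurableI)
  fix S :: "'y set" assume "open S"
  show "(\<lambda>(w, x). f w x) -` S \<inter> space (M \<Otimes>\<^sub>M borel) \<in> sets (M \<Otimes>\<^sub>M borel)"
  \<comment> \<open>\<open>infdist\<close> to the empty set is 0, so the distance to
    \<open>- S\<close> detects \<open>S\<close> only when \<open>- S\<close> is nonempty.\<close>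
  proof (cases "S = UNIV")
    case False
    have "y \<in> S \<longleftrightarrow> 0 < infdist y (- S)" for y
    proof -
      have "y \<in> - S \<longleftrightarrow> infdist y (- S) = 0"
        using \<open>open S\<close> False by (intro in_closed_iff_infdist_zero) auto
      then show ?thesis using infdist_nonneg[of y "- S"] by auto
    qed
    then have "(\<lambda>(w, x). f w x) -` S \<inter> space (M \<Otimes>\<^sub>M borel) = {(w, x). 0 < infdist (f w x) (- S)}"
      using UNIV by (auto simp: space_pair_measure)
    also have "random_open M \<dots>"
    proof (rule caratheodory_random_open[OF _ _ UNIV])
      show "(\<lambda>w. infdist (f w x) (- S)) \<in> borel_measurable M" for x
        using meas by (intro borel_measurable_continuous_on[of "\<lambda>y. infdist y (- S)"] continuous_intros) auto
      show "continuous_on UNIV (\<lambda>x. infdist (f w x) (- S))" for w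
        using cont by (intro continuous_intros)
    qed
    then have "{(w, x). 0 < infdist (f w x) (- S)} \<in> sets (M \<Otimes>\<^sub>M borel)" by (rule random_open_measurable)
    finally show ?thesis .
  qed simp
qed

locale neutral_cocycle = ergodic_automorphism M \<sigma> + linear_cocycle M \<sigma> \<A>
  for M :: "'w::polish_space measure" and \<sigma> :: "'w \<Rightarrow> 'w"
    and \<A> :: "'w \<Rightarrow> nat \<Rightarrow> 'x::{banach, second_countable_topology} \<Rightarrow>\<^sub>L 'x" +
  fixes \<eta> :: real
  assumes compact: "compact_cocycle \<A>"
    and integrable_log: "integrable M (\<lambda>w. log_plus (norm (\<A> w 1)))"
    and eta_pos: "0 < \<eta>"
    and neutral: "AE w in M. neutral_growth \<eta> (\<A> w)"
begin

lemma neutral_vector: "AE w in M. \<exists>u C. norm u = 1 \<and> 1 \<le> C \<and>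
       (\<forall>n. exp (- (\<eta> / 2) * real n) \<le> C * norm (\<A> w n u) \<and> norm (\<A> w n u) \<le> C * exp (\<eta> * real n))"
  using neutral by eventually_elim (simp add: neutral_growth_def)

lemma zero_growth: "AE w in M. \<forall>u C. norm u = 1 \<longrightarrow>
       (\<forall>n. exp (- \<eta> * real n) \<le> C * norm (\<A> w n u) \<and> norm (\<A> w n u) \<le> C * exp (\<eta> * real n)) \<longrightarrow>
       (\<lambda>n. ln (norm (\<A> w n u)) / real n) \<longlonglongrightarrow> 0"
  using neutral by eventually_elim (simp add: neutral_growth_def)

lemma uniform_growth: "AE w in M. \<exists>C. \<forall>u. (\<exists>C'. \<forall>n. norm (\<A> w n u) \<le> C' * exp (\<eta> * real n)) \<longrightarrow>
       (\<forall>n. norm (\<A> w n u) \<le> C * exp (\<eta> * real n) * norm u)"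
  using neutral by eventually_elim (simp add: neutral_growth_def)

lemma space_M: "space M = UNIV"
  using sets_eq_imp_space_eq[OF sets_M] by simp

lemma iterate_measurable [measurable]: "(\<sigma> ^^ n) \<in> measurable M M"
proof (induction n)
  case (Suc n)
  show ?case unfolding funpow.simps by (rule measurable_comp[OF Suc measurable_fwd])
qed (simp add: id_def)

lemma distr_iterate: "distr M M (\<sigma> ^^ n) = M"
proof (induction n)
  case 0
  show ?case by (simp add: id_def distr_id)
next
  case (Suc n)
  have "distr M M (\<sigma> ^^ Suc n) = distr (distr M M (\<sigma> ^^ n)) M \<sigma>"
    unfolding funpow.simps by (rule distr_distr[symmetric]) (use measurable_fwd in auto)
  then show ?case by (simp only: Suc preserving)
qed

lemma integral_iterate:
  fixes f :: "'w \<Rightarrow> real"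
  assumes "f \<in> borel_measurable M"
  shows "(\<integral>w. f ((\<sigma> ^^ n) w) \<partial>M) = (\<integral>w. f w \<partial>M)"
  using integral_distr[of "\<sigma> ^^ n" M M f] assms distr_iterate[of n] by simp

lemma integrable_iterate:
  fixes f :: "'w \<Rightarrow> real"
  assumes "integrable M f"
  shows "integrable M (\<lambda>w. f ((\<sigma> ^^ n) w))"
  using integrable_distr[of "\<sigma> ^^ n" M M f] assms distr_iterate[of n] by simp

lemma vimage_iterate_sets:
  assumes "R \<in> sets M"
  shows "{w. (\<sigma> ^^ n) w \<in> R} \<in> sets M"
  using measurable_sets[OF iterate_measurable[of n] assms] by (simp add: space_M vimage_def)

lemma prob_iterate:
  assumes "R \<in> sets M"
  shows "prob {w. (\<sigma> ^^ n) w \<in> R} = prob R"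
  using measure_distr[OF iterate_measurable[of n] assms] distr_iterate[of n]
  by (simp add: space_M vimage_def)

lemma cocycle_apply: "\<A> w (n + m) x = \<A> ((\<sigma> ^^ m) w) n (\<A> w m x)"
  by (simp add: cocycle_add)

lemma cocycle_zero [simp]: "\<A> w 0 x = x"
  by (simp add: cocycle_0)

lemma cocycle_measurable: "(\<lambda>w. \<A> w n x) \<in> borel_measurable M"
proof (induction n)
  case (Suc n)
  have J: "(\<lambda>(w, x). \<A> w 1 x) \<in> borel_measurable (M \<Otimes>\<^sub>M borel)"
    by (rule caratheodory_measurable[OF strongly_measurable _ space_M]) (intro continuous_intros)
  have "(\<lambda>w. ((\<sigma> ^^ n) w, \<A> w n x)) \<in> M \<rightarrow>\<^sub>M M \<Otimes>\<^sub>M borel"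
    using Suc by measurable
  from measurable_compose[OF this J] show ?case
    using cocycle_apply[of _ 1 n x] by simp
qed simp

lemma cocycle_measurable_pair [measurable]: "(\<lambda>(w, x). \<A> w n x) \<in> borel_measurable (M \<Otimes>\<^sub>M borel)"
  by (rule caratheodory_measurable[OF cocycle_measurable _ space_M]) (intro continuous_intros)

lemma norm_measurable [measurable]: "(\<lambda>w. norm (\<A> w n x)) \<in> borel_measurable M"
  using cocycle_measurable[of n x] by measurable

lemma gdelta_norm_ge: "random_gdelta M {(w, u). c \<le> norm (\<A> w n u)}"
  by (intro caratheodory_random_gdelta[OF norm_measurable _ space_M] continuous_intros)

lemma open_norm_gt: "random_open M {(w, u). c < norm (\<A> w n u)}"
  by (intro caratheodory_random_open[OF norm_measurable _ space_M] continuous_intros)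

lemma gdelta_norm_le: "random_gdelta M {(w, u). norm (\<A> w n u) \<le> c}"
proof -
  have "random_gdelta M {(w, u). - c \<le> - norm (\<A> w n u)}"
    by (intro caratheodory_random_gdelta[OF borel_measurable_uminus[OF norm_measurable] _ space_M] continuous_intros)
  then show ?thesis by simp
qed

lemma open_norm_less: "random_open M {(w, u). norm (\<A> w n u) < c}"
proof -
  have "random_open M {(w, u). - c < - norm (\<A> w n u)}"
    by (intro caratheodory_random_open[OF borel_measurable_uminus[OF norm_measurable] _ space_M] continuous_intros)
  then show ?thesis by simp
qed

lemma gdelta_base:
  assumes "R \<in> sets M"
  shows "random_gdelta M {(w, u :: 'b::topological_space). w \<in> R}"
proof -
  have "{(w, u :: 'b::topological_space). w \<in> R} = R \<times> UNIV" by auto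
  then show ?thesis using random_open_gdelta[OF random_open_rect[OF assms open_UNIV]] by simp
qed

lemma gdelta_sphere: "random_gdelta M {(w, u :: 'x). norm u = 1}"
proof -
  have "{(w, u :: 'x). norm u = 1} = {(w, u). 1 \<le> norm (\<A> w 0 u)} \<inter> {(w, u). norm (\<A> w 0 u) \<le> 1}"
    by auto
  then show ?thesis using random_gdelta_Int[OF gdelta_norm_ge[of 1 0] gdelta_norm_le[of 0 1]] by (simp only:)
qed

text \<open>The skew product on directions. It is total since \<open>sgn 0 = 0\<close>, and
  \<open>T 0\<close> normalizes: it fixes unit vectors but not arbitrary ones.\<close>

definition T :: "nat \<Rightarrow> 'w \<times> 'x \<Rightarrow> 'w \<times> 'x" where
  "T n z = ((\<sigma> ^^ n) (fst z), sgn (\<A> (fst z) n (snd z)))"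

lemma sgn_cocycle_sgn: "sgn (\<A> w n (sgn x)) = sgn (\<A> w n x)"
proof (cases "x = 0")
  case False
  have "\<A> w n (sgn x) = inverse (norm x) *\<^sub>R \<A> w n x" by (simp add: sgn_div_norm blinfun.scaleR_right)
  then show ?thesis using False by (simp add: sgn_scaleR)
qed simp

lemma T_add: "T (m + n) z = T m (T n z)"
  unfolding T_def using cocycle_apply[of "fst z" m n "snd z"]
  by (simp add: funpow_add sgn_cocycle_sgn)

lemma T_measurable [measurable]: "T n \<in> M \<Otimes>\<^sub>M borel \<rightarrow>\<^sub>M M \<Otimes>\<^sub>M borel"
proof -
  have 1: "(\<lambda>z. \<A> (fst z) n (snd z)) \<in> borel_measurable (M \<Otimes>\<^sub>M borel)"
    using cocycle_measurable_pair[of n] by (simp add: split_beta')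
  have 2: "(\<lambda>x::'x. sgn x) \<in> borel_measurable borel"
    unfolding sgn_div_norm by measurable
  show ?thesis unfolding T_def using measurable_compose[OF 1 2] by measurable
qed

text \<open>The norms form a multiplicative cocycle over \<open>T\<close>. If the orbit is 0 at time
  \<open>j\<close>, both sides are 0, because \<open>sgn 0 = 0\<close> and division by 0 gives
  0.\<close>

lemma norm_T:
  "norm (\<A> (fst (T j z)) n (snd (T j z))) = norm (\<A> (fst z) (n + j) (snd z)) / norm (\<A> (fst z) j (snd z))"
  unfolding T_def using cocycle_apply[of "fst z" n j "snd z"]
  by (simp add: sgn_div_norm blinfun.scaleR_right divide_inverse mult.commute)

text \<open>The step that leads into the fibre is a compact operator, so the fibre of this set is
  compact, which a sphere of \<open>X\<close> need not be. The operator is taken at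
  \<open>inv \<sigma> w\<close> because \<open>w\<close> is the end point of the step.\<close>

definition Img :: "real \<Rightarrow> ('w \<times> 'x) set" where
  "Img C = {(w, u). u \<in> closure (\<A> (inv \<sigma> w) 1 ` ball 0 C)}"

definition Low :: "real \<Rightarrow> ('w \<times> 'x) set" where
  "Low C = {(w, u). \<forall>k. exp (- \<eta> * real k) \<le> C * norm (\<A> w k u)}"

definition Up :: "real \<Rightarrow> ('w \<times> 'x) set" where
  "Up C = {(w, u). \<forall>k. norm (\<A> w k u) \<le> C * exp (\<eta> * real k)}"

text \<open>By \<open>zero_growth\<close>, over almost every base point all vectors in
  \<open>Q C\<close> have growth rate 0. \<open>Suc\<close> keeps the constant positive, as
  \<open>gdelta_Low\<close> requires.\<close>

definition Q :: "nat \<Rightarrow> ('w \<times> 'x) set" where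
  "Q C = {(w, u). norm u = 1} \<inter> Img (real (Suc C)) \<inter> Low (real (Suc C)) \<inter> Up (real (Suc C))"

text \<open>A point of the closure is approximated by images of a countable dense subset of the
  ball, which gives a countable intersection of countable unions of Caratheodory sets. Measurability
  of \<open>inv \<sigma>\<close> enters here.\<close>

lemma gdelta_Img: "random_gdelta M (Img C)"
proof -
  obtain D :: "'x set" where D: "countable D" "\<And>X. open X \<Longrightarrow> X \<noteq> {} \<Longrightarrow> \<exists>d\<in>D. d \<in> X"
    using countable_dense_exists by blast
  have dense: "ball 0 C \<subseteq> closure (D \<inter> ball 0 C)"
  proof
    fix x :: 'x assume x: "x \<in> ball 0 C"
    show "x \<in> closure (D \<inter> ball 0 C)"
      unfolding closure_iff_nhds_not_empty
    proof (intro allI impI)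
      fix A V assume V: "V \<subseteq> A" "open V" "x \<in> V"
      then have "\<exists>d\<in>D. d \<in> V \<inter> ball 0 C" using x by (intro D(2)) auto
      then show "D \<inter> ball 0 C \<inter> A \<noteq> {}" using V(1) by auto
    qed
  qed
  have closure_eq: "closure (blinfun_apply B ` ball 0 C) = closure (blinfun_apply B ` (D \<inter> ball 0 C))"
    for B :: "'x \<Rightarrow>\<^sub>L 'x"
  proof (rule antisym)
    have "blinfun_apply B ` ball 0 C \<subseteq> closure (blinfun_apply B ` (D \<inter> ball 0 C))"
    proof (rule order_trans[OF image_mono[OF dense]])
      show "blinfun_apply B ` closure (D \<inter> ball 0 C) \<subseteq> closure (blinfun_apply B ` (D \<inter> ball 0 C))"
        by (intro image_closure_subset closure_subset closed_closure continuous_intros)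
    qed
    then show "closure (blinfun_apply B ` ball 0 C) \<subseteq> closure (blinfun_apply B ` (D \<inter> ball 0 C))"
      by (simp add: closure_minimal)
    show "closure (blinfun_apply B ` (D \<inter> ball 0 C)) \<subseteq> closure (blinfun_apply B ` ball 0 C)"
      by (intro closure_mono) auto
  qed
  have "Img C = (\<Inter>m. \<Union>d\<in>D \<inter> ball 0 C. {(w, u). - inverse (real (Suc m)) < - dist (\<A> (inv \<sigma> w) 1 d) u})"
  proof (intro set_eqI iffI; clarify)
    fix w u m assume "(w, u) \<in> Img C"
    then have "u \<in> closure (\<A> (inv \<sigma> w) 1 ` (D \<inter> ball 0 C))" unfolding Img_def closure_eq by simp
    then obtain y where "y \<in> \<A> (inv \<sigma> w) 1 ` (D \<inter> ball 0 C)" "dist y u < inverse (real (Suc m))"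
      unfolding closure_approachable by (meson inverse_positive_iff_positive of_nat_0_less_iff zero_less_Suc)
    then show "(w, u) \<in> (\<Union>d\<in>D \<inter> ball 0 C. {(w, u). - inverse (real (Suc m)) < - dist (\<A> (inv \<sigma> w) 1 d) u})"
      by auto
  next
    fix w u assume *: "(w, u) \<in> (\<Inter>m. \<Union>d\<in>D \<inter> ball 0 C. {(w, u). - inverse (real (Suc m)) < - dist (\<A> (inv \<sigma> w) 1 d) u})"
    have "u \<in> closure (\<A> (inv \<sigma> w) 1 ` (D \<inter> ball 0 C))"
      unfolding closure_approachable
    proof (intro allI impI)
      fix e :: real assume "0 < e"
      then obtain m where m: "inverse (real (Suc m)) < e" using reals_Archimedean by blast
      have "(w, u) \<in> (\<Union>d\<in>D \<inter> ball 0 C. {(w, u). - inverse (real (Suc m)) < - dist (\<A> (inv \<sigma> w) 1 d) u})"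
        using * by (rule INT_D) simp
      then obtain d where "d \<in> D \<inter> ball 0 C" "dist (\<A> (inv \<sigma> w) 1 d) u < inverse (real (Suc m))" by auto
      then show "\<exists>y\<in>\<A> (inv \<sigma> w) 1 ` (D \<inter> ball 0 C). dist y u < e" using m by (meson image_eqI less_trans)
    qed
    then show "(w, u) \<in> Img C" unfolding Img_def closure_eq by simp
  qed
  also have "random_gdelta M \<dots>"
  proof (intro random_gdelta_INT random_open_gdelta random_open_UN caratheodory_random_open[OF _ _ space_M])
    show "(\<lambda>w. - dist (\<A> (inv \<sigma> w) 1 d) x) \<in> borel_measurable M" for d x
      using measurable_compose[OF measurable_bwd cocycle_measurable[of 1 d]] by measurable
  qed (use D(1) in \<open>auto intro!: continuous_intros\<close>)
  finally show ?thesis .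
qed

lemma gdelta_Low:
  assumes "0 < C"
  shows "random_gdelta M (Low C)"
proof -
  have "Low C = (\<Inter>k. {(w, u). exp (- \<eta> * real k) / C \<le> norm (\<A> w k u)})"
    unfolding Low_def using assms by (auto simp: field_simps)
  then show ?thesis by (simp only:) (intro random_gdelta_INT gdelta_norm_ge; simp)
qed

lemma gdelta_Up: "random_gdelta M (Up C)"
proof -
  have "Up C = (\<Inter>k. {(w, u). norm (\<A> w k u) \<le> C * exp (\<eta> * real k)})"
    unfolding Up_def by auto
  then show ?thesis by (simp only:) (intro random_gdelta_INT gdelta_norm_le; simp)
qed

lemma gdelta_Q: "random_gdelta M (Q C)"
  unfolding Q_def by (intro random_gdelta_Int gdelta_sphere gdelta_Img gdelta_Low gdelta_Up) simp

lemma gdelta_sets: "random_gdelta M (B :: ('w \<times> 'x) set) \<Longrightarrow> B \<in> sets (M \<Otimes>\<^sub>M borel)"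
  by (rule random_gdelta_measurable[OF _ space_M])

lemma Q_sets [measurable]: "Q C \<in> sets (M \<Otimes>\<^sub>M borel)"
  by (rule gdelta_sets[OF gdelta_Q])

lemma Compl_sets: "B \<in> sets (M \<Otimes>\<^sub>M borel) \<Longrightarrow> - B \<in> sets (M \<Otimes>\<^sub>M (borel :: 'x measure))"
  using sets.compl_sets[of B "M \<Otimes>\<^sub>M borel"] by (simp add: space_pair_measure space_M Compl_eq_Diff_UNIV)

lemma Q_mono: "C \<le> D \<Longrightarrow> Q C \<subseteq> Q D"
proof -
  assume "C \<le> D"
  then have CD: "real (Suc C) \<le> real (Suc D)" by simp
  have "Img (real (Suc C)) \<subseteq> Img (real (Suc D))"
    unfolding Img_def using closure_mono[OF image_mono[OF subset_ball[OF CD]]] by blast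
  moreover have "Low (real (Suc C)) \<subseteq> Low (real (Suc D))"
    unfolding Low_def using CD by (auto intro: order_trans[OF _ mult_right_mono])
  moreover have "Up (real (Suc C)) \<subseteq> Up (real (Suc D))"
    unfolding Up_def using CD by (auto intro: order_trans[OF _ mult_right_mono])
  ultimately show ?thesis unfolding Q_def by blast
qed

lemma compact_Q: "compact {u. (w, u) \<in> Q C}"
proof -
  let ?K = "closure (\<A> (inv \<sigma> w) 1 ` ball 0 (real (Suc C)))"
  have "compact ?K" using compact unfolding compact_cocycle_def compact_operator_def by simp
  moreover have "closed ({u. norm u = 1} \<inter> {u. \<forall>k. exp (- \<eta> * real k) \<le> real (Suc C) * norm (\<A> w k u)} \<inter>
      {u. \<forall>k. norm (\<A> w k u) \<le> real (Suc C) * exp (\<eta> * real k)})"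
    by (intro closed_Int closed_Collect_eq closed_Collect_all closed_Collect_le continuous_intros)
  ultimately have "compact (?K \<inter> ({u. norm u = 1} \<inter> {u. \<forall>k. exp (- \<eta> * real k) \<le> real (Suc C) * norm (\<A> w k u)} \<inter>
      {u. \<forall>k. norm (\<A> w k u) \<le> real (Suc C) * exp (\<eta> * real k)}))"
    by (rule compact_Int_closed)
  moreover have "{u. (w, u) \<in> Q C} = ?K \<inter> ({u. norm u = 1} \<inter> {u. \<forall>k. exp (- \<eta> * real k) \<le> real (Suc C) * norm (\<A> w k u)} \<inter>
      {u. \<forall>k. norm (\<A> w k u) \<le> real (Suc C) * exp (\<eta> * real k)})"
    unfolding Q_def Img_def Low_def Up_def by auto
  ultimately show ?thesis by simp
qed

end

subsection \<open>Orbit averages of a neutral vector field\<close>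

text \<open>An additive form of Pliss' lemma. The tail infimum \<open>m j\<close> can rise at
  \<open>j\<close> only if \<open>b j\<close> is itself a tail minimum, and then by at most
  \<open>b (Suc j) - b j\<close>. The rises telescope from at most \<open>b 0\<close> to at least
  \<open>L\<close>.\<close>

lemma sum_over_future_minima:
  fixes b :: "nat \<Rightarrow> real"
  assumes bdd: "\<And>k. c \<le> b k" and inc: "\<And>k. b (Suc k) - b k \<le> g k" and L: "\<And>k. n \<le> k \<Longrightarrow> L \<le> b k"
  shows "L \<le> b 0 + (\<Sum>j<n. if \<forall>k\<ge>j. b j \<le> b k then g j else 0)"
proof -
  define m where "m j = (INF k\<in>{j..}. b k)" for j
  have bd: "bdd_below (b ` S)" for S using bdd by (auto intro!: bdd_belowI2[of _ c])
  have m_le: "m j \<le> b k" if "j \<le> k" for j k unfolding m_def using that bd by (intro cINF_lower) auto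
  have m_ge: "x \<le> m j" if "\<And>k. j \<le> k \<Longrightarrow> x \<le> b k" for j x unfolding m_def using that by (intro cINF_greatest) auto
  have step: "m (Suc j) - m j \<le> (if \<forall>k\<ge>j. b j \<le> b k then g j else 0)" for j
  proof (cases "\<forall>k\<ge>j. b j \<le> b k")
    case True
    then have "b j \<le> m j" by (intro m_ge) auto
    then show ?thesis using True m_le[of "Suc j" "Suc j"] inc[of j] by simp
  next
    case False
    then obtain l where l: "j \<le> l" "b l < b j" by (auto simp: not_le)
    then have "j \<noteq> l" by auto
    have "m (Suc j) \<le> m j"
    proof (rule m_ge)
      fix k assume "j \<le> k"
      show "m (Suc j) \<le> b k"
      proof (cases "k = j")
        case True
        then show ?thesis using m_le[of "Suc j" l] l \<open>j \<noteq> l\<close> by simp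
      next
        case False
        then show ?thesis using m_le[of "Suc j" k] \<open>j \<le> k\<close> by simp
      qed
    qed
    then show ?thesis using False by auto
  qed
  have "m n - m 0 = (\<Sum>j<n. m (Suc j) - m j)" by (rule sum_lessThan_telescope[symmetric])
  also have "\<dots> \<le> (\<Sum>j<n. if \<forall>k\<ge>j. b j \<le> b k then g j else 0)" by (intro sum_mono step)
  finally show ?thesis using m_ge[of n L] L m_le[of 0 0] by simp
qed

context neutral_cocycle
begin

definition psi :: "'w \<Rightarrow> real" where
  "psi w = log_plus (norm (\<A> w 1))"

lemma psi_integrable: "integrable M psi"
  using integrable_log unfolding psi_def .

lemma psi_measurable [measurable]: "psi \<in> borel_measurable M"
  using psi_integrable by (rule borel_measurable_integrable)

text \<open>Since \<open>psi\<close> is only integrable, a fixed bound per step is available only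
  after the part above \<open>K\<close> has been split off; the mean of that part is small for large
  \<open>K\<close>.\<close>

definition excess :: "nat \<Rightarrow> real \<Rightarrow> 'w \<Rightarrow> real" where
  "excess n K w = (\<Sum>j<n. max 0 (psi ((\<sigma> ^^ j) w) - K))"

lemma psi_nonneg: "0 \<le> psi w"
  unfolding psi_def log_plus_def by simp

lemma ln_norm_step:
  assumes "\<A> w k u \<noteq> 0" "\<A> w (Suc k) u \<noteq> 0"
  shows "ln (norm (\<A> w (Suc k) u)) - ln (norm (\<A> w k u)) \<le> psi ((\<sigma> ^^ k) w)"
proof -
  let ?B = "\<A> ((\<sigma> ^^ k) w) 1"
  have "\<A> w (Suc k) u = ?B (\<A> w k u)" using cocycle_apply[of w 1 k u] by simp
  then have "norm (\<A> w (Suc k) u) \<le> norm ?B * norm (\<A> w k u)" by (simp add: norm_blinfun)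
  also have "\<dots> \<le> max 1 (norm ?B) * norm (\<A> w k u)" by (intro mult_right_mono) auto
  finally have "ln (norm (\<A> w (Suc k) u)) \<le> ln (max 1 (norm ?B) * norm (\<A> w k u))"
    using assms by simp
  also have "\<dots> = psi ((\<sigma> ^^ k) w) + ln (norm (\<A> w k u))"
    using assms unfolding psi_def log_plus_def by (subst ln_mult) auto
  finally show ?thesis by simp
qed

lemma integrable_bounded:
  fixes f :: "'w \<Rightarrow> real"
  assumes "f \<in> borel_measurable M" "\<And>w. \<bar>f w\<bar> \<le> B"
  shows "integrable M f"
  using assms by (intro integrable_const_bound[of _ B]) auto

text \<open>Neutral vectors exist almost everywhere, but with a constant depending on the base
  point. Rounding the constant up to an integer leaves countably many random sets, one of which has
  a projection of positive outer measure; the selection theorem is applied to it.\<close>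

lemma exists_section:
  obtains Y v C where "Y \<in> sets M" "0 < prob Y" "v \<in> borel_measurable M" "1 \<le> C"
    "\<And>w. w \<in> Y \<Longrightarrow> norm (v w) = 1"
    "\<And>w n. w \<in> Y \<Longrightarrow> exp (- (\<eta> / 2) * real n) \<le> C * norm (\<A> w n (v w))"
    "\<And>w n. w \<in> Y \<Longrightarrow> norm (\<A> w n (v w)) \<le> C * exp (\<eta> * real n)"
proof -
  define B where "B m = {(w, u). norm u = 1} \<inter> (\<Inter>k. {(w, u). exp (- (\<eta> / 2) * real k) / real (Suc m) \<le> norm (\<A> w k u)}) \<inter> Up (real (Suc m))"
    for m
  have gB: "random_gdelta M (B m)" for m
    unfolding B_def by (intro random_gdelta_Int random_gdelta_INT gdelta_sphere gdelta_norm_ge gdelta_Up) simp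
  have "\<exists>m. outer M (fst ` B m) \<noteq> 0"
  proof (rule ccontr)
    assume "\<not> ?thesis"
    then have zero: "outer M (fst ` B m) = 0" for m by simp
    have "AE w in M. w \<notin> fst ` B m" for m
    proof -
      obtain H where H: "H \<in> sets M" "fst ` B m \<subseteq> H" "prob H = 0"
        using outer_hull[of "fst ` B m"] space_M zero by auto
      then have "AE w in M. w \<notin> H" by (simp add: AE_iff_measurable[of H] emeasure_eq_measure space_M)
      then show ?thesis using H(2) by auto
    qed
    then have "AE w in M. \<forall>m. w \<notin> fst ` B m" by (simp add: AE_all_countable)
    then have "AE w in M. False" using neutral_vector
    proof eventually_elim
      case (elim w)
      then obtain u C where u: "norm u = 1" "1 \<le> C"
        "\<And>n. exp (- (\<eta> / 2) * real n) \<le> C * norm (\<A> w n u)" "\<And>n. norm (\<A> w n u) \<le> C * exp (\<eta> * real n)" by blast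
      obtain m :: nat where "C \<le> real m" using real_arch_simple by blast
      then have m: "C \<le> real (Suc m)" by simp
      have "exp (- (\<eta> / 2) * real n) / real (Suc m) \<le> norm (\<A> w n u)" for n
      proof -
        have "exp (- (\<eta> / 2) * real n) \<le> norm (\<A> w n u) * real (Suc m)"
          using u(3)[of n] mult_right_mono[OF m norm_ge_zero, of "\<A> w n u"] by (simp add: mult.commute)
        then show ?thesis by (subst pos_divide_le_eq) auto
      qed
      moreover have "norm (\<A> w n u) \<le> real (Suc m) * exp (\<eta> * real n)" for n
        by (rule order_trans[OF u(4) mult_right_mono[OF m]]) simp
      ultimately have "(w, u) \<in> B m" unfolding B_def Up_def using u(1) by simp
      then show False using elim(1) by force
    qed
    then show False by simp
  qed
  then obtain m where m: "outer M (fst ` B m) \<noteq> 0" by blast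
  obtain v S where S: "v \<in> borel_measurable M" "S \<in> sets M" "\<And>w. w \<in> S \<Longrightarrow> (w, v w) \<in> B m" "outer M (fst ` B m) = prob S"
    using measurable_section[OF gB space_M, of m] by metis
  show ?thesis
  proof (rule that[of S v "real (Suc m)"])
    show "0 < prob S" using S(4) m by (simp add: zero_less_measure_iff measure_nonneg less_le)
    show "exp (- (\<eta> / 2) * real n) \<le> real (Suc m) * norm (\<A> w n (v w))" if "w \<in> S" for w n
    proof -
      have "exp (- (\<eta> / 2) * real n) / real (Suc m) \<le> norm (\<A> w n (v w))" using S(3)[OF that] unfolding B_def by blast
      then show ?thesis by (subst (asm) pos_divide_le_eq) (auto simp: mult.commute)
    qed
  qed (use S in \<open>auto simp: B_def Up_def\<close>)
qed

text \<open>The constant in \<open>uniform_growth\<close> is not known to be measurable. The base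
  points where \<open>Suc C\<close> is too small form a countable union of projections; these unions
  decrease to a null set and are covered by the \<open>H C\<close>.\<close>

lemma upper_growth_sets:
  obtains H where "\<And>C. H C \<in> sets M" "(\<lambda>C. prob (H C)) \<longlonglongrightarrow> 0"
    "\<And>w u C C'. norm u = 1 \<Longrightarrow> (\<And>k. norm (\<A> w k u) \<le> C' * exp (\<eta> * real k)) \<Longrightarrow> (w, u) \<notin> Up (real (Suc C)) \<Longrightarrow> w \<in> H C"
proof -
  define U where "U C m k = fst ` ({(w, u). norm u = 1} \<inter> Up (real m) \<inter> {(w, u). real (Suc C) * exp (\<eta> * real k) < norm (\<A> w k u)})"
    for C m k :: nat
  have U: "U C m k \<in> sets (completion M)" for C m k
    unfolding U_def
    by (intro projection_completion[OF _ space_M] random_gdelta_Int gdelta_sphere gdelta_Up random_open_gdelta open_norm_gt)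
  define Bad where "Bad C = (\<Union>m. \<Union>k. U C m k)" for C
  have Bad: "Bad C \<in> sets (completion M)" for C unfolding Bad_def using U by auto
  have Bad_iff: "w \<in> Bad C \<longleftrightarrow> (\<exists>u C' k. norm u = 1 \<and> (\<forall>k. norm (\<A> w k u) \<le> C' * exp (\<eta> * real k)) \<and>
      real (Suc C) * exp (\<eta> * real k) < norm (\<A> w k u))" (is "_ \<longleftrightarrow> ?P") for w C
  proof
    assume "w \<in> Bad C"
    then obtain m k u where "norm u = 1" "(w, u) \<in> Up (real m)" "real (Suc C) * exp (\<eta> * real k) < norm (\<A> w k u)"
      unfolding Bad_def U_def by auto
    then show ?P unfolding Up_def by blast
  next
    assume ?P
    then obtain u C' k where u: "norm u = 1" "\<And>k. norm (\<A> w k u) \<le> C' * exp (\<eta> * real k)"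
      "real (Suc C) * exp (\<eta> * real k) < norm (\<A> w k u)" by blast
    obtain m :: nat where m: "C' \<le> real m" using real_arch_simple by blast
    have "norm (\<A> w k u) \<le> real m * exp (\<eta> * real k)" for k
      by (rule order_trans[OF u(2) mult_right_mono[OF m]]) simp
    then have "w \<in> U C m k" unfolding U_def Up_def using u(1,3) by (intro image_eqI[of _ _ "(w, u)"]) auto
    then show "w \<in> Bad C" unfolding Bad_def by blast
  qed
  have dec: "decseq Bad"
  proof (rule decseq_SucI, rule subsetI)
    fix n w assume "w \<in> Bad (Suc n)"
    then obtain u C' k where u: "norm u = 1" "\<And>k. norm (\<A> w k u) \<le> C' * exp (\<eta> * real k)"
      "real (Suc (Suc n)) * exp (\<eta> * real k) < norm (\<A> w k u)" unfolding Bad_iff by blast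
    have "real (Suc n) * exp (\<eta> * real k) \<le> real (Suc (Suc n)) * exp (\<eta> * real k)" by (intro mult_right_mono) auto
    then show "w \<in> Bad n" unfolding Bad_iff using u by (meson order_le_less_trans)
  qed
  have null: "AE w in M. w \<notin> (\<Inter>C. Bad C)"
    using uniform_growth
  proof eventually_elim
    case (elim w)
    then obtain C where C: "\<And>u C' n. (\<And>n. norm (\<A> w n u) \<le> C' * exp (\<eta> * real n)) \<Longrightarrow> norm (\<A> w n u) \<le> C * exp (\<eta> * real n) * norm u"
      by blast
    obtain m :: nat where m: "C \<le> real m" using real_arch_simple by blast
    have "w \<notin> Bad m"
    proof
      assume "w \<in> Bad m"
      then obtain u C' k where u: "norm u = 1" "\<And>k. norm (\<A> w k u) \<le> C' * exp (\<eta> * real k)"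
        "real (Suc m) * exp (\<eta> * real k) < norm (\<A> w k u)" unfolding Bad_iff by blast
      have "norm (\<A> w k u) \<le> C * exp (\<eta> * real k)" using C[OF u(2)] u(1) by simp
      also have "\<dots> \<le> real (Suc m) * exp (\<eta> * real k)" using m by (intro mult_right_mono) auto
      finally show False using u(3) by simp
    qed
    then show ?case by blast
  qed
  obtain H where H: "\<And>C. H C \<in> sets M" "\<And>C. Bad C \<subseteq> H C" "(\<lambda>C. prob (H C)) \<longlonglongrightarrow> 0"
    by (rule measurable_covers_tendsto_0[OF Bad dec null]) blast
  show ?thesis
  proof (rule that[OF H(1,3)])
    fix w u C C' assume "norm u = 1" "\<And>k. norm (\<A> w k u) \<le> C' * exp (\<eta> * real k)" "(w, u) \<notin> Up (real (Suc C))"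
    then have "w \<in> Bad C" unfolding Bad_iff Up_def by (auto simp: not_le)
    then show "w \<in> H C" using H(2) by blast
  qed
qed

end


section \<open>Frequencies along the orbit of a selected neutral field\<close>

locale cocycle_section = neutral_cocycle M \<sigma> \<A> \<eta>
  for M :: "'w::polish_space measure" and \<sigma> :: "'w \<Rightarrow> 'w"
    and \<A> :: "'w \<Rightarrow> nat \<Rightarrow> 'x::{banach, second_countable_topology} \<Rightarrow>\<^sub>L 'x" and \<eta> +
  fixes Y :: "'w set" and v :: "'w \<Rightarrow> 'x" and C0 :: real
  assumes Y_sets [measurable]: "Y \<in> sets M" and Y_pos: "0 < prob Y"
    and v_measurable [measurable]: "v \<in> borel_measurable M" and C0: "1 \<le> C0"
    and norm_v: "\<And>w. w \<in> Y \<Longrightarrow> norm (v w) = 1"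
    and v_lower: "\<And>w n. w \<in> Y \<Longrightarrow> exp (- (\<eta> / 2) * real n) \<le> C0 * norm (\<A> w n (v w))"
    and v_upper: "\<And>w n. w \<in> Y \<Longrightarrow> norm (\<A> w n (v w)) \<le> C0 * exp (\<eta> * real n)"
begin

definition state :: "nat \<Rightarrow> 'w \<Rightarrow> 'w \<times> 'x" where
  "state j w = T j (w, v w)"

text \<open>The empirical mean of \<open>n\<close> steps started with \<open>M\<close> restricted to
  \<open>Y\<close>; it is not normalized by \<open>prob Y\<close>, so it stays below
  \<open>M\<close> on the base.\<close>

definition freq :: "nat \<Rightarrow> ('w \<times> 'x \<Rightarrow> real) \<Rightarrow> real" where
  "freq n f = (\<Sum>j<n. \<integral>w. indicator Y w * f (state j w) \<partial>M) / real n"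

lemma state_measurable [measurable]: "state j \<in> M \<rightarrow>\<^sub>M M \<Otimes>\<^sub>M borel"
  unfolding state_def by measurable

lemma nonzero: "w \<in> Y \<Longrightarrow> \<A> w n (v w) \<noteq> 0"
  using v_lower[of w n] by (auto simp: not_le[symmetric])

lemma fst_state: "fst (state j w) = (\<sigma> ^^ j) w"
  unfolding state_def T_def by simp

lemma snd_state: "snd (state j w) = sgn (\<A> w j (v w))"
  unfolding state_def T_def by simp

lemma norm_snd_state: "w \<in> Y \<Longrightarrow> norm (snd (state j w)) = 1"
  unfolding snd_state using nonzero by (simp add: norm_sgn)

lemma norm_state:
  assumes "w \<in> Y"
  shows "norm (\<A> ((\<sigma> ^^ j) w) n (snd (state j w))) = norm (\<A> w (n + j) (v w)) / norm (\<A> w j (v w))"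
  using norm_T[of j "(w, v w)" n] fst_state[of j w] unfolding state_def by simp

definition al :: "nat \<Rightarrow> 'w \<Rightarrow> real" where
  "al k w = ln (norm (\<A> w k (v w)))"

lemma al_0: "w \<in> Y \<Longrightarrow> al 0 w = 0"
  unfolding al_def using norm_v by simp

lemma al_lower: "w \<in> Y \<Longrightarrow> - (\<eta> / 2) * real k - ln C0 \<le> al k w"
proof -
  assume w: "w \<in> Y"
  have "- (\<eta> / 2) * real k \<le> ln (C0 * norm (\<A> w k (v w)))"
    using v_lower[OF w, of k] nonzero[OF w, of k] C0 by (subst ln_ge_iff) auto
  also have "\<dots> = ln C0 + al k w" unfolding al_def using nonzero[OF w, of k] C0 by (subst ln_mult) auto
  finally show ?thesis by simp
qed

lemma al_step: "w \<in> Y \<Longrightarrow> al (Suc k) w - al k w \<le> psi ((\<sigma> ^^ k) w)"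
  unfolding al_def by (intro ln_norm_step nonzero)

lemma integrable_state:
  fixes f :: "'w \<times> 'x \<Rightarrow> real"
  assumes "f \<in> borel_measurable (M \<Otimes>\<^sub>M borel)" "\<And>z. \<bar>f z\<bar> \<le> B"
  shows "integrable M (\<lambda>w. indicator Y w * f (state j w))"
proof (rule integrable_bounded)
  show "(\<lambda>w. indicator Y w * f (state j w)) \<in> borel_measurable M"
    using measurable_compose[OF state_measurable assms(1)] by measurable
  show "\<bar>indicator Y w * f (state j w)\<bar> \<le> B" for w
    using assms(2)[of "state j w"] by (auto simp: indicator_def)
qed

lemma integrable_state_sum:
  fixes f :: "'w \<times> 'x \<Rightarrow> real"
  assumes "f \<in> borel_measurable (M \<Otimes>\<^sub>M borel)" "\<And>z. \<bar>f z\<bar> \<le> B"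
  shows "integrable M (\<lambda>w. indicator Y w * (\<Sum>j<n. f (state j w)))"
  unfolding sum_distrib_left by (rule Bochner_Integration.integrable_sum) (rule integrable_state[OF assms])

lemma freq_eq_integral:
  fixes f :: "'w \<times> 'x \<Rightarrow> real"
  assumes "f \<in> borel_measurable (M \<Otimes>\<^sub>M borel)" "\<And>z. \<bar>f z\<bar> \<le> B"
  shows "freq n f * real n = (\<integral>w. indicator Y w * (\<Sum>j<n. f (state j w)) \<partial>M)"
proof -
  have "(\<integral>w. indicator Y w * (\<Sum>j<n. f (state j w)) \<partial>M) = (\<Sum>j<n. \<integral>w. indicator Y w * f (state j w) \<partial>M)"
    unfolding sum_distrib_left by (rule Bochner_Integration.integral_sum) (rule integrable_state[OF assms])
  then show ?thesis unfolding freq_def by (cases "n = 0") auto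
qed

lemma psi_excess_integrable: "integrable M (\<lambda>w. max 0 (psi ((\<sigma> ^^ j) w) - K))"
  by (rule integrable_iterate[of "\<lambda>w. max 0 (psi w - K)"])
    (intro integrable_max psi_integrable Bochner_Integration.integrable_diff; simp)

lemma excess_integrable: "integrable M (excess n K)"
  unfolding excess_def by (intro Bochner_Integration.integrable_sum psi_excess_integrable)

lemma psi_sum_integrable: "integrable M (\<lambda>w. indicator Y w * excess n K w)"
  using integrable_mult_indicator[OF Y_sets excess_integrable] by (simp only: real_scaleR_def)

lemma psi_sum_bound:
  "(\<integral>w. indicator Y w * excess n K w \<partial>M) \<le> real n * (\<integral>w. max 0 (psi w - K) \<partial>M)"
proof -
  have "(\<integral>w. indicator Y w * excess n K w \<partial>M) \<le> (\<integral>w. excess n K w \<partial>M)"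
    by (intro integral_mono psi_sum_integrable excess_integrable)
       (auto simp: indicator_def excess_def intro: sum_nonneg)
  also have "\<dots> = (\<Sum>j<n. \<integral>w. max 0 (psi ((\<sigma> ^^ j) w) - K) \<partial>M)"
    unfolding excess_def by (rule Bochner_Integration.integral_sum) (rule psi_excess_integrable)
  also have "\<dots> = (\<Sum>j<n. \<integral>w. max 0 (psi w - K) \<partial>M)"
    by (intro sum.cong refl integral_iterate[of "\<lambda>w. max 0 (psi w - K)"]) measurable
  finally show ?thesis by simp
qed

text \<open>Passing from one future minimum of \<open>al k w + \<eta> * k\<close> to the next, the sequence grows by
  at most \<open>\<eta> + psi\<close>; since it grows linearly on the whole, the future minima have positive density.\<close>

lemma low_pointwise:
  assumes w: "w \<in> Y" and "0 \<le> K"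
  shows "\<eta> / 2 * real n - ln C0 \<le> (\<eta> + K) * (\<Sum>j<n. indicator (Low 1) (state j w)) + excess n K w"
proof -
  \<comment> \<open>Adding \<open>\<eta> * k\<close> turns the lower bound of rate
    \<open>- \<eta>\<close> into a comparison of values: \<open>state j w\<close> is in
    \<open>Low 1\<close> exactly when \<open>b j\<close> is a minimum of the tail. By
    \<open>v_lower\<close>, \<open>b k\<close> is at least
    \<open>\<eta> / 2 * k - ln C0\<close>.\<close>
  define b where "b k = al k w + \<eta> * real k" for k
  have low: "state j w \<in> Low 1 \<longleftrightarrow> (\<forall>k\<ge>j. b j \<le> b k)" for j
  proof -
    have "exp (- \<eta> * real k) \<le> 1 * norm (\<A> ((\<sigma> ^^ j) w) k (snd (state j w))) \<longleftrightarrow> b j \<le> b (k + j)" for k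
    proof -
      have "exp (- \<eta> * real k) \<le> norm (\<A> w (k + j) (v w)) / norm (\<A> w j (v w)) \<longleftrightarrow>
          - \<eta> * real k \<le> ln (norm (\<A> w (k + j) (v w)) / norm (\<A> w j (v w)))"
        using nonzero[OF w] by (subst ln_ge_iff) auto
      also have "ln (norm (\<A> w (k + j) (v w)) / norm (\<A> w j (v w))) = al (k + j) w - al j w"
        unfolding al_def using nonzero[OF w] by (subst ln_div) auto
      finally show ?thesis unfolding norm_state[OF w] b_def by (simp add: algebra_simps)
    qed
    moreover have "state j w \<in> Low 1 \<longleftrightarrow> (\<forall>k. exp (- \<eta> * real k) \<le> 1 * norm (\<A> ((\<sigma> ^^ j) w) k (snd (state j w))))"
      unfolding Low_def using fst_state[of j w] by (cases "state j w") simp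
    ultimately show ?thesis by (metis le_add2 le_add_diff_inverse2)
  qed
  have "\<eta> / 2 * real n - ln C0 \<le> b 0 + (\<Sum>j<n. if \<forall>k\<ge>j. b j \<le> b k then \<eta> + psi ((\<sigma> ^^ j) w) else 0)"
  proof (rule sum_over_future_minima[of "- ln C0"])
    have lower: "\<eta> / 2 * real k - ln C0 \<le> b k" for k using al_lower[OF w, of k] unfolding b_def by (simp add: algebra_simps)
    show "- ln C0 \<le> b k" for k using lower[of k] eta_pos by (smt (verit) divide_nonneg_nonneg mult_nonneg_nonneg of_nat_0_le_iff)
    show "b (Suc k) - b k \<le> \<eta> + psi ((\<sigma> ^^ k) w)" for k using al_step[OF w, of k] unfolding b_def by (simp add: algebra_simps)
    show "\<eta> / 2 * real n - ln C0 \<le> b k" if "n \<le> k" for k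
    proof -
      have "\<eta> / 2 * real n \<le> \<eta> / 2 * real k" using that eta_pos by (intro mult_left_mono) auto
      then show ?thesis using lower[of k] by linarith
    qed
  qed
  also have "b 0 = 0" unfolding b_def using al_0[OF w] by simp
  also have "(\<Sum>j<n. if \<forall>k\<ge>j. b j \<le> b k then \<eta> + psi ((\<sigma> ^^ j) w) else 0) \<le>
      (\<Sum>j<n. (\<eta> + K) * indicator (Low 1) (state j w) + max 0 (psi ((\<sigma> ^^ j) w) - K))"
    by (intro sum_mono) (auto simp: indicator_def low)
  finally show ?thesis by (simp add: sum.distrib sum_distrib_left excess_def)
qed

lemma low_freq:
  obtains \<rho> n0 where "0 < \<rho>" "\<And>n. n0 \<le> n \<Longrightarrow> \<rho> \<le> freq n (indicator (Low 1))"
proof -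
  have "(\<lambda>K. \<integral>w. max 0 (psi w - real K) \<partial>M) \<longlonglongrightarrow> (\<integral>w. 0 \<partial>M)"
  proof (rule integral_dominated_convergence[where w = psi])
    show "AE w in M. (\<lambda>K. max 0 (psi w - real K)) \<longlonglongrightarrow> 0"
    proof (rule AE_I2)
      fix w
      obtain m :: nat where "psi w \<le> real m" using real_arch_simple by blast
      then have "\<And>K. m \<le> K \<Longrightarrow> max 0 (psi w - real K) = 0" by (auto simp: max_def)
      then show "(\<lambda>K. max 0 (psi w - real K)) \<longlonglongrightarrow> 0"
        by (intro tendsto_eventually) (auto simp: eventually_sequentially)
    qed
    show "AE w in M. norm (max 0 (psi w - real K)) \<le> psi w" for K
      using psi_nonneg by (intro AE_I2) auto
  qed (auto intro: psi_integrable)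
  then have "eventually (\<lambda>K. (\<integral>w. max 0 (psi w - real K) \<partial>M) < prob Y * \<eta> / 8) sequentially"
    using Y_pos eta_pos by (intro order_tendstoD(2)) auto
  then obtain K :: nat where K: "(\<integral>w. max 0 (psi w - real K) \<partial>M) < prob Y * \<eta> / 8"
    by (meson eventually_sequentially order_refl)
  obtain n0 :: nat where n0: "8 * ln C0 / \<eta> \<le> real n0" using real_arch_simple by blast
  \<comment> \<open>Of the slope \<open>\<eta> / 2\<close>, one eighth of \<eta> pays for the excess
    over \<open>K\<close> and one eighth for \<open>ln C0\<close>, so \<eta> / 4 remains. The
    denominator bounds the rise at one future minimum, the excess left aside.\<close>
  define \<rho> where "\<rho> = prob Y * \<eta> / 4 / (\<eta> + real K)"
  have pos: "0 < \<eta> + real K" using eta_pos by (simp add: add_pos_nonneg)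
  show ?thesis
  proof (rule that[of \<rho> "Suc n0"])
    show "0 < \<rho>" unfolding \<rho>_def using Y_pos eta_pos pos by simp
    fix n assume n: "Suc n0 \<le> n"
    have Low_ms: "indicator (Low 1) \<in> borel_measurable (M \<Otimes>\<^sub>M borel)"
      using gdelta_sets[OF gdelta_Low[of 1]] by simp
    have ind_bd: "\<bar>indicator (Low 1) z\<bar> \<le> (1::real)" for z by (auto simp: indicator_def)
    have "(\<integral>w. indicator Y w * (\<eta> / 2 * real n - ln C0) \<partial>M) \<le>
      (\<integral>w. (\<eta> + real K) * (indicator Y w * (\<Sum>j<n. indicator (Low 1) (state j w))) + indicator Y w * excess n (real K) w \<partial>M)"
    proof (rule integral_mono)
      show "integrable M (\<lambda>w. indicator Y w * (\<eta> / 2 * real n - ln C0))"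
        by (intro integrable_mult_left) (simp add: integrable_bounded[of _ 1] indicator_def)
      show "integrable M (\<lambda>w. (\<eta> + real K) * (indicator Y w * (\<Sum>j<n. indicator (Low 1) (state j w))) + indicator Y w * excess n (real K) w)"
        by (intro Bochner_Integration.integrable_add integrable_mult_right
            integrable_state_sum[OF Low_ms ind_bd] psi_sum_integrable)
      fix w
      show "indicator Y w * (\<eta> / 2 * real n - ln C0) \<le> (\<eta> + real K) * (indicator Y w * (\<Sum>j<n. indicator (Low 1) (state j w))) + indicator Y w * excess n (real K) w"
        using low_pointwise[of w "real K" n] by (auto simp: indicator_def)
    qed
    also have "\<dots> = (\<eta> + real K) * (freq n (indicator (Low 1)) * real n) + (\<integral>w. indicator Y w * excess n (real K) w \<partial>M)"
      unfolding freq_eq_integral[OF Low_ms ind_bd]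
      by (subst Bochner_Integration.integral_add)
         (intro integrable_mult_right integrable_state_sum[OF Low_ms ind_bd] psi_sum_integrable integral_mult_right_zero
            arg_cong2[where f = "(+)"] refl)+
    also have "(\<integral>w. indicator Y w * excess n (real K) w \<partial>M) \<le> real n * (prob Y * \<eta> / 8)"
      using psi_sum_bound[where n = n and K = "real K"] K by (meson less_imp_le mult_left_mono of_nat_0_le_iff order_trans)
    also have "(\<integral>w. indicator Y w * (\<eta> / 2 * real n - ln C0) \<partial>M) = prob Y * (\<eta> / 2 * real n - ln C0)"
      by simp
    finally have "prob Y * (\<eta> / 2 * real n - ln C0) - real n * (prob Y * \<eta> / 8) \<le> (\<eta> + real K) * (freq n (indicator (Low 1)) * real n)"
      by simp
    moreover have "prob Y * ln C0 \<le> prob Y * (\<eta> / 8 * real n)"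
    proof (rule mult_left_mono)
      have "8 * ln C0 \<le> \<eta> * real n0" using n0 eta_pos by (simp add: field_simps)
      also have "\<dots> \<le> \<eta> * real n" using n eta_pos by (intro mult_left_mono) auto
      finally show "ln C0 \<le> \<eta> / 8 * real n" by simp
    qed simp
    ultimately have "(prob Y * \<eta> / 4) * real n \<le> (\<eta> + real K) * freq n (indicator (Low 1)) * real n"
      by (simp add: algebra_simps)
    then have "prob Y * \<eta> / 4 \<le> (\<eta> + real K) * freq n (indicator (Low 1))" using n by simp
    then show "\<rho> \<le> freq n (indicator (Low 1))"
      unfolding \<rho>_def pos_divide_le_eq[OF pos] by (simp only: mult.commute)
  qed
qed


text \<open>The previous point of the orbit, rescaled by the new norm, is a preimage of the new
  direction. If it lies outside the ball of radius \<open>C\<close>, the norm has dropped at least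
  by the factor \<open>C\<close> in this step.\<close>

lemma not_Img_imp:
  assumes w: "w \<in> Y" and C: "1 < C" and notin: "state (Suc j) w \<notin> Img C"
  shows "ln C \<le> al j w - al (Suc j) w"
proof (rule ccontr)
  assume "\<not> ?thesis"
  then have less: "al j w - al (Suc j) w < ln C" by simp
  let ?a = "norm (\<A> w j (v w))" and ?b = "norm (\<A> w (Suc j) (v w))"
  have pos: "0 < ?a" "0 < ?b" using nonzero[OF w] by auto
  have "ln (?a / ?b) < ln C" using less pos unfolding al_def by (simp add: ln_div)
  then have "?a / ?b < C" using pos C by (subst (asm) ln_less_cancel_iff) auto
  define x where "x = (1 / ?b) *\<^sub>R \<A> w j (v w)"
  have "norm x < C" unfolding x_def using \<open>?a / ?b < C\<close> by simp
  have "\<A> ((\<sigma> ^^ j) w) 1 x = sgn (\<A> w (Suc j) (v w))"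
    unfolding x_def using cocycle_apply[of w 1 j "v w"]
    by (simp add: blinfun.scaleR_right sgn_div_norm divide_inverse)
  moreover have "inv \<sigma> ((\<sigma> ^^ Suc j) w) = (\<sigma> ^^ j) w" using bij by (simp add: bij_is_inj)
  ultimately have "snd (state (Suc j) w) \<in> \<A> (inv \<sigma> (fst (state (Suc j) w))) 1 ` ball 0 C"
    unfolding fst_state snd_state using \<open>norm x < C\<close> by (intro image_eqI[of _ _ x]) auto
  then have "state (Suc j) w \<in> Img C"
    unfolding Img_def split_beta mem_Collect_eq by (rule subsetD[OF closure_subset])
  then show False using notin by simp
qed

text \<open>Each visit outside \<open>Img C\<close> after time 0 lowers the logarithmic norm by at
  least \<open>ln C\<close>. The rises are at most \<open>psi\<close> per step and the net loss is
  bounded by \<open>v_lower\<close>, so such visits are rare when \<open>C\<close> is large.\<close>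

lemma img_pointwise:
  assumes w: "w \<in> Y" and C: "1 < C"
  shows "ln C * (\<Sum>j<Suc m. indicator (- Img C) (state j w)) \<le>
    ln C + excess (Suc m) 0 w + (\<eta> / 2 * real (Suc m) + ln C0)"
proof -
  have lnC: "0 < ln C" using C by simp
  have step: "ln C * indicator (- Img C) (state (Suc j) w) \<le> psi ((\<sigma> ^^ j) w) - (al (Suc j) w - al j w)" for j
  proof (cases "state (Suc j) w \<in> Img C")
    case True
    then show ?thesis using al_step[OF w, of j] by simp
  next
    case False
    then show ?thesis using not_Img_imp[OF w C False] psi_nonneg[of "(\<sigma> ^^ j) w"] by simp
  qed
  \<comment> \<open>Time 0 has no preceding step and is charged the full
    \<open>ln C\<close>.\<close>
  have "ln C * (\<Sum>j<Suc m. indicator (- Img C) (state j w)) =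
      ln C * indicator (- Img C) (state 0 w) + (\<Sum>j<m. ln C * indicator (- Img C) (state (Suc j) w))"
    unfolding sum.lessThan_Suc_shift by (simp only: distrib_left sum_distrib_left)
  also have "\<dots> \<le> ln C + (\<Sum>j<m. psi ((\<sigma> ^^ j) w) - (al (Suc j) w - al j w))"
    using lnC by (intro add_mono sum_mono step) (auto simp: indicator_def)
  also have "\<dots> = ln C + (\<Sum>j<m. psi ((\<sigma> ^^ j) w)) - (al m w - al 0 w)"
    unfolding sum_subtractf[of "\<lambda>j. psi ((\<sigma> ^^ j) w)" "\<lambda>j. al (Suc j) w - al j w"]
      sum_lessThan_telescope[of "\<lambda>j. al j w"] by simp
  also have "\<dots> \<le> ln C + (\<Sum>j<m. psi ((\<sigma> ^^ j) w)) + (\<eta> / 2 * real (Suc m) + ln C0)"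
  proof -
    have "\<eta> / 2 * real (Suc m) = \<eta> / 2 * real m + \<eta> / 2" by (simp add: distrib_left)
    moreover have "- (\<eta> / 2) * real m = - (\<eta> / 2 * real m)" by simp
    ultimately show ?thesis using al_0[OF w] al_lower[OF w, of m] eta_pos by linarith
  qed
  also have "(\<Sum>j<m. psi ((\<sigma> ^^ j) w)) \<le> excess (Suc m) 0 w"
    using psi_nonneg by (simp add: max_absorb2 excess_def)
  finally show ?thesis by simp
qed

lemma img_freq:
  assumes C: "1 < C"
  shows "ln C * (freq (Suc m) (indicator (- Img C)) * real (Suc m)) \<le>
    ln C + real (Suc m) * (\<integral>w. psi w \<partial>M) + (\<eta> / 2 * real (Suc m) + ln C0)"
proof -
  have ms: "indicator (- Img C) \<in> borel_measurable (M \<Otimes>\<^sub>M borel)"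
  proof -
    have "- Img C = space (M \<Otimes>\<^sub>M borel) - Img C" by (auto simp: space_pair_measure space_M)
    then have "- Img C \<in> sets (M \<Otimes>\<^sub>M borel)" using gdelta_sets[OF gdelta_Img] by simp
    then show ?thesis by simp
  qed
  have bd: "\<bar>indicator (- Img C) z\<bar> \<le> (1::real)" for z by (auto simp: indicator_def)
  let ?c = "ln C + (\<eta> / 2 * real (Suc m) + ln C0)"
  have c: "0 \<le> ?c" using C C0 eta_pos by simp
  have "ln C * (freq (Suc m) (indicator (- Img C)) * real (Suc m)) =
      (\<integral>w. ln C * (indicator Y w * (\<Sum>j<Suc m. indicator (- Img C) (state j w))) \<partial>M)"
    unfolding freq_eq_integral[OF ms bd] by (rule integral_mult_right_zero[symmetric])
  also have "\<dots> \<le> (\<integral>w. ?c + indicator Y w * excess (Suc m) 0 w \<partial>M)"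
  proof (rule integral_mono)
    show "integrable M (\<lambda>w. ln C * (indicator Y w * (\<Sum>j<Suc m. indicator (- Img C) (state j w))))"
      by (intro integrable_mult_right integrable_state_sum[OF ms bd])
    show "integrable M (\<lambda>w. ?c + indicator Y w * excess (Suc m) 0 w)"
      by (intro Bochner_Integration.integrable_add psi_sum_integrable integrable_const)
    fix w
    show "ln C * (indicator Y w * (\<Sum>j<Suc m. indicator (- Img C) (state j w))) \<le>
      ?c + indicator Y w * excess (Suc m) 0 w"
    proof (cases "w \<in> Y")
      case True
      then show ?thesis using img_pointwise[OF True C, of m] by (simp only: indicator_simps mult_1 algebra_simps)
    next
      case False
      then have "indicator Y w = (0::real)" by simp
      then show ?thesis using c by (simp only: mult_zero_left mult_zero_right add_0_right)
    qed
  qed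
  also have "\<dots> = ?c + (\<integral>w. indicator Y w * excess (Suc m) 0 w \<partial>M)"
    by (subst Bochner_Integration.integral_add) (simp_all only: psi_sum_integrable integrable_const lebesgue_integral_const prob_space real_scaleR_def mult_1)
  also have "(\<integral>w. indicator Y w * excess (Suc m) 0 w \<partial>M) \<le> real (Suc m) * (\<integral>w. max 0 (psi w - 0) \<partial>M)"
    by (rule psi_sum_bound)
  also have "(\<integral>w. max 0 (psi w - 0) \<partial>M) = (\<integral>w. psi w \<partial>M)" using psi_nonneg by (simp add: max_absorb2)
  finally show ?thesis by simp
qed

lemma freq_mono:
  fixes f g :: "'w \<times> 'x \<Rightarrow> real"
  assumes "f \<in> borel_measurable (M \<Otimes>\<^sub>M borel)" "\<And>z. \<bar>f z\<bar> \<le> B"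
    and "g \<in> borel_measurable (M \<Otimes>\<^sub>M borel)" "\<And>z. \<bar>g z\<bar> \<le> B'"
    and "\<And>j w. w \<in> Y \<Longrightarrow> f (state j w) \<le> g (state j w)"
  shows "freq n f \<le> freq n g"
  unfolding freq_def using assms(5)
  by (intro divide_right_mono sum_mono integral_mono integrable_state[OF assms(1,2)] integrable_state[OF assms(3,4)])
     (auto simp: indicator_def)

lemma freq_add:
  fixes f g :: "'w \<times> 'x \<Rightarrow> real"
  assumes "f \<in> borel_measurable (M \<Otimes>\<^sub>M borel)" "\<And>z. \<bar>f z\<bar> \<le> B"
    and "g \<in> borel_measurable (M \<Otimes>\<^sub>M borel)" "\<And>z. \<bar>g z\<bar> \<le> B'"
  shows "freq n (\<lambda>z. f z + g z) = freq n f + freq n g"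
  unfolding freq_def distrib_left
  by (simp only: Bochner_Integration.integral_add[OF integrable_state[OF assms(1,2)] integrable_state[OF assms(3,4)]] sum.distrib add_divide_distrib)

text \<open>By invariance of \<open>M\<close> the base point of the state has distribution
  \<open>M\<close> at every time, and restricting to \<open>Y\<close> only lowers the
  integral.\<close>

lemma freq_base:
  assumes R: "R \<in> sets M" and f: "f \<in> borel_measurable (M \<Otimes>\<^sub>M borel)"
    and le: "\<And>z. 0 \<le> f z \<and> f z \<le> 1" and sub: "\<And>j w. w \<in> Y \<Longrightarrow> (\<sigma> ^^ j) w \<notin> R \<Longrightarrow> f (state j w) = 0"
  shows "freq n f \<le> prob R"
proof (cases "n = 0")
  case False
  have bd: "\<bar>f z\<bar> \<le> 1" for z using le[of z] by simp
  have "(\<Sum>j<n. \<integral>w. indicator Y w * f (state j w) \<partial>M) \<le> (\<Sum>j<n. prob R)"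
  proof (rule sum_mono)
    fix j
    have "(\<integral>w. indicator Y w * f (state j w) \<partial>M) \<le> (\<integral>w. indicator {w. (\<sigma> ^^ j) w \<in> R} w \<partial>M)"
    proof (rule integral_mono[OF integrable_state[OF f bd]])
      show "integrable M (\<lambda>w. indicator {w. (\<sigma> ^^ j) w \<in> R} w :: real)"
        using vimage_iterate_sets[OF R, of j]
        by (intro integrable_bounded[of _ 1] borel_measurable_indicator) (auto simp: indicator_def)
      show "indicator Y w * f (state j w) \<le> indicator {w. (\<sigma> ^^ j) w \<in> R} w" for w
        using le[of "state j w"] sub[of w j] by (auto simp: indicator_def)
    qed
    also have "\<dots> = prob R"
      using vimage_iterate_sets[OF R, of j] prob_iterate[OF R, of j] by simp
    finally show "(\<integral>w. indicator Y w * f (state j w) \<partial>M) \<le> prob R" .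
  qed
  then show ?thesis using False unfolding freq_def by (simp add: field_simps)
qed (simp add: freq_def)

text \<open>\<open>Low 1\<close> has frequency at least \<open>\<rho>\<close>. For large
  \<open>C\<close> the states outside \<open>Img\<close> and those outside \<open>Up\<close> have
  frequency at most \<open>\<rho> / 4\<close> each: the former because norm drops are rare, the
  latter because they lie over the small set \<open>H C\<close>.\<close>

lemma Q_freq:
  obtains \<rho> C n0 where "0 < \<rho>" "\<And>n. n0 \<le> n \<Longrightarrow> \<rho> \<le> freq n (indicator (Q C))"
proof -
  obtain \<rho> n0 where \<rho>: "0 < \<rho>" "\<And>n. n0 \<le> n \<Longrightarrow> \<rho> \<le> freq n (indicator (Low 1))"
    using low_freq by metis
  obtain H where H: "\<And>C. H C \<in> sets M" "(\<lambda>C. prob (H C)) \<longlonglongrightarrow> 0"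
    "\<And>w u C C'. norm u = 1 \<Longrightarrow> (\<And>k. norm (\<A> w k u) \<le> C' * exp (\<eta> * real k)) \<Longrightarrow> (w, u) \<notin> Up (real (Suc C)) \<Longrightarrow> w \<in> H C"
    using upper_growth_sets by metis
  \<comment> \<open>Bounds the cost per step in \<open>img_freq\<close>, with \<open>ln C0\<close>
    charged at every step; only the single \<open>ln C\<close> is left over, and \<open>n1\<close>
    takes care of it.\<close>
  define E where "E = (\<integral>w. psi w \<partial>M) + \<eta> / 2 + ln C0"
  have E: "0 < E" unfolding E_def using eta_pos C0 psi_nonneg by (simp add: add_nonneg_pos add_pos_nonneg)
  have "eventually (\<lambda>C. prob (H C) < \<rho> / 4) sequentially"
    using \<rho>(1) by (intro order_tendstoD(2)[OF H(2)]) auto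
  moreover have "eventually (\<lambda>C. 8 * E / \<rho> \<le> ln (real (Suc C))) sequentially"
  proof -
    have "filterlim (\<lambda>C. ln (real (Suc C))) at_top sequentially"
      by (intro filterlim_compose[OF ln_at_top] filterlim_compose[OF filterlim_real_sequentially] filterlim_Suc)
    then show ?thesis by (simp add: filterlim_at_top)
  qed
  moreover have "eventually (\<lambda>C::nat. 0 < C) sequentially" by (rule eventually_gt_at_top)
  ultimately have "eventually (\<lambda>C. prob (H C) < \<rho> / 4 \<and> 8 * E / \<rho> \<le> ln (real (Suc C)) \<and> 0 < C) sequentially"
    by eventually_elim simp
  from eventually_happens'[OF sequentially_bot this]
  obtain C where C: "prob (H C) < \<rho> / 4" "8 * E / \<rho> \<le> ln (real (Suc C))" "0 < C" by blast
  obtain n1 :: nat where n1: "8 / \<rho> \<le> real n1" using real_arch_simple by blast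
  let ?C = "real (Suc C)"
  have lnC: "0 < ln ?C" using C(3) by simp
  have meas: "indicator (Low 1) \<in> borel_measurable (M \<Otimes>\<^sub>M borel)" "indicator (Q C) \<in> borel_measurable (M \<Otimes>\<^sub>M borel)"
    "indicator (- Img ?C) \<in> borel_measurable (M \<Otimes>\<^sub>M borel)"
    "indicator (- Up ?C) \<in> borel_measurable (M \<Otimes>\<^sub>M borel)"
    using gdelta_sets[OF gdelta_Low[of 1]] Compl_sets[OF gdelta_sets[OF gdelta_Img]] Compl_sets[OF gdelta_sets[OF gdelta_Up]]
      Q_sets by auto
  have bd: "\<bar>indicator B z\<bar> \<le> (1::real)" for B and z :: "'w \<times> 'x" by (auto simp: indicator_def)
  have g2: "(\<lambda>z. indicator (- Img ?C) z + indicator (- Up ?C) z :: real) \<in> borel_measurable (M \<Otimes>\<^sub>M borel)"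
    by (intro borel_measurable_add meas)
  have g3: "(\<lambda>z. indicator (Q C) z + (indicator (- Img ?C) z + indicator (- Up ?C) z) :: real) \<in> borel_measurable (M \<Otimes>\<^sub>M borel)"
    by (intro borel_measurable_add meas)
  have bd2: "\<bar>indicator (- Img ?C) z + indicator (- Up ?C) z\<bar> \<le> (2::real)"
    and bd3: "\<bar>indicator (Q C) z + (indicator (- Img ?C) z + indicator (- Up ?C) z)\<bar> \<le> (3::real)" for z
    by (auto simp: indicator_def)
  have up: "freq n (indicator (- Up ?C)) \<le> prob (H C)" for n
  proof (rule freq_base[OF H(1) meas(4)])
    fix j w assume w: "w \<in> Y" and notin: "(\<sigma> ^^ j) w \<notin> H C"
    have "norm (\<A> ((\<sigma> ^^ j) w) k (snd (state j w))) \<le> (C0 * exp (\<eta> * real j) / norm (\<A> w j (v w))) * exp (\<eta> * real k)" for k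
      unfolding norm_state[OF w] using v_upper[OF w, of "k + j"] nonzero[OF w, of j]
      by (simp add: divide_right_mono exp_add algebra_simps)
    then have "((\<sigma> ^^ j) w, snd (state j w)) \<in> Up ?C"
      using H(3)[OF norm_snd_state[OF w]] notin by blast
    then show "indicator (- Up ?C) (state j w) = (0::real)" using fst_state[of j w] by (cases "state j w") simp
  qed (auto simp: indicator_def)
  show ?thesis
  proof (rule that[of "\<rho> / 2" "max n0 (Suc n1)" C])
    show "0 < \<rho> / 2" using \<rho>(1) by simp
    fix n assume n: "max n0 (Suc n1) \<le> n"
    then obtain m where m: "n = Suc m" by (cases n) auto
    have img: "freq n (indicator (- Img ?C)) \<le> \<rho> / 4"
    proof -
      have "ln ?C * (freq n (indicator (- Img ?C)) * real n) \<le> ln ?C + real n * (\<integral>w. psi w \<partial>M) + (\<eta> / 2 * real n + ln C0)"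
        unfolding m by (rule img_freq) (use C(3) in simp)
      also have "\<dots> \<le> ln ?C + real n * E"
        using C0 n unfolding E_def m by (simp add: algebra_simps)
      also have "\<dots> \<le> ln ?C * (\<rho> / 8 * real n) + real n * (ln ?C * \<rho> / 8)"
      proof (intro add_mono mult_left_mono)
        have "8 / \<rho> \<le> real n" using n1 n by simp
        then have "1 \<le> \<rho> / 8 * real n" using \<rho>(1) by (simp add: field_simps)
        then show "ln ?C \<le> ln ?C * (\<rho> / 8 * real n)" using mult_left_mono[of 1 "\<rho> / 8 * real n" "ln ?C"] lnC by simp
        show "E \<le> ln ?C * \<rho> / 8" using C(2) \<rho>(1) by (simp add: field_simps)
      qed simp
      also have "\<dots> = ln ?C * (\<rho> / 4 * real n)" by (simp add: algebra_simps)
      finally show ?thesis using lnC n by simp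
    qed
    have "freq n (indicator (Low 1)) \<le> freq n (\<lambda>z. indicator (Q C) z + (indicator (- Img ?C) z + indicator (- Up ?C) z))"
    proof (rule freq_mono[OF meas(1) bd g3 bd3])
      fix j w assume w: "w \<in> Y"
      obtain p u where st: "state j w = (p, u)" by (cases "state j w")
      then have "norm u = 1" using norm_snd_state[OF w, of j] by simp
      moreover have "(p, u) \<in> Low ?C" if "(p, u) \<in> Low 1"
      proof -
        have "exp (- \<eta> * real k) \<le> ?C * norm (\<A> p k u)" for k
        proof -
          have "exp (- \<eta> * real k) \<le> 1 * norm (\<A> p k u)" using that unfolding Low_def by blast
          also have "\<dots> \<le> ?C * norm (\<A> p k u)" by (intro mult_right_mono) auto
          finally show ?thesis .
        qed
        then show ?thesis unfolding Low_def by simp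
      qed
      ultimately show "indicator (Low 1) (state j w) \<le> indicator (Q C) (state j w) + (indicator (- Img ?C) (state j w) + indicator (- Up ?C) (state j w) :: real)"
        unfolding st Q_def by (auto simp: indicator_def)
    qed
    also have "\<dots> = freq n (indicator (Q C)) + freq n (\<lambda>z. indicator (- Img ?C) z + indicator (- Up ?C) z)"
      by (rule freq_add[OF meas(2) bd g2 bd2])
    also have "freq n (\<lambda>z. indicator (- Img ?C) z + indicator (- Up ?C) z) = freq n (indicator (- Img ?C)) + freq n (indicator (- Up ?C))"
      by (rule freq_add[OF meas(3) bd meas(4) bd])
    finally show "\<rho> / 2 \<le> freq n (indicator (Q C))"
      using \<rho>(2)[of n] img up[of n] C(1) n by simp
  qed
qed

end

subsection \<open>Invariant means\<close>

context neutral_cocycle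
begin

definition bounded_meas :: "('w \<times> 'x \<Rightarrow> real) \<Rightarrow> bool" where
  "bounded_meas f \<longleftrightarrow> f \<in> borel_measurable (M \<Otimes>\<^sub>M borel) \<and> (\<exists>B. \<forall>z. \<bar>f z\<bar> \<le> B)"

lemma bounded_meas_const [simp]: "bounded_meas (\<lambda>_. c)"
  unfolding bounded_meas_def by auto

lemma bounded_meas_add:
  assumes "bounded_meas f" "bounded_meas g"
  shows "bounded_meas (\<lambda>z. f z + g z)"
proof -
  obtain B B' where "\<And>z. \<bar>f z\<bar> \<le> B" "\<And>z. \<bar>g z\<bar> \<le> B'" using assms unfolding bounded_meas_def by blast
  then have "\<bar>f z + g z\<bar> \<le> B + B'" for z by (intro order_trans[OF abs_triangle_ineq] add_mono)
  then show ?thesis using assms unfolding bounded_meas_def by (auto intro!: exI[of _ "B + B'"])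
qed

lemma bounded_meas_mult:
  assumes "bounded_meas f" "bounded_meas g"
  shows "bounded_meas (\<lambda>z. f z * g z)"
proof -
  obtain B B' where B: "\<And>z. \<bar>f z\<bar> \<le> B" "\<And>z. \<bar>g z\<bar> \<le> B'" using assms unfolding bounded_meas_def by blast
  then have "0 \<le> B" using abs_ge_zero order_trans by blast
  then have "\<bar>f z * g z\<bar> \<le> B * B'" for z unfolding abs_mult using B by (intro mult_mono) auto
  then show ?thesis using assms unfolding bounded_meas_def by (auto intro!: exI[of _ "B * B'"])
qed

lemma bounded_meas_indicator: "B \<in> sets (M \<Otimes>\<^sub>M borel) \<Longrightarrow> bounded_meas (indicator B)"
  unfolding bounded_meas_def by (intro conjI borel_measurable_indicator exI[of _ 1]) (auto simp: indicator_def)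

lemma bounded_meas_T: "bounded_meas f \<Longrightarrow> bounded_meas (\<lambda>z. f (T n z))"
  unfolding bounded_meas_def using measurable_compose[OF T_measurable[of n], of f borel] by blast

lemma bounded_meas_sum:
  assumes "finite I" "\<And>i. i \<in> I \<Longrightarrow> bounded_meas (f i)"
  shows "bounded_meas (\<lambda>z. \<Sum>i\<in>I. f i z)"
  using assms by (induction I rule: finite_induct) (auto intro: bounded_meas_add)

lemma uniform_bounds:
  obtains b :: "('w \<times> 'x \<Rightarrow> real) \<Rightarrow> real" where "\<And>f z. bounded_meas f \<Longrightarrow> \<bar>f z\<bar> \<le> b f"
proof -
  have "\<forall>f. \<exists>B. bounded_meas f \<longrightarrow> (\<forall>z. \<bar>f z\<bar> \<le> B)" unfolding bounded_meas_def by blast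
  from choice[OF this] show ?thesis using that by blast
qed

text \<open>The operators depend on \<open>w\<close> only strongly measurably; a countable dense set
  of vectors detects a large operator norm.\<close>

lemma norm_step_sets: "{w. c < norm (\<A> w 1)} \<in> sets M"
proof -
  obtain D :: "'x set" where D: "countable D" "\<And>X. open X \<Longrightarrow> X \<noteq> {} \<Longrightarrow> \<exists>d\<in>D. d \<in> X"
    using countable_dense_exists by blast
  show ?thesis
  proof (cases "c < 0")
    case True
    then have "{w. c < norm (\<A> w 1)} = space M" by (auto simp: space_M intro: less_le_trans)
    then show ?thesis by simp
  next
    case False
    have "c < norm (\<A> w 1) \<longleftrightarrow> (\<exists>d\<in>D. c * norm d < norm (\<A> w 1 d))" for w
    proof
      assume "c < norm (\<A> w 1)"
      have "\<exists>x. c * norm x < norm (\<A> w 1 x)"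
      proof (rule ccontr)
        assume "\<not> ?thesis"
        then have "norm (\<A> w 1 x) \<le> c * norm x" for x by (meson not_le)
        then have "norm (\<A> w 1) \<le> c" using False by (intro norm_blinfun_bound) auto
        then show False using \<open>c < norm (\<A> w 1)\<close> by simp
      qed
      then obtain x where x: "c * norm x < norm (\<A> w 1 x)" by blast
      have "open {x. c * norm x < norm (\<A> w 1 x)}" by (intro open_Collect_less continuous_intros)
      then show "\<exists>d\<in>D. c * norm d < norm (\<A> w 1 d)" using D(2)[of "{x. c * norm x < norm (\<A> w 1 x)}"] x by auto
    next
      assume "\<exists>d\<in>D. c * norm d < norm (\<A> w 1 d)"
      then obtain d where d: "c * norm d < norm (\<A> w 1 d)" by blast
      also have "\<dots> \<le> norm (\<A> w 1) * norm d" by (rule norm_blinfun)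
      finally show "c < norm (\<A> w 1)" by (meson mult_right_mono norm_ge_zero not_le)
    qed
    then have "{w. c < norm (\<A> w 1)} = (\<Union>d\<in>D. {w \<in> space M. c * norm d < norm (\<A> w 1 d)})"
      by (auto simp: space_M)
    also have "\<dots> \<in> sets M"
    proof (rule sets.countable_UN'[OF D(1)], rule image_subsetI)
      show "{w \<in> space M. c * norm d < norm (\<A> w 1 d)} \<in> sets M" for d by measurable
    qed
    finally show ?thesis .
  qed
qed

text \<open>\<open>Low\<close> at time 1 bounds the inverse norm of \<open>\<A> w 1 u\<close> by
  \<open>Suc C * exp \<eta>\<close>. This gives \<open>Img\<close>, and with a second such factor
  \<open>Up\<close>. For \<open>Low\<close> an upper bound on the same norm is used, hence
  \<open>max 1 (norm (\<A> (fst z) 1))\<close>.\<close>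

lemma T_Q:
  assumes "z \<in> Q C" and D: "(real (Suc C))\<^sup>2 * exp (2 * \<eta>) * max 1 (norm (\<A> (fst z) 1)) < real (Suc D)"
  shows "T 1 z \<in> Q D"
proof -
  obtain w u where z: "z = (w, u)" by (cases z)
  let ?B = "\<A> w 1" and ?c = "real (Suc C)" and ?d = "real (Suc D)"
  have u: "norm u = 1" and low: "\<And>k. exp (- \<eta> * real k) \<le> ?c * norm (\<A> w k u)"
    and up: "\<And>k. norm (\<A> w k u) \<le> ?c * exp (\<eta> * real k)"
    using assms(1) unfolding z Q_def Low_def Up_def by auto
  have low1: "exp (- \<eta>) \<le> ?c * norm (?B u)" using low[of 1] by simp
  then have pos: "0 < norm (?B u)" by (metis exp_gt_zero mult_zero_right norm_eq_zero not_le zero_less_norm_iff)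
  have inv: "inverse (norm (?B u)) \<le> ?c * exp \<eta>"
  proof -
    have "1 \<le> ?c * norm (?B u) * exp \<eta>"
      using mult_right_mono[OF low1, of "exp \<eta>"] by (simp add: exp_minus)
    then show ?thesis using pos by (simp add: field_simps)
  qed
  have T: "T 1 z = (\<sigma> w, sgn (?B u))" unfolding T_def z by simp
  have nT: "norm (\<A> (\<sigma> w) k (sgn (?B u))) = norm (\<A> w (Suc k) u) / norm (?B u)" for k
    using norm_T[of 1 z k] unfolding T by (simp add: z Suc_eq_plus1 del: One_nat_def)
  let ?K = "?c\<^sup>2 * exp (2 * \<eta>)"
  have K: "?c * exp \<eta> \<le> ?K"
  proof (rule mult_mono)
    show "?c \<le> ?c\<^sup>2" by (simp add: power2_eq_square)
  qed (use eta_pos in auto)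
  have D': "?K * max 1 (norm ?B) < ?d" using D z by simp
  have "?K * 1 \<le> ?K * max 1 (norm ?B)" by (intro mult_left_mono) auto
  then have K': "?K < ?d" using D' by linarith
  have ceta: "?c * exp \<eta> < ?d" using K K' by linarith
  have "norm (sgn (?B u)) = 1" using pos by (simp add: norm_sgn)
  moreover have "(\<sigma> w, sgn (?B u)) \<in> Img ?d"
  proof -
    have "sgn (?B u) = ?B (inverse (norm (?B u)) *\<^sub>R u)" by (simp add: sgn_div_norm blinfun.scaleR_right)
    moreover have "inverse (norm (?B u)) *\<^sub>R u \<in> ball 0 ?d" using inv ceta u by simp
    ultimately have "sgn (?B u) \<in> ?B ` ball 0 ?d" by blast
    moreover have "inv \<sigma> (\<sigma> w) = w" using bij by (simp add: bij_is_inj)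
    ultimately show ?thesis unfolding Img_def using closure_subset[of "?B ` ball 0 ?d"] by auto
  qed
  moreover have "(\<sigma> w, sgn (?B u)) \<in> Low ?d"
    unfolding Low_def split_beta mem_Collect_eq fst_conv snd_conv
  proof
    fix k
    have "norm (?B u) \<le> norm ?B" using norm_blinfun[of ?B u] u by simp
    have "exp (- \<eta> * real k) * norm (?B u) \<le> exp (- \<eta> * real k) * norm ?B"
      using \<open>norm (?B u) \<le> norm ?B\<close> by simp
    also have "\<dots> = exp (- \<eta> * real (Suc k)) * (exp \<eta> * norm ?B)"
      by (simp add: exp_add[symmetric] algebra_simps)
    also have "\<dots> \<le> ?c * norm (\<A> w (Suc k) u) * (exp \<eta> * norm ?B)" by (intro mult_right_mono low) auto
    also have "\<dots> = ?c * exp \<eta> * norm ?B * norm (\<A> w (Suc k) u)" by simp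
    also have "\<dots> \<le> ?d * norm (\<A> w (Suc k) u)"
    proof (rule mult_right_mono)
      have "?c * exp \<eta> * norm ?B \<le> ?K * max 1 (norm ?B)" by (intro mult_mono[OF K]) auto
      then show "?c * exp \<eta> * norm ?B \<le> ?d" using D' by linarith
    qed simp
    finally show "exp (- \<eta> * real k) \<le> ?d * norm (\<A> (\<sigma> w) k (sgn (?B u)))"
      unfolding nT using pos by (simp add: field_simps)
  qed
  moreover have "(\<sigma> w, sgn (?B u)) \<in> Up ?d"
    unfolding Up_def split_beta mem_Collect_eq fst_conv snd_conv nT
  proof
    fix k
    have "norm (\<A> w (Suc k) u) * inverse (norm (?B u)) \<le> (?c * exp (\<eta> * real (Suc k))) * (?c * exp \<eta>)"
      by (intro mult_mono up inv) auto
    also have "\<dots> = ?K * exp (\<eta> * real k)"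
    proof -
      have "exp (\<eta> * real (Suc k)) * exp \<eta> = exp (2 * \<eta>) * exp (\<eta> * real k)"
        by (simp add: exp_add[symmetric] algebra_simps)
      then show ?thesis by (simp only: power2_eq_square mult.assoc mult.left_commute)
    qed
    also have "\<dots> \<le> ?d * exp (\<eta> * real k)" using K' by (intro mult_right_mono) auto
    finally show "norm (\<A> w (Suc k) u) / norm (?B u) \<le> ?d * exp (\<eta> * real k)"
      by (simp add: divide_inverse)
  qed
  ultimately show ?thesis unfolding T Q_def by simp
qed


lemma step_tail_sets: "{w. real (Suc D) \<le> K * max 1 (norm (\<A> w 1))} \<in> sets M"
proof -
  have "(\<lambda>w. norm (\<A> w 1)) \<in> borel_measurable M"
    by (rule borel_measurableI_greater) (use norm_step_sets in \<open>simp add: space_M\<close>)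
  then have "{w \<in> space M. real (Suc D) \<le> K * max 1 (norm (\<A> w 1))} \<in> sets M" by measurable
  then show ?thesis by (simp add: space_M)
qed

lemma one_step_tail:
  assumes "0 < \<delta>"
  shows "\<exists>D0. \<forall>D\<ge>D0. prob {w. real (Suc D) \<le> K * max 1 (norm (\<A> w 1))} < \<delta>"
proof -
  let ?R = "\<lambda>D. {w. real (Suc D) \<le> K * max 1 (norm (\<A> w 1))}"
  have dec: "decseq ?R" by (rule decseq_SucI) auto
  have "(\<Inter>D. ?R D) = {}"
  proof (rule equals0I)
    fix w assume "w \<in> (\<Inter>D. ?R D)"
    then have le: "\<And>D. real (Suc D) \<le> K * max 1 (norm (\<A> w 1))" by blast
    obtain m :: nat where "K * max 1 (norm (\<A> w 1)) < real m" using reals_Archimedean2 by blast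
    then show False using le[of m] by linarith
  qed
  then have "(\<lambda>D. prob (?R D)) \<longlonglongrightarrow> 0"
    using finite_Lim_measure_decseq[OF _ dec] step_tail_sets by (simp add: image_subset_iff)
  then have "eventually (\<lambda>D. prob (?R D) < \<delta>) sequentially" using assms by (intro order_tendstoD(2)) auto
  then show ?thesis unfolding eventually_sequentially .
qed

end

text \<open>A finitely additive mean, possibly of mass less than 1. \<open>mean_base\<close> makes
  its marginal on the base subordinate to \<open>M\<close>; this is the trace of countable
  additivity that allows small sets of base points to be neglected.\<close>

locale invariant_mean = neutral_cocycle M \<sigma> \<A> \<eta>
  for M :: "'w::polish_space measure" and \<sigma> :: "'w \<Rightarrow> 'w"
    and \<A> :: "'w \<Rightarrow> nat \<Rightarrow> 'x::{banach, second_countable_topology} \<Rightarrow>\<^sub>L 'x" and \<eta> +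
  fixes \<Lambda> :: "('w \<times> 'x \<Rightarrow> real) \<Rightarrow> real"
  assumes mean_add: "\<And>f g. bounded_meas f \<Longrightarrow> bounded_meas g \<Longrightarrow> \<Lambda> (\<lambda>z. f z + g z) = \<Lambda> f + \<Lambda> g"
    and mean_cmult: "\<And>c f. bounded_meas f \<Longrightarrow> \<Lambda> (\<lambda>z. c * f z) = c * \<Lambda> f"
    and mean_mono: "\<And>f g. bounded_meas f \<Longrightarrow> bounded_meas g \<Longrightarrow> (\<And>z. f z \<le> g z) \<Longrightarrow> \<Lambda> f \<le> \<Lambda> g"
    and mean_invariant: "\<And>f. bounded_meas f \<Longrightarrow> (\<And>z. 0 \<le> f z \<and> f z \<le> 1) \<Longrightarrow> \<Lambda> (\<lambda>z. f (T 1 z)) = \<Lambda> f"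
    and mean_base: "\<And>f R. bounded_meas f \<Longrightarrow> R \<in> sets M \<Longrightarrow> (\<And>z. 0 \<le> f z \<and> f z \<le> 1) \<Longrightarrow>
      (\<And>z. fst z \<notin> R \<Longrightarrow> f z = 0) \<Longrightarrow> \<Lambda> f \<le> prob R"
begin

lemma mean_abs_le:
  assumes f: "bounded_meas f" and B: "\<And>z. \<bar>f z\<bar> \<le> B"
  shows "\<bar>\<Lambda> f\<bar> \<le> B"
proof -
  have B0: "0 \<le> B" using B[of undefined] by simp
  have "\<Lambda> (\<lambda>_. 1) \<le> prob (space M)" by (rule mean_base[OF bounded_meas_const sets.top]) (simp_all add: space_M)
  then have le: "\<Lambda> (\<lambda>_. c * 1) \<le> c" if "0 \<le> c" for c
    using that by (simp only: mean_cmult[OF bounded_meas_const] prob_space mult_left_le)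
  have "\<Lambda> g \<le> B" if "bounded_meas g" "\<And>z. \<bar>g z\<bar> \<le> B" for g
  proof -
    have "\<Lambda> g \<le> \<Lambda> (\<lambda>_. B * 1)"
      by (rule mean_mono[OF that(1) bounded_meas_const]) (use that(2) in \<open>simp add: abs_le_iff\<close>)
    then show ?thesis using le[OF B0] by simp
  qed
  from this[OF f B] this[OF bounded_meas_mult[OF bounded_meas_const f], of "-1"] show ?thesis
    using B mean_cmult[OF f, of "-1"] by (simp add: abs_le_iff)
qed

end

locale tight_mean = invariant_mean M \<sigma> \<A> \<eta> \<Lambda>
  for M :: "'w::polish_space measure" and \<sigma> :: "'w \<Rightarrow> 'w"
    and \<A> :: "'w \<Rightarrow> nat \<Rightarrow> 'x::{banach, second_countable_topology} \<Rightarrow>\<^sub>L 'x" and \<eta> \<Lambda> +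
  assumes mean_pos: "0 < \<Lambda> (\<lambda>_. 1)"
    and mean_tight: "\<And>\<delta>. 0 < \<delta> \<Longrightarrow> \<exists>C. \<Lambda> (\<lambda>_. 1) - \<delta> < \<Lambda> (indicator (Q C))"

context cocycle_section
begin

lemma freq_cmult:
  assumes "bounded_meas f"
  shows "freq n (\<lambda>z. c * f z) = c * freq n f"
  unfolding freq_def by (simp add: sum_distrib_left mult.left_commute)

lemma integral_state_abs_le:
  fixes f :: "'w \<times> 'x \<Rightarrow> real"
  assumes "\<And>z. \<bar>f z\<bar> \<le> B" "f \<in> borel_measurable (M \<Otimes>\<^sub>M borel)"
  shows "\<bar>\<integral>w. indicator Y w * f (state j w) \<partial>M\<bar> \<le> B"
proof -
  have B: "0 \<le> B" using assms(1)[of undefined] by simp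
  have "\<bar>\<integral>w. indicator Y w * f (state j w) \<partial>M\<bar> \<le> (\<integral>w. \<bar>indicator Y w * f (state j w)\<bar> \<partial>M)"
    using integral_norm_bound[of M "\<lambda>w. indicator Y w * f (state j w)"] by simp
  also have "\<dots> \<le> (\<integral>w. B \<partial>M)"
    using assms(1) B by (intro integral_mono integrable_abs integrable_state[OF assms(2,1)]) (auto simp: indicator_def)
  finally show ?thesis by (simp add: prob_space)
qed

lemma freq_abs_le:
  fixes f :: "'w \<times> 'x \<Rightarrow> real"
  assumes "\<And>z. \<bar>f z\<bar> \<le> B" "f \<in> borel_measurable (M \<Otimes>\<^sub>M borel)"
  shows "\<bar>freq n f\<bar> \<le> B"
proof (cases "n = 0")
  case True
  then show ?thesis using assms(1)[of undefined] unfolding freq_def by simp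
next
  case False
  have "\<bar>\<Sum>j<n. \<integral>w. indicator Y w * f (state j w) \<partial>M\<bar> \<le> (\<Sum>j<n. B)"
    by (intro order_trans[OF sum_abs] sum_mono integral_state_abs_le assms)
  then show ?thesis using False unfolding freq_def by (simp add: field_simps)
qed

lemma freq_shift:
  fixes f :: "'w \<times> 'x \<Rightarrow> real"
  assumes "\<And>z. \<bar>f z\<bar> \<le> B" "f \<in> borel_measurable (M \<Otimes>\<^sub>M borel)"
  shows "\<bar>freq n (\<lambda>z. f (T 1 z)) - freq n f\<bar> \<le> 2 * B / real n"
proof (cases "n = 0")
  case False
  let ?I = "\<lambda>j. \<integral>w. indicator Y w * f (state j w) \<partial>M"
  have st: "T 1 (state j w) = state (Suc j) w" for j w
    unfolding state_def using T_add[of 1 j "(w, v w)"] by simp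
  have I: "\<bar>?I j\<bar> \<le> B" for j by (rule integral_state_abs_le[OF assms])
  have "freq n (\<lambda>z. f (T 1 z)) - freq n f = ((\<Sum>j<n. ?I (Suc j)) - (\<Sum>j<n. ?I j)) / real n"
    unfolding freq_def st by (simp add: diff_divide_distrib)
  also have "(\<Sum>j<n. ?I (Suc j)) - (\<Sum>j<n. ?I j) = ?I n - ?I 0"
    unfolding sum_subtractf[symmetric] by (rule sum_lessThan_telescope)
  finally have "\<bar>freq n (\<lambda>z. f (T 1 z)) - freq n f\<bar> = \<bar>?I n - ?I 0\<bar> / real n" by simp
  also have "\<dots> \<le> 2 * B / real n" using I[of n] I[of 0] by (intro divide_right_mono) auto
  finally show ?thesis .
qed (simp add: freq_def)

text \<open>Invariance holds in the limit because a shift of time by one changes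
  \<open>freq n f\<close> by at most \<open>2 * B / n\<close>; the mass on some \<open>Q C\<close>
  survives by \<open>Q_freq\<close>.\<close>

lemma exists_limit_mean: "\<exists>\<Lambda>. invariant_mean M \<sigma> \<A> \<eta> \<Lambda> \<and> (\<exists>C. 0 < \<Lambda> (indicator (Q C)))"
proof -
  \<comment> \<open>The value 0 off \<open>bounded_meas\<close> gives every function a bound
    independent of \<open>n\<close>, as \<open>simultaneous_limit_filter\<close> demands at all
    indices.\<close>
  define L where "L n f = (if bounded_meas f then freq n f else 0)" for n f
  obtain b where b: "\<And>f z. bounded_meas f \<Longrightarrow> \<bar>f z\<bar> \<le> b f" using uniform_bounds by metis
  have "\<bar>L n f\<bar> \<le> \<bar>b f\<bar>" for n f
  proof (cases "bounded_meas f")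
    case True
    have "\<bar>freq n f\<bar> \<le> b f"
      by (rule freq_abs_le) (use b[OF True] True in \<open>auto simp: bounded_meas_def\<close>)
    then show ?thesis using True unfolding L_def by simp
  qed (simp add: L_def)
  then obtain F \<Lambda> where
    F: "F \<noteq> bot" "F \<le> sequentially" and lim0: "\<And>f. ((\<lambda>n. L n f) \<longlongrightarrow> \<Lambda> f) F"
    by (rule simultaneous_limit_filter[of L "\<lambda>f. \<bar>b f\<bar>"]) blast
  have lim: "((\<lambda>n. freq n f) \<longlongrightarrow> \<Lambda> f) F" if "bounded_meas f" for f
    using lim0[of f] that unfolding L_def by simp
  have ms: "f \<in> borel_measurable (M \<Otimes>\<^sub>M borel)" if "bounded_meas f" for f
    using that unfolding bounded_meas_def by simp
  have "invariant_mean M \<sigma> \<A> \<eta> \<Lambda>"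
  proof unfold_locales
    fix f g assume fg: "bounded_meas f" "bounded_meas g"
    have "freq n (\<lambda>z. f z + g z) = freq n f + freq n g" for n
      by (rule freq_add[OF ms[OF fg(1)] b[OF fg(1)] ms[OF fg(2)] b[OF fg(2)]])
    then show "\<Lambda> (\<lambda>z. f z + g z) = \<Lambda> f + \<Lambda> g"
      using tendsto_unique[OF F(1) lim[OF bounded_meas_add[OF fg]]] tendsto_add[OF lim[OF fg(1)] lim[OF fg(2)]] by simp
    assume le: "\<And>z. f z \<le> g z"
    have "freq n f \<le> freq n g" for n
      by (rule freq_mono[OF ms[OF fg(1)] b[OF fg(1)] ms[OF fg(2)] b[OF fg(2)] le])
    then show "\<Lambda> f \<le> \<Lambda> g" by (intro tendsto_le[OF F(1) lim[OF fg(2)] lim[OF fg(1)]] always_eventually) simp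
  next
    fix c f assume f: "bounded_meas f"
    show "\<Lambda> (\<lambda>z. c * f z) = c * \<Lambda> f"
      using tendsto_unique[OF F(1) lim[OF bounded_meas_mult[OF bounded_meas_const f]]] tendsto_mult_left[OF lim[OF f], of c]
      unfolding freq_cmult[OF f] .
  next
    fix f assume f: "bounded_meas f"
    have "((\<lambda>n. freq n (\<lambda>z. f (T 1 z)) - freq n f) \<longlongrightarrow> 0) F"
    proof (rule tendsto_mono[OF F(2)])
      show "(\<lambda>n. freq n (\<lambda>z. f (T 1 z)) - freq n f) \<longlonglongrightarrow> 0"
      proof (rule Lim_null_comparison)
        show "eventually (\<lambda>n. norm (freq n (\<lambda>z. f (T 1 z)) - freq n f) \<le> 2 * b f / real n) sequentially"
          unfolding real_norm_def by (intro always_eventually allI freq_shift b f ms)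
        show "(\<lambda>n. 2 * b f / real n) \<longlonglongrightarrow> 0" by (rule lim_const_over_n)
      qed
    qed
    moreover have "((\<lambda>n. freq n (\<lambda>z. f (T 1 z)) - freq n f) \<longlongrightarrow> \<Lambda> (\<lambda>z. f (T 1 z)) - \<Lambda> f) F"
      by (intro tendsto_diff lim bounded_meas_T f)
    ultimately have "\<Lambda> (\<lambda>z. f (T 1 z)) - \<Lambda> f = 0" using tendsto_unique[OF F(1)] by blast
    then show "\<Lambda> (\<lambda>z. f (T 1 z)) = \<Lambda> f" by simp
  next
    fix f R assume f: "bounded_meas f" and R: "R \<in> sets M" and le: "\<And>z. 0 \<le> f z \<and> f z \<le> 1"
      and zero: "\<And>z. fst z \<notin> R \<Longrightarrow> f z = 0"
    have "freq n f \<le> prob R" for n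
      by (rule freq_base[OF R ms[OF f] le]) (simp add: zero fst_state)
    then show "\<Lambda> f \<le> prob R"
      by (intro tendsto_upperbound[OF lim[OF f] _ F(1)] always_eventually) simp
  qed
  moreover have "\<exists>C. 0 < \<Lambda> (indicator (Q C))"
  proof -
    obtain \<rho> C n0 where C: "0 < \<rho>" "\<And>n. n0 \<le> n \<Longrightarrow> \<rho> \<le> freq n (indicator (Q C))" using Q_freq by metis
    have "eventually (\<lambda>n. \<rho> \<le> freq n (indicator (Q C))) F"
      using C(2) by (intro filter_leD[OF F(2)]) (auto simp: eventually_sequentially)
    then have "\<rho> \<le> \<Lambda> (indicator (Q C))"
      by (intro tendsto_lowerbound[OF lim[OF bounded_meas_indicator[OF Q_sets]] _ F(1)])
    then show ?thesis using C(1) by (intro exI[of _ C]) linarith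
  qed
  ultimately show ?thesis by (intro exI[of _ \<Lambda>] conjI)
qed

text \<open>The part of \<open>\<Lambda>\<close> carried by the compact sets \<open>Q C\<close>. It is still invariant, because \<open>T 1\<close>
  maps \<open>Q C\<close> into \<open>Q D\<close> outside a small set of base points when \<open>D\<close> is large.\<close>

theorem exists_tight_mean: "\<exists>\<Lambda>. tight_mean M \<sigma> \<A> \<eta> \<Lambda>"
proof -
  obtain \<Phi> where "invariant_mean M \<sigma> \<A> \<eta> \<Phi>" and pos: "\<exists>C. 0 < \<Phi> (indicator (Q C))"
    using exists_limit_mean by blast
  then interpret \<Phi>: invariant_mean M \<sigma> \<A> \<eta> \<Phi> by simp
  note add = \<Phi>.mean_add and cmult = \<Phi>.mean_cmult and mono = \<Phi>.mean_mono and inv = \<Phi>.mean_invariant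
    and base = \<Phi>.mean_base and bound = \<Phi>.mean_abs_le
  let ?q = "\<lambda>C. indicator (Q C) :: 'w \<times> 'x \<Rightarrow> real"
  have q: "bounded_meas (?q C)" for C by (rule bounded_meas_indicator[OF Q_sets])
  have qf: "bounded_meas (\<lambda>z. ?q C z * f z)" if "bounded_meas f" for C f by (rule bounded_meas_mult[OF q that])
  define L where "L n f = (if bounded_meas f then \<Phi> (\<lambda>z. ?q n z * f z) else 0)" for n f
  obtain b where b: "\<And>f z. bounded_meas f \<Longrightarrow> \<bar>f z\<bar> \<le> b f" using uniform_bounds by metis
  have "\<bar>L n f\<bar> \<le> \<bar>b f\<bar>" for n f
  proof (cases "bounded_meas f")
    case True
    have "\<bar>?q n z * f z\<bar> \<le> b f" for z
      using b[OF True, of z] order_trans[OF abs_ge_zero b[OF True, of z]] by (auto simp: indicator_def)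
    from bound[OF qf[OF True] this] show ?thesis using True unfolding L_def by simp
  qed (simp add: L_def)
  then obtain F \<Lambda> where
    F: "F \<noteq> bot" "F \<le> sequentially" and lim0: "\<And>f. ((\<lambda>n. L n f) \<longlongrightarrow> \<Lambda> f) F"
    by (rule simultaneous_limit_filter[of L "\<lambda>f. \<bar>b f\<bar>"]) blast
  have lim: "((\<lambda>n. \<Phi> (\<lambda>z. ?q n z * f z)) \<longlongrightarrow> \<Lambda> f) F" if "bounded_meas f" for f
    using lim0[of f] that unfolding L_def by simp
  have \<Lambda>_add: "\<Lambda> (\<lambda>z. f z + g z) = \<Lambda> f + \<Lambda> g" if "bounded_meas f" "bounded_meas g" for f g
    using tendsto_unique[OF F(1) lim[OF bounded_meas_add[OF that]]] tendsto_add[OF lim[OF that(1)] lim[OF that(2)]]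
    by (simp add: distrib_left add[OF qf qf] that)
  have \<Lambda>_cmult: "\<Lambda> (\<lambda>z. c * f z) = c * \<Lambda> f" if "bounded_meas f" for c f
    using tendsto_unique[OF F(1) lim[OF bounded_meas_mult[OF bounded_meas_const that]]] tendsto_mult_left[OF lim[OF that], of c]
    by (simp add: mult.left_commute[of _ c] cmult[OF qf] that)
  have Q_int: "?q n z * ?q C z = ?q C z" if "C \<le> n" for n C z
    using Q_mono[OF that] by (auto simp: indicator_def)
  have \<Lambda>_Q: "\<Lambda> (?q C) = \<Phi> (?q C)" for C
  proof -
    have "\<Phi> (\<lambda>z. ?q n z * ?q C z) = \<Phi> (?q C)" if "C \<le> n" for n
      by (simp only: Q_int[OF that])
    then have "eventually (\<lambda>n. \<Phi> (\<lambda>z. ?q n z * ?q C z) = \<Phi> (?q C)) F"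
      by (intro filter_leD[OF F(2)]) (unfold eventually_sequentially, blast)
    then have "((\<lambda>n. \<Phi> (\<lambda>z. ?q n z * ?q C z)) \<longlongrightarrow> \<Phi> (?q C)) F" by (rule tendsto_eventually)
    then show ?thesis using tendsto_unique[OF F(1) lim[OF q]] by blast
  qed
  have \<Lambda>_mono: "\<Lambda> f \<le> \<Lambda> g" if "bounded_meas f" "bounded_meas g" "\<And>z. f z \<le> g z" for f g
  proof -
    have "\<Phi> (\<lambda>z. ?q n z * f z) \<le> \<Phi> (\<lambda>z. ?q n z * g z)" for n
      using that by (intro mono qf mult_left_mono) auto
    then show ?thesis by (intro tendsto_le[OF F(1) lim[OF that(2)] lim[OF that(1)]] always_eventually) simp
  qed
  have \<Lambda>_le: "\<Lambda> (\<lambda>z. f (T 1 z)) \<le> \<Lambda> f" if f: "bounded_meas f" "\<And>z. 0 \<le> f z \<and> f z \<le> 1" for f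
  proof -
    have fT: "bounded_meas (\<lambda>z. f (T 1 z))" by (rule bounded_meas_T[OF f(1)])
    have "\<Phi> (\<lambda>z. ?q C z * f (T 1 z)) \<le> \<Lambda> f" for C
    proof (rule field_le_epsilon)
      fix \<delta> :: real assume "0 < \<delta>"
      let ?K = "(real (Suc C))\<^sup>2 * exp (2 * \<eta>)"
      obtain D0 where D0: "\<And>D. D0 \<le> D \<Longrightarrow> prob {w. real (Suc D) \<le> ?K * max 1 (norm (\<A> w 1))} < \<delta>"
        using one_step_tail[OF \<open>0 < \<delta>\<close>] by blast
      have "\<Phi> (\<lambda>z. ?q C z * f (T 1 z)) - \<delta> \<le> \<Phi> (\<lambda>z. ?q D z * f z)" if "D0 \<le> D" for D
      proof -
        let ?R = "{w. real (Suc D) \<le> ?K * max 1 (norm (\<A> w 1))}"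
        note R = step_tail_sets[of D ?K]
        have RU: "?R \<times> UNIV \<in> sets (M \<Otimes>\<^sub>M (borel :: 'x measure))" using R by auto
        have iR: "bounded_meas (indicator (?R \<times> UNIV) :: 'w \<times> 'x \<Rightarrow> real)" by (rule bounded_meas_indicator[OF RU])
        \<comment> \<open>Either \<open>z\<close> moves from \<open>Q C\<close> into
          \<open>Q D\<close>, or the left side vanishes, or the base point lies in
          \<open>?R\<close>, whose probability is below \<delta>. The first term on the right is a
          function of \<open>T 1 z\<close>, so invariance of \<Phi> applies to it.\<close>
        have "?q C z * f (T 1 z) \<le> ?q D (T 1 z) * f (T 1 z) + indicator (?R \<times> UNIV) z" for z
        proof (cases "z \<in> Q C \<and> fst z \<notin> ?R")
          case True
          then have "T 1 z \<in> Q D" by (intro T_Q[of z C D]) (auto simp: not_le)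
          then show ?thesis using f(2)[of "T 1 z"] by (simp add: indicator_def)
        next
          case False
          then show ?thesis using f(2)[of "T 1 z"] by (cases z) (auto simp: indicator_def)
        qed
        then have "\<Phi> (\<lambda>z. ?q C z * f (T 1 z)) \<le> \<Phi> (\<lambda>z. ?q D (T 1 z) * f (T 1 z) + indicator (?R \<times> UNIV) z)"
          by (intro mono bounded_meas_add iR qf fT bounded_meas_T[OF qf[OF f(1)]])
        also have "\<dots> = \<Phi> (\<lambda>z. ?q D (T 1 z) * f (T 1 z)) + \<Phi> (indicator (?R \<times> UNIV))"
          by (rule add[OF bounded_meas_T[OF qf[OF f(1)]] iR])
        also have "\<Phi> (\<lambda>z. ?q D (T 1 z) * f (T 1 z)) = \<Phi> (\<lambda>z. ?q D z * f z)" by (rule inv[OF qf[OF f(1)]]) (use f(2) in \<open>auto simp: indicator_def\<close>)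
        also have "\<Phi> (indicator (?R \<times> UNIV)) \<le> prob ?R" by (rule base[OF iR R]) (auto simp: indicator_def)
        finally show ?thesis using D0[OF that] by simp
      qed
      then have "eventually (\<lambda>D. \<Phi> (\<lambda>z. ?q C z * f (T 1 z)) - \<delta> \<le> \<Phi> (\<lambda>z. ?q D z * f z)) F"
        by (intro filter_leD[OF F(2)]) (auto simp: eventually_sequentially)
      then have "\<Phi> (\<lambda>z. ?q C z * f (T 1 z)) - \<delta> \<le> \<Lambda> f" by (intro tendsto_lowerbound[OF lim[OF f(1)] _ F(1)])
      then show "\<Phi> (\<lambda>z. ?q C z * f (T 1 z)) \<le> \<Lambda> f + \<delta>" by simp
    qed
    then show ?thesis by (intro tendsto_upperbound[OF lim[OF fT] _ F(1)] always_eventually) simp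
  qed
  have "tight_mean M \<sigma> \<A> \<eta> \<Lambda>"
  proof (unfold_locales, fact \<Lambda>_add, fact \<Lambda>_cmult, fact \<Lambda>_mono)
    fix f assume f: "bounded_meas f" "\<And>z. 0 \<le> f z \<and> f z \<le> 1"
    \<comment> \<open>\<open>\<Lambda>_le\<close> is one inequality; applied to \<open>1 - f\<close>
      it yields the other.\<close>
    have minus: "bounded_meas (\<lambda>z. 1 + (-1) * f z)" by (intro bounded_meas_add bounded_meas_mult bounded_meas_const f)
    have "\<Lambda> (\<lambda>z. 1 + (-1) * f (T 1 z)) \<le> \<Lambda> (\<lambda>z. 1 + (-1) * f z)"
      by (rule \<Lambda>_le[OF minus]) (use f(2) in auto)
    moreover have "\<Lambda> (\<lambda>z. 1 + (-1) * f z) = \<Lambda> (\<lambda>_. 1) - \<Lambda> f" if "bounded_meas f" for f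
      using \<Lambda>_add[OF bounded_meas_const bounded_meas_mult[OF bounded_meas_const that], of 1 "-1"] \<Lambda>_cmult[OF that, of "-1"] by simp
    ultimately have "\<Lambda> f \<le> \<Lambda> (\<lambda>z. f (T 1 z))" using f(1) bounded_meas_T[OF f(1), of 1] by simp
    then show "\<Lambda> (\<lambda>z. f (T 1 z)) = \<Lambda> f" using \<Lambda>_le[OF f] by simp
  next
    fix f R assume f: "bounded_meas f" and R: "R \<in> sets M" and le: "\<And>z. 0 \<le> f z \<and> f z \<le> 1"
      and zero: "\<And>z. fst z \<notin> R \<Longrightarrow> f z = 0"
    have "\<Phi> (\<lambda>z. ?q n z * f z) \<le> prob R" for n
      by (rule base[OF qf[OF f] R]) (use le zero in \<open>auto simp: indicator_def\<close>)
    then show "\<Lambda> f \<le> prob R" by (intro tendsto_upperbound[OF lim[OF f] _ F(1)] always_eventually) simp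
  next
    obtain C where "0 < \<Phi> (?q C)" using pos by blast
    then have "0 < \<Lambda> (?q C)" using \<Lambda>_Q by simp
    also have "\<dots> \<le> \<Lambda> (\<lambda>_. 1)" by (rule \<Lambda>_mono[OF q bounded_meas_const]) (simp add: indicator_def)
    finally show "0 < \<Lambda> (\<lambda>_. 1)" .
  next
    fix \<delta> :: real assume "0 < \<delta>"
    \<comment> \<open>The approximants are \<open>\<Phi> (?q n) = \<Lambda> (?q n)\<close>, so the
      mass of \<Lambda> is the limit of the masses of the \<open>Q n\<close>.\<close>
    then have "eventually (\<lambda>n. \<Lambda> (\<lambda>_. 1) - \<delta> < \<Phi> (\<lambda>z. ?q n z * 1)) F"
      by (intro order_tendstoD(1)[OF lim[OF bounded_meas_const]]) simp
    from eventually_happens'[OF F(1) this] show "\<exists>C. \<Lambda> (\<lambda>_. 1) - \<delta> < \<Lambda> (?q C)" using \<Lambda>_Q by auto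
  qed
  then show ?thesis by (rule exI[of _ \<Lambda>])
qed

end

section \<open>Convergence theorems for a finitely additive content\<close>

context tight_mean
begin

abbreviation S :: "('w \<times> 'x) set set" where
  "S \<equiv> sets (M \<Otimes>\<^sub>M borel)"

definition mu :: "('w \<times> 'x) set \<Rightarrow> real" where
  "mu B = \<Lambda> (indicator B)"

lemma mean_sum:
  assumes "finite I" "\<And>i. i \<in> I \<Longrightarrow> bounded_meas (f i)"
  shows "\<Lambda> (\<lambda>z. \<Sum>i\<in>I. f i z) = (\<Sum>i\<in>I. \<Lambda> (f i))"
  using assms
proof (induction I rule: finite_induct)
  case empty
  then show ?case using mean_cmult[OF bounded_meas_const, of 0 0] by simp
next
  case (insert i I)
  then show ?case by (simp add: mean_add bounded_meas_sum)
qed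

lemma mu_mono: "A \<subseteq> B \<Longrightarrow> A \<in> S \<Longrightarrow> B \<in> S \<Longrightarrow> mu A \<le> mu B"
  unfolding mu_def by (intro mean_mono bounded_meas_indicator) (auto simp: indicator_def)

lemma mu_empty: "mu {} = 0"
proof -
  have "(indicator {} :: 'w \<times> 'x \<Rightarrow> real) = (\<lambda>_. 0 * 0)" by auto
  then show ?thesis unfolding mu_def using mean_cmult[OF bounded_meas_const, of 0 0] by simp
qed

lemma mu_Un_le: "A \<in> S \<Longrightarrow> B \<in> S \<Longrightarrow> mu (A \<union> B) \<le> mu A + mu B"
proof -
  assume AB: "A \<in> S" "B \<in> S"
  have "\<Lambda> (indicator (A \<union> B)) \<le> \<Lambda> (\<lambda>z. indicator A z + indicator B z)"
    by (intro mean_mono bounded_meas_add bounded_meas_indicator sets.Un AB) (auto simp: indicator_def)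
  also have "\<dots> = mu A + mu B"
    unfolding mu_def by (intro mean_add bounded_meas_indicator AB)
  finally show ?thesis unfolding mu_def .
qed

lemma mu_UN_le:
  assumes "finite I" "\<And>i. i \<in> I \<Longrightarrow> A i \<in> S"
  shows "mu (\<Union>i\<in>I. A i) \<le> (\<Sum>i\<in>I. mu (A i))"
  using assms
proof (induction I rule: finite_induct)
  case empty
  then show ?case by (simp add: mu_empty)
next
  case (insert i I)
  have "mu (A i \<union> (\<Union>i\<in>I. A i)) \<le> mu (A i) + mu (\<Union>i\<in>I. A i)"
    using insert by (intro mu_Un_le sets.finite_UN) auto
  then show ?case using insert by simp
qed

lemma mu_Diff: "A \<in> S \<Longrightarrow> B \<in> S \<Longrightarrow> A \<subseteq> B \<Longrightarrow> mu (B - A) = mu B - mu A"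
proof -
  assume AB: "A \<in> S" "B \<in> S" "A \<subseteq> B"
  have "indicator B = (\<lambda>z. indicator (B - A) z + indicator A z :: real)"
    using AB(3) by (auto simp: indicator_def fun_eq_iff)
  then have "mu B = mu (B - A) + mu A"
    unfolding mu_def using mean_add[OF bounded_meas_indicator bounded_meas_indicator, of "B - A" A] AB by simp
  then show ?thesis by simp
qed

lemma mu_UNIV: "mu UNIV = \<Lambda> (\<lambda>_. 1)"
  unfolding mu_def by (simp add: indicator_def)

lemma UNIV_S: "UNIV \<in> S"
  using sets.top[of "M \<Otimes>\<^sub>M (borel :: 'x measure)"] by (simp add: space_pair_measure space_M)

lemma mu_le_prob:
  assumes "B \<in> S" "R \<in> sets M" "\<And>z. z \<in> B \<Longrightarrow> fst z \<in> R"
  shows "mu B \<le> prob R"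
  unfolding mu_def using assms by (intro mean_base bounded_meas_indicator) (auto simp: indicator_def)

lemma mu_UNIV_le: "mu UNIV \<le> 1"
  using mu_le_prob[OF UNIV_S sets.top] prob_space by (simp add: space_M)

lemma mu_not_sphere: "mu (- {(w, u :: 'x). norm u = 1}) \<le> 0"
proof (rule field_le_epsilon)
  fix e :: real assume "0 < e"
  then obtain C where C: "\<Lambda> (\<lambda>_. 1) - e < mu (Q C)" using mean_tight unfolding mu_def by blast
  have "mu (- {(w, u :: 'x). norm u = 1}) \<le> mu (UNIV - Q C)"
    by (intro mu_mono Compl_sets gdelta_sets gdelta_sphere sets.Diff UNIV_S gdelta_Q) (auto simp: Q_def)
  also have "\<dots> < e" using mu_Diff[OF Q_sets UNIV_S, of C] C mu_UNIV by simp
  finally show "mu (- {(w, u :: 'x). norm u = 1}) \<le> 0 + e" by simp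
qed

lemma mu_T: "B \<in> S \<Longrightarrow> \<Lambda> (\<lambda>z. indicator B (T n z)) = mu B"
proof (induction n)
  case 0
  \<comment> \<open>\<open>T 0\<close> normalizes, so the case of time 0 has content: it fixes unit
    vectors, and the other vectors carry no mass.\<close>
  have "\<Lambda> (\<lambda>z. indicator B (T 0 z)) = mu B" if "B \<in> S" for B
  proof (rule antisym)
    have sph: "{(w, u :: 'x). norm u = 1} \<in> S" by (rule gdelta_sets[OF gdelta_sphere])
    note null = mu_not_sphere
    have T0: "T 0 z = z" if "z \<in> {(w, u :: 'x). norm u = 1}" for z
      using that unfolding T_def by (cases z) (auto simp: sgn_div_norm)
    let ?N = "- {(w, u :: 'x). norm u = 1}"
    have b: "bounded_meas (\<lambda>z. indicator B (T 0 z))" "bounded_meas (indicator B)" "bounded_meas (indicator ?N)"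
      by (intro bounded_meas_T bounded_meas_indicator that Compl_sets sph)+
    have "\<Lambda> (\<lambda>z. indicator B (T 0 z)) \<le> \<Lambda> (\<lambda>z. indicator B z + indicator ?N z)"
      by (intro mean_mono bounded_meas_add b) (use T0 in \<open>auto simp: indicator_def\<close>)
    then show "\<Lambda> (\<lambda>z. indicator B (T 0 z)) \<le> mu B" using null mean_add[OF b(2,3)] unfolding mu_def by simp
    have "\<Lambda> (indicator B) \<le> \<Lambda> (\<lambda>z. indicator B (T 0 z) + indicator ?N z)"
      by (intro mean_mono bounded_meas_add b) (use T0 in \<open>auto simp: indicator_def\<close>)
    then show "mu B \<le> \<Lambda> (\<lambda>z. indicator B (T 0 z))" using null mean_add[OF b(1,3)] unfolding mu_def by simp
  qed
  then show ?case using 0 by simp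
next
  case (Suc n)
  have "bounded_meas (\<lambda>z. indicator B (T n z))" by (intro bounded_meas_T bounded_meas_indicator Suc)
  from mean_invariant[OF this] have "\<Lambda> (\<lambda>z. indicator B (T n (T 1 z))) = \<Lambda> (\<lambda>z. indicator B (T n z))"
    by (simp add: indicator_def)
  then show ?case using Suc T_add[of n 1] by simp
qed

text \<open>The fibres of \<open>Q C\<close> are compact, so over almost every base point some
  \<open>B k\<close> no longer meets \<open>Q C\<close>. Hence the projections of
  \<open>B k \<inter> Q C\<close> decrease to a null set, and \<open>mean_base\<close> turns their
  probabilities into bounds for \<open>mu\<close>. Tightness handles the complement of
  \<open>Q C\<close>.\<close>

lemma dini:
  assumes B: "\<And>k::nat. random_gdelta M (B k)" and dec: "decseq B" and cl: "\<And>k w. closed {u. (w, u) \<in> B k}"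
    and empty: "AE w in M. \<forall>C u. (w, u) \<in> Q C \<longrightarrow> (\<exists>k. (w, u) \<notin> B k)" and "0 < \<delta>"
  shows "\<exists>k. mu (B k) < \<delta>"
proof -
  obtain C where C: "\<Lambda> (\<lambda>_. 1) - \<delta> / 2 < mu (Q C)" using mean_tight[of "\<delta> / 2"] \<open>0 < \<delta>\<close> unfolding mu_def by auto
  define P where "P k = fst ` (B k \<inter> Q C)" for k
  have g: "random_gdelta M (B k \<inter> Q C)" for k by (intro random_gdelta_Int B gdelta_Q)
  have P: "P k \<in> sets (completion M)" for k unfolding P_def by (rule projection_completion[OF g space_M])
  have decP: "decseq P" using dec unfolding P_def decseq_def by blast
  have null: "AE w in M. w \<notin> (\<Inter>k. P k)"
    using empty
  proof eventually_elim
    case (elim w)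
    show ?case
    proof
      assume w: "w \<in> (\<Inter>k. P k)"
      have "{u. (w, u) \<in> Q C} \<inter> (\<Inter>k. {u. (w, u) \<in> B k}) \<noteq> {}"
      proof (rule compact_imp_fip_image[OF compact_Q cl])
        fix I :: "nat set" assume "finite I"
        then obtain b where b: "\<And>k. k \<in> I \<Longrightarrow> k \<le> b" by (meson finite_nat_set_iff_bounded_le)
        have "w \<in> P b" using w by blast
        then obtain u where "(w, u) \<in> B b" "(w, u) \<in> Q C" unfolding P_def by auto
        then have "u \<in> {u. (w, u) \<in> Q C} \<inter> (\<Inter>k\<in>I. {u. (w, u) \<in> B k})"
          using decseqD[OF dec b] by blast
        then show "{u. (w, u) \<in> Q C} \<inter> (\<Inter>k\<in>I. {u. (w, u) \<in> B k}) \<noteq> {}" by blast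
      qed
      then show False using elim by blast
    qed
  qed
  obtain H where H: "\<And>k. H k \<in> sets M" "\<And>k. P k \<subseteq> H k" "(\<lambda>k. prob (H k)) \<longlonglongrightarrow> 0"
    by (rule measurable_covers_tendsto_0[OF P decP null]) blast
  have "eventually (\<lambda>k. prob (H k) < \<delta> / 2) sequentially"
    using \<open>0 < \<delta>\<close> by (intro order_tendstoD(2)[OF H(3)]) auto
  from eventually_happens'[OF sequentially_bot this] obtain k where k: "prob (H k) < \<delta> / 2" by blast
  have "mu (B k \<inter> Q C) \<le> prob (H k)"
    using H(2)[of k] by (intro mu_le_prob[OF gdelta_sets[OF g] H(1)]) (auto simp: P_def)
  also note k
  finally have 1: "mu (B k \<inter> Q C) < \<delta> / 2" .
  have "mu (B k) \<le> mu ((B k \<inter> Q C) \<union> (UNIV - Q C))"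
    using gdelta_sets[OF B] gdelta_sets[OF g] UNIV_S by (intro mu_mono sets.Un sets.Diff) auto
  also have "\<dots> \<le> mu (B k \<inter> Q C) + mu (UNIV - Q C)"
    using gdelta_sets[OF g] UNIV_S by (intro mu_Un_le sets.Diff) auto
  also have "mu (UNIV - Q C) < \<delta> / 2" using mu_Diff[OF Q_sets UNIV_S, of C] C mu_UNIV by simp
  finally show ?thesis using 1 by (intro exI[of _ k]) simp
qed

text \<open>Arzela's argument: replacing the sets by finite unions and then intersecting costs little,
  so bounded convergence follows from the monotone case, although \<open>mu\<close> is only finitely additive.\<close>

lemma bounded_convergence:
  assumes B: "\<And>k::nat. random_gdelta M (B k)" and cl: "\<And>k w. closed {u. (w, u) \<in> B k}"
    and fin: "AE w in M. \<forall>C u. (w, u) \<in> Q C \<longrightarrow> finite {k. (w, u) \<in> B k}" and "0 < \<delta>"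
  shows "\<exists>k. mu (B k) < \<delta>"
proof (rule ccontr)
  assume "\<not> ?thesis"
  then have large: "\<delta> \<le> mu (B k)" for k by (auto simp: not_less)
  define U where "U j m = (\<Union>n\<in>{j..m}. B n)" for j m
  have gU: "random_gdelta M (U j m)" for j m unfolding U_def by (intro random_gdelta_UN_finite B) auto
  note US = gdelta_sets[OF gU]
  have U_mono: "U j m \<subseteq> U j m'" if "m \<le> m'" for j m m' unfolding U_def using that by fastforce
  \<comment> \<open>A supremum over finite unions: finite additivity does not determine
    \<open>mu\<close> of a countable union from them.\<close>
  define s where "s j = (SUP m. mu (U j m))" for j
  have bdd: "bdd_above (range (\<lambda>m. mu (U j m)))" for j
    by (intro bdd_aboveI2[of _ _ "mu UNIV"] mu_mono US UNIV_S) auto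
  have "\<exists>m. s j - \<delta> * (1/2) ^ (j + 2) < mu (U j m)" for j
  proof -
    have "s j - \<delta> * (1/2) ^ (j + 2) < s j" using \<open>0 < \<delta>\<close> by simp
    then show ?thesis unfolding s_def using less_cSUP_iff[OF _ bdd] by auto
  qed
  then obtain m where m: "\<And>j. s j - \<delta> * (1/2) ^ (j + 2) < mu (U j (m j))" by metis
  \<comment> \<open>\<open>W\<close> decreases and has closed fibres. A point in only finitely many
    \<open>B k\<close> is outside \<open>U b (m b)\<close> for large \<open>b\<close>, so
    \<open>dini\<close> applies to \<open>W\<close>.\<close>
  define W where "W n = (\<Inter>j\<in>{..n}. U j (m j))" for n
  have gW: "random_gdelta M (W n)" for n unfolding W_def by (intro random_gdelta_INT gU) auto
  have decW: "decseq W" unfolding W_def decseq_def by fastforce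
  have clW: "closed {u. (w, u) \<in> W n}" for n w
  proof -
    have "{u. (w, u) \<in> W n} = (\<Inter>j\<in>{..n}. \<Union>k\<in>{j..m j}. {u. (w, u) \<in> B k})" unfolding W_def U_def by auto
    also have "closed \<dots>" by (intro closed_INT ballI closed_UN finite_atLeastAtMost cl)
    finally show ?thesis .
  qed
  have emptyW: "AE w in M. \<forall>C u. (w, u) \<in> Q C \<longrightarrow> (\<exists>k. (w, u) \<notin> W k)"
    using fin
  proof eventually_elim
    case (elim w)
    show ?case
    proof (intro allI impI)
      fix C u assume "(w, u) \<in> Q C"
      then have "finite {k. (w, u) \<in> B k}" using elim by blast
      then obtain b where b: "\<And>k. (w, u) \<in> B k \<Longrightarrow> k < b" by (metis finite_nat_set_iff_bounded mem_Collect_eq)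
      have "(w, u) \<notin> U b (m b)" unfolding U_def using b by force
      then show "\<exists>k. (w, u) \<notin> W k" unfolding W_def by (intro exI[of _ b]) auto
    qed
  qed
  obtain n where n: "mu (W n) < \<delta> / 2"
    using dini[OF gW decW clW emptyW, of "\<delta> / 2"] \<open>0 < \<delta>\<close> by auto
  have step: "mu (B n - U j (m j)) \<le> \<delta> * (1/2) ^ (j + 2)" if "j \<le> n" for j
  proof -
    let ?M = "max n (m j)"
    have "mu (B n - U j (m j)) \<le> mu (U j ?M - U j (m j))"
      using that US gdelta_sets[OF B] by (intro mu_mono sets.Diff) (auto simp: U_def)
    also have "\<dots> = mu (U j ?M) - mu (U j (m j))" by (intro mu_Diff US U_mono) simp
    also have "mu (U j ?M) \<le> s j" unfolding s_def by (rule cSUP_upper[OF _ bdd]) simp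
    finally show ?thesis using m[of j] by simp
  qed
  \<comment> \<open>A point of \<open>B n\<close> can miss \<open>W n\<close> only through the
    errors in \<open>step\<close>, whose sum is at most \<delta> / 2.\<close>
  have "B n \<subseteq> W n \<union> (\<Union>j\<in>{..n}. B n - U j (m j))" unfolding W_def by auto
  then have "mu (B n) \<le> mu (W n \<union> (\<Union>j\<in>{..n}. B n - U j (m j)))"
    using gdelta_sets[OF B] gdelta_sets[OF gW] US by (intro mu_mono sets.Un sets.finite_UN sets.Diff) auto
  also have "\<dots> \<le> mu (W n) + mu (\<Union>j\<in>{..n}. B n - U j (m j))"
    using gdelta_sets[OF B] gdelta_sets[OF gW] US by (intro mu_Un_le sets.finite_UN sets.Diff) auto
  also have "mu (\<Union>j\<in>{..n}. B n - U j (m j)) \<le> (\<Sum>j\<in>{..n}. mu (B n - U j (m j)))"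
    using gdelta_sets[OF B] US by (intro mu_UN_le sets.Diff) auto
  also have "\<dots> \<le> (\<Sum>j\<in>{..n}. \<delta> * (1/2) ^ (j + 2))" by (intro sum_mono step) auto
  also have "\<dots> = \<delta> / 2 * (1 - (1/2) ^ Suc n)"
    by (induction n) (auto simp: algebra_simps)
  also have "\<dots> \<le> \<delta> / 2" using \<open>0 < \<delta>\<close> by (simp add: algebra_simps)
  finally show False using n large[of n] by simp
qed

text \<open>By invariance all \<open>A k \<times> UNIV\<close> have the mass of
  \<open>Y \<times> UNIV\<close>. By ergodicity finitely many \<open>A k\<close> cover the base up
  to probability below \<open>mu UNIV\<close>; if their masses were 0, the rest could not account
  for the total mass.\<close>

lemma mu_base_pos:
  assumes Y: "Y \<in> sets M" "0 < prob Y"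
  shows "0 < mu (Y \<times> UNIV)"
proof (rule ccontr)
  assume neg: "\<not> ?thesis"
  define A where "A k = {w. (\<sigma> ^^ k) w \<in> Y}" for k
  have A: "A k \<in> sets M" "prob (A k) = prob Y" for k
    unfolding A_def using vimage_iterate_sets[OF Y(1)] prob_iterate[OF Y(1)] by auto
  have AS: "A k \<times> UNIV \<in> S" for k using A by auto
  have muA: "mu (A k \<times> UNIV) \<le> 0" for k
  proof -
    have "mu (A k \<times> UNIV) = \<Lambda> (\<lambda>z. indicator (Y \<times> UNIV) (T k z))"
      unfolding mu_def A_def T_def by (rule arg_cong[of _ _ \<Lambda>]) (auto simp: indicator_def fun_eq_iff)
    also have "\<dots> = mu (Y \<times> UNIV)" using Y by (intro mu_T) auto
    finally show ?thesis using neg by simp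
  qed
  \<comment> \<open>The intersection of the \<open>Z n\<close> is strictly invariant, as
    \<open>ergodic\<close> requires, whereas for the union \<open>Z 0\<close> only the inclusion of
    the preimage is clear.\<close>
  define Z where "Z n = (\<Union>k\<in>{n..}. A k)" for n
  have Z: "Z n \<in> sets M" for n unfolding Z_def using A(1) by (intro sets.countable_UN') auto
  have decZ: "decseq Z" unfolding Z_def decseq_def by fastforce
  have inv: "\<sigma> -` (\<Inter>n. Z n) = (\<Inter>n. Z n)"
  proof (rule set_eqI)
    fix w
    have A_shift: "\<sigma> w \<in> A k \<longleftrightarrow> w \<in> A (Suc k)" for k unfolding A_def by (simp add: funpow_swap1)
    have shift: "\<sigma> w \<in> Z n \<longleftrightarrow> w \<in> Z (Suc n)" for n
    proof -
      have "{Suc n..} = Suc ` {n..}"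
      proof (rule set_eqI)
        show "x \<in> {Suc n..} \<longleftrightarrow> x \<in> Suc ` {n..}" for x by (cases x) auto
      qed
      then show ?thesis unfolding Z_def by (simp add: A_shift)
    qed
    then show "w \<in> \<sigma> -` (\<Inter>n. Z n) \<longleftrightarrow> w \<in> (\<Inter>n. Z n)"
      using decseqD[OF decZ, of n "Suc n" for n] by auto
  qed
  have "prob Y \<le> prob (\<Inter>n. Z n)"
  proof (rule LIMSEQ_le_const)
    show "(\<lambda>n. prob (Z n)) \<longlonglongrightarrow> prob (\<Inter>n. Z n)" using Z by (intro finite_Lim_measure_decseq decZ) auto
    have "prob Y \<le> prob (Z n)" for n
      using finite_measure_mono[OF _ Z[of n], of "A n"] A(2)[of n] unfolding Z_def by auto
    then show "\<exists>N. \<forall>n\<ge>N. prob Y \<le> prob (Z n)" by auto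
  qed
  then have "prob (\<Inter>n. Z n) = 1" using ergodic[OF _ inv] Z Y(2) by fastforce
  then have Z0: "prob (Z 0) = 1"
    using finite_measure_mono[of "\<Inter>n. Z n" "Z 0"] Z prob_le_1[of "Z 0"] by auto
  define V where "V K = (\<Union>k\<in>{..K}. A k)" for K
  have V: "V K \<in> sets M" for K unfolding V_def using A(1) by auto
  have "incseq V" unfolding V_def incseq_def by fastforce
  then have "(\<lambda>K. prob (V K)) \<longlonglongrightarrow> prob (\<Union>K. V K)" using V by (intro finite_Lim_measure_incseq) auto
  moreover have "(\<Union>K. V K) = Z 0" unfolding V_def Z_def by auto
  ultimately have "eventually (\<lambda>K. 1 - mu UNIV < prob (V K)) sequentially"
    using Z0 mean_pos mu_UNIV by (intro order_tendstoD(1)) auto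
  from eventually_happens'[OF sequentially_bot this] obtain K where K: "1 - mu UNIV < prob (V K)" by blast
  have VS: "V K \<times> UNIV \<in> S" "(UNIV - V K) \<times> UNIV \<in> S"
    using V[of K] sets.Diff[OF sets.top V[of K]] by (auto simp: space_M)
  have "mu UNIV \<le> mu (V K \<times> UNIV \<union> (UNIV - V K) \<times> UNIV)" using VS UNIV_S by (intro mu_mono) auto
  also have "\<dots> \<le> mu (V K \<times> UNIV) + mu ((UNIV - V K) \<times> UNIV)" by (rule mu_Un_le[OF VS])
  also have "mu ((UNIV - V K) \<times> UNIV) \<le> prob (UNIV - V K)"
    using VS(2) sets.Diff[OF sets.top V[of K]] by (intro mu_le_prob) (auto simp: space_M)
  also have "prob (UNIV - V K) = 1 - prob (V K)" using prob_compl[OF V] by (simp add: space_M)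
  also have "mu (V K \<times> UNIV) = mu (\<Union>k\<in>{..K}. A k \<times> UNIV)" unfolding V_def by (rule arg_cong[of _ _ mu]) auto
  also have "\<dots> \<le> (\<Sum>k\<in>{..K}. mu (A k \<times> UNIV))" by (intro mu_UN_le AS) auto
  also have "\<dots> \<le> 0" by (intro sum_nonpos muA)
  finally show False using K by simp
qed


subsection \<open>Balanced vectors\<close>

text \<open>The parameter \<open>m\<close> is both starting time and tolerance, which expresses the
  conditions on liminf and limsup by countably many random open sets.\<close>

definition balanced :: "('w \<times> 'x) set" where
  "balanced = {(w, u). norm u = 1} \<inter>
     (\<Inter>m. (\<Union>k\<in>{m..}. {(w, u). norm (\<A> w k u) < 1 + inverse (real (Suc m))}) \<inter>
          (\<Union>k\<in>{m..}. {(w, u). 1 - inverse (real (Suc m)) < norm (\<A> w k u)}))"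

lemma gdelta_balanced: "random_gdelta M balanced"
  unfolding balanced_def
  by (intro random_gdelta_Int random_gdelta_INT gdelta_sphere random_open_gdelta random_open_UN
      open_norm_less open_norm_gt) auto

text \<open>Suppose no vector over \<open>Y\<close> is balanced. By bounded convergence the orbits of a set of
  positive mean stay, from a fixed time \<open>N\<close> on, either above \<open>1 + \<epsilon>\<close> or below \<open>1 - \<epsilon>\<close>. Since
  such orbits return with positive frequency, their norms change exponentially in time.\<close>

lemma balanced_meets:
  assumes Y: "Y \<in> sets M" "0 < prob Y"
  shows "\<exists>w\<in>Y. \<exists>u. (w, u) \<in> balanced"
proof (rule ccontr)
  assume neg: "\<not> ?thesis"
  \<comment> \<open>\<open>N + 2\<close> makes \<open>eps N\<close> less than 1, and strictly less
    than \<open>1 / (l + 1)\<close> for all \<open>N\<close> \<ge> \<open>l\<close>.\<close>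
  define eps where "eps N = inverse (real (N + 2))" for N :: nat
  have eps: "0 < eps N" "eps N < 1" for N unfolding eps_def by (auto simp: inverse_less_1_iff)
  define YS where "YS = {(w, u :: 'x). w \<in> Y} \<inter> {(w, u). norm u = 1}"
  have gYS: "random_gdelta M YS" unfolding YS_def by (intro random_gdelta_Int gdelta_base Y gdelta_sphere)
  \<comment> \<open>Finite windows keep the fibres closed. Off this set, a vector of
    \<open>YS\<close> has norms above \<open>1 + eps N\<close> throughout the window or below
    \<open>1 - eps N\<close> throughout.\<close>
  define O' where "O' N m = YS \<inter> (\<Union>n\<in>{N..m}. {(w, u). norm (\<A> w n u) \<le> 1 + eps N}) \<inter>
      (\<Union>n\<in>{N..m}. {(w, u). 1 - eps N \<le> norm (\<A> w n u)})" for N m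
  have gO: "random_gdelta M (O' N m)" for N m
    unfolding O'_def by (intro random_gdelta_Int random_gdelta_UN_finite gYS gdelta_norm_le gdelta_norm_ge) auto
  have clO: "closed {u. (w, u) \<in> O' N m}" for N m w
  proof -
    have "{u. (w, u) \<in> O' N m} = {u. w \<in> Y} \<inter> {u. norm u = 1} \<inter> (\<Union>n\<in>{N..m}. {u. norm (\<A> w n u) \<le> 1 + eps N}) \<inter>
      (\<Union>n\<in>{N..m}. {u. 1 - eps N \<le> norm (\<A> w n u)})"
      unfolding O'_def YS_def by auto
    also have "closed \<dots>"
      by (intro closed_Int closed_UN finite_atLeastAtMost closed_Collect_le closed_Collect_eq closed_Collect_const ballI continuous_intros)
    finally show ?thesis .
  qed
  have finO: "finite {N. (w, u) \<in> O' N (m N)}" for w u m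
  proof (cases "(w, u) \<in> YS")
    case True
    then have "norm u = 1" "(w, u) \<notin> balanced" using neg unfolding YS_def by auto
    then obtain l where l: "(\<forall>k\<ge>l. 1 + inverse (real (Suc l)) \<le> norm (\<A> w k u)) \<or>
        (\<forall>k\<ge>l. norm (\<A> w k u) \<le> 1 - inverse (real (Suc l)))"
      unfolding balanced_def by (auto simp: not_less)
    have "(w, u) \<notin> O' N (m N)" if "l \<le> N" for N
    proof
      assume "(w, u) \<in> O' N (m N)"
      then obtain n n' where n: "N \<le> n" "norm (\<A> w n u) \<le> 1 + eps N" "N \<le> n'" "1 - eps N \<le> norm (\<A> w n' u)"
        unfolding O'_def by auto
      have "eps N < inverse (real (Suc l))" unfolding eps_def using that by (intro less_imp_inverse_less) auto
      then show False using l n that by (meson add_less_cancel_left diff_strict_left_mono leD le_trans order_less_le_trans order_le_less_trans)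
    qed
    then have "{N. (w, u) \<in> O' N (m N)} \<subseteq> {..<l}" by (auto simp: not_le[symmetric])
    then show ?thesis by (rule finite_subset) simp
  qed (simp add: O'_def)
  define \<beta> where "\<beta> = mu YS"
  have \<beta>: "0 < \<beta>"
  proof -
    have YU: "Y \<times> UNIV \<in> S" using Y by auto
    have "mu (Y \<times> UNIV) \<le> mu (YS \<union> - {(w, u). norm u = 1})"
      by (intro mu_mono[OF _ YU] sets.Un Compl_sets gdelta_sets gYS gdelta_sphere) (auto simp: YS_def)
    also have "\<dots> \<le> mu YS + mu (- {(w, u). norm u = 1})"
      by (intro mu_Un_le Compl_sets gdelta_sets gYS gdelta_sphere)
    finally show ?thesis using mu_base_pos[OF Y] mu_not_sphere unfolding \<beta>_def by simp
  qed
  \<comment> \<open>One \<open>N\<close> serves all windows: if every \<open>N\<close> had a bad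
    window, the sets \<open>O' N (m N)\<close> would contradict
    \<open>bounded_convergence\<close>.\<close>
  have "\<exists>N. \<forall>m. mu (O' N m) < \<beta> / 2"
  proof (rule ccontr)
    assume "\<not> ?thesis"
    then have "\<forall>N. \<exists>m. \<beta> / 2 \<le> mu (O' N m)" by (auto simp: not_less)
    from choice[OF this] obtain m where m: "\<And>N. \<beta> / 2 \<le> mu (O' N (m N))" by blast
    have "\<exists>N. mu (O' N (m N)) < \<beta> / 2"
      by (rule bounded_convergence[OF gO clO]) (use finO \<beta> in auto)
    then show False using m by (auto simp: not_less[symmetric])
  qed
  then obtain N where N: "\<And>m. mu (O' N m) < \<beta> / 2" by blast
  define D where "D m = YS - O' N m" for m
  have DS: "D m \<in> S" for m unfolding D_def by (intro sets.Diff gdelta_sets gYS gO)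
  have D_large: "\<beta> / 2 \<le> mu (D m)" for m
  proof -
    have "O' N m \<subseteq> YS" unfolding O'_def by blast
    from mu_Diff[OF gdelta_sets[OF gO] gdelta_sets[OF gYS] this] show ?thesis
      using N[of m] unfolding D_def \<beta>_def by linarith
  qed
  define e where "e = ln (1 + eps N)"
  have e: "0 < e" unfolding e_def using eps[of N] by simp
  have e': "ln (1 - eps N) \<le> - e"
  proof -
    have "(1 - eps N) * (1 + eps N) \<le> 1" using eps[of N] by (simp add: algebra_simps)
    then have "ln ((1 - eps N) * (1 + eps N)) \<le> 0" using eps[of N] by (subst ln_le_zero_iff) (auto intro: mult_pos_pos)
    then show ?thesis unfolding e_def using eps[of N] by (simp add: ln_mult)
  qed
  \<comment> \<open>With logarithmic norms bounded by \<open>\<kappa> * m\<close>, the counting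
    bound below allows at most \<open>\<beta> * m / 16 + 4 * (N + 1)\<close> visits.\<close>
  define \<kappa> where "\<kappa> = \<beta> * e / (64 * (real N + 1))"
  have \<kappa>: "0 < \<kappa>" unfolding \<kappa>_def using \<beta> e by simp
  \<comment> \<open>All times up to \<open>m\<close> are tested, because the counting bound needs
    the logarithmic norm at every visit. By zero growth a vector of \<open>Q C\<close> still lies in
    only finitely many \<open>R m\<close>.\<close>
  define R where "R m = (\<Union>j\<in>{..m}. {(w, u). exp (\<kappa> * real m) \<le> norm (\<A> w j u)} \<union> {(w, u). norm (\<A> w j u) \<le> exp (- \<kappa> * real m)})" for m
  have gR: "random_gdelta M (R m)" for m
    unfolding R_def by (intro random_gdelta_UN_finite random_gdelta_Un gdelta_norm_ge gdelta_norm_le) auto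
  have clR: "closed {u. (w, u) \<in> R m}" for m w
  proof -
    have "{u. (w, u) \<in> R m} = (\<Union>j\<in>{..m}. {u. exp (\<kappa> * real m) \<le> norm (\<A> w j u)} \<union> {u. norm (\<A> w j u) \<le> exp (- \<kappa> * real m)})"
      unfolding R_def by auto
    also have "closed \<dots>" by (intro closed_UN finite_atMost ballI closed_Un closed_Collect_le continuous_intros)
    finally show ?thesis .
  qed
  have finR: "AE w in M. \<forall>C u. (w, u) \<in> Q C \<longrightarrow> finite {m. (w, u) \<in> R (m + m0)}" for m0
    using zero_growth
  proof eventually_elim
    case (elim w)
    show ?case
    proof (intro allI impI)
      fix C u assume Q: "(w, u) \<in> Q C"
      then have lim: "(\<lambda>n. ln (norm (\<A> w n u)) / real n) \<longlonglongrightarrow> 0"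
        using elim unfolding Q_def Low_def Up_def by auto
      have pos: "0 < norm (\<A> w n u)" for n
      proof -
        have "exp (- \<eta> * real n) \<le> real (Suc C) * norm (\<A> w n u)" using Q unfolding Q_def Low_def by auto
        then have "\<A> w n u \<noteq> 0" by (auto simp: not_le[symmetric])
        then show ?thesis by simp
      qed
      define a where "a n = ln (norm (\<A> w n u))" for n
      have "eventually (\<lambda>n. \<bar>a n / real n\<bar> < \<kappa> / 2) sequentially"
        using tendsto_rabs[OF lim] \<kappa> unfolding a_def by (intro order_tendstoD(2)[of _ 0]) auto
      then obtain K where K: "\<And>n. K \<le> n \<Longrightarrow> \<bar>a n / real n\<bar> < \<kappa> / 2" unfolding eventually_sequentially by blast
      define A where "A = (\<Sum>j\<le>K. \<bar>a j\<bar>)"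
      have a_bd: "\<bar>a n\<bar> \<le> A + \<kappa> / 2 * real n" for n
      proof (cases "n \<le> K")
        case True
        then have "\<bar>a n\<bar> \<le> A" unfolding A_def by (intro member_le_sum) auto
        then show ?thesis using \<kappa> by (simp add: add_increasing2)
      next
        case False
        then have "\<bar>a n\<bar> \<le> \<kappa> / 2 * real n" using K[of n] by (auto simp: abs_divide field_simps)
        moreover have "0 \<le> A" unfolding A_def by (intro sum_nonneg) auto
        ultimately show ?thesis by simp
      qed
      obtain m1 :: nat where m1: "2 * A / \<kappa> < real m1" using reals_Archimedean2 by blast
      have "(w, u) \<notin> R m" if "m1 \<le> m" for m
      proof
        assume "(w, u) \<in> R m"
        then obtain j where j: "j \<le> m" "exp (\<kappa> * real m) \<le> norm (\<A> w j u) \<or> norm (\<A> w j u) \<le> exp (- \<kappa> * real m)"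
          unfolding R_def by auto
        then have "\<kappa> * real m \<le> \<bar>a j\<bar>"
        proof (elim disjE)
          assume "exp (\<kappa> * real m) \<le> norm (\<A> w j u)"
          then have "\<kappa> * real m \<le> a j" unfolding a_def using pos[of j] by (simp add: ln_ge_iff)
          then show ?thesis by simp
        next
          assume "norm (\<A> w j u) \<le> exp (- \<kappa> * real m)"
          then have "ln (norm (\<A> w j u)) \<le> ln (exp (- \<kappa> * real m))" using pos[of j] by (subst ln_le_cancel_iff) auto
          then show ?thesis unfolding a_def by simp
        qed
        also have "\<bar>a j\<bar> \<le> A + \<kappa> / 2 * real m"
        proof -
          have "\<kappa> / 2 * real j \<le> \<kappa> / 2 * real m" using j(1) \<kappa> by (intro mult_left_mono) auto
          then show ?thesis using a_bd[of j] by linarith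
        qed
        finally have "\<kappa> * real m \<le> 2 * A" by simp
        moreover have "2 * A < \<kappa> * real m1" using m1 \<kappa> by (simp add: field_simps)
        moreover have "\<kappa> * real m1 \<le> \<kappa> * real m" using that \<kappa> by simp
        ultimately show False by linarith
      qed
      then have "{m. (w, u) \<in> R (m + m0)} \<subseteq> {..<m1}" by (force simp: not_le[symmetric])
      then show "finite {m. (w, u) \<in> R (m + m0)}" by (rule finite_subset) simp
    qed
  qed
  \<comment> \<open>From \<open>m0\<close> on, \<open>4 * (N + 1)\<close> is at most
    \<open>\<beta> * m / 16\<close>, so the count is at most \<open>\<beta> * m / 8\<close>, half of
    what \<open>H\<close> demands.\<close>
  obtain m0 :: nat where m0: "64 * (real N + 1) / \<beta> \<le> real m0" using real_arch_simple by blast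
  have R_large: "\<beta> / 4 \<le> mu (R m)" if m: "Suc m0 \<le> m" for m
  proof -
    \<comment> \<open>Counts the visits to \<open>D m\<close> before time \<open>m\<close>. By
      invariance its mean is \<open>m * mu (D m)\<close>, at least \<open>m * \<beta> / 2\<close>,
      and Markov's argument leaves mass at least \<open>\<beta> / 4\<close> where the count is at
      least \<open>m * \<beta> / 4\<close>.\<close>
    define c where "c z = (\<Sum>j<m. indicator (D m) (T j z) :: real)" for z
    have bmT: "bounded_meas (\<lambda>z. indicator (D m) (T j z))" for j
      by (intro bounded_meas_T bounded_meas_indicator DS)
    have bmc: "bounded_meas c" unfolding c_def by (intro bounded_meas_sum bmT) auto
    have mean_c: "\<Lambda> c = real m * mu (D m)"
      unfolding c_def by (subst mean_sum) (auto simp: bmT mu_T DS)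
    define H where "H = {z \<in> space (M \<Otimes>\<^sub>M borel). real m * \<beta> / 4 \<le> c z}"
    have HS: "H \<in> S"
    proof -
      have "c \<in> borel_measurable (M \<Otimes>\<^sub>M borel)" using bmc unfolding bounded_meas_def by simp
      then show ?thesis unfolding H_def by measurable
    qed
    have c_le: "c z \<le> real m" for z
      using sum_bounded_above[of "{..<m}" "\<lambda>j. indicator (D m) (T j z) :: real" 1] unfolding c_def by (simp add: indicator_def)
    have "\<Lambda> c \<le> \<Lambda> (\<lambda>z. real m * indicator H z + (real m * \<beta> / 4) * 1)"
      by (intro mean_mono bmc bounded_meas_add bounded_meas_mult bounded_meas_const bounded_meas_indicator HS)
         (use c_le \<beta> in \<open>auto simp: H_def indicator_def space_pair_measure space_M add_increasing2\<close>)
    also have "\<dots> = real m * mu H + (real m * \<beta> / 4) * mu UNIV"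
      unfolding mu_def using mean_add[OF bounded_meas_mult[OF bounded_meas_const bounded_meas_indicator[OF HS]] bounded_meas_mult[OF bounded_meas_const bounded_meas_const], of "real m" "real m * \<beta> / 4" 1]
        mean_cmult[OF bounded_meas_indicator[OF HS], of "real m"] mean_cmult[OF bounded_meas_const, of "real m * \<beta> / 4" 1] mu_UNIV
      by (simp add: mu_def)
    also have "\<dots> \<le> real m * mu H + (real m * \<beta> / 4)"
      using mu_UNIV_le \<beta> by (simp add: mult_left_le)
    finally have "real m * mu (D m) \<le> real m * mu H + real m * \<beta> / 4" using mean_c by simp
    moreover have "real m * (\<beta> / 2) \<le> real m * mu (D m)" by (intro mult_left_mono D_large) simp
    ultimately have "real m * (\<beta> / 4) \<le> real m * mu H" by simp
    then have H_large: "\<beta> / 4 \<le> mu H" using m by simp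
    have "H \<subseteq> R m"
    proof (rule subsetI, rule ccontr)
      fix z assume z: "z \<in> H" "z \<notin> R m"
      obtain w u where wu: "z = (w, u)" by (cases z)
      define a where "a j = ln (norm (\<A> w j u))" for j
      define J where "J = {j. j < m \<and> T j z \<in> D m}"
      have finJ: "finite J" unfolding J_def by simp
      have cJ: "c z = real (card J)"
      proof -
        have "J = {..<m} \<inter> {j. T j z \<in> D m}" unfolding J_def by auto
        then show ?thesis unfolding c_def by (simp add: indicator_def of_bool_def sum.If_cases)
      qed
      have bounds: "exp (- \<kappa> * real m) < norm (\<A> w j u)" "norm (\<A> w j u) < exp (\<kappa> * real m)" if "j \<le> m" for j
        using z(2) that unfolding R_def wu by (auto simp: not_le)
      have pos: "0 < norm (\<A> w j u)" if "j \<le> m" for j using bounds(1)[OF that] by (meson exp_gt_zero order_less_trans)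
      have a_bd: "\<bar>a j\<bar> \<le> \<kappa> * real m" if "j \<le> m" for j
      proof -
        have "ln (exp (- \<kappa> * real m)) < a j" "a j < ln (exp (\<kappa> * real m))"
          unfolding a_def using bounds[OF that] pos[OF that] by (subst ln_less_cancel_iff; simp)+
        then show ?thesis by simp
      qed
      have ratio: "norm (\<A> (fst (T i z)) (j - i) (snd (T i z))) = exp (a j - a i)" if "i \<le> j" "j \<le> m" for i j
      proof -
        have "norm (\<A> (fst (T i z)) (j - i) (snd (T i z))) = norm (\<A> w j u) / norm (\<A> w i u)"
          unfolding norm_T wu using that by simp
        also have "\<dots> = exp (a j - a i)" unfolding a_def exp_diff using pos that by simp
        finally show ?thesis .
      qed
      \<comment> \<open>After a visit in \<open>Jp\<close> the norm ratio exceeds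
        \<open>1 + eps N\<close> at all lags from \<open>N\<close> to \<open>m\<close>, so the
        logarithm has risen by \<open>e\<close> at every later visit at least \<open>N\<close> steps
        away; after a visit in \<open>Jm\<close> it has fallen by \<open>e\<close>. The counting
        bound applies to each kind separately.\<close>
      define Jp where "Jp = {j \<in> J. \<forall>n\<in>{N..m}. 1 + eps N < norm (\<A> (fst (T j z)) n (snd (T j z)))}"
      define Jm where "Jm = {j \<in> J. \<forall>n\<in>{N..m}. norm (\<A> (fst (T j z)) n (snd (T j z))) < 1 - eps N}"
      have "J \<subseteq> Jp \<union> Jm"
      proof
        fix j assume j: "j \<in> J"
        obtain p x where px: "T j z = (p, x)" by (cases "T j z")
        have "(p, x) \<in> YS" "(p, x) \<notin> O' N m" using j px unfolding J_def D_def by auto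
        then have "(\<forall>n\<in>{N..m}. 1 + eps N < norm (\<A> p n x)) \<or> (\<forall>n\<in>{N..m}. norm (\<A> p n x) < 1 - eps N)"
          unfolding O'_def by (auto simp: not_le)
        then show "j \<in> Jp \<union> Jm" using j px unfolding Jp_def Jm_def by auto
      qed
      then have "card J \<le> card Jp + card Jm"
        using card_mono[of "Jp \<union> Jm" J] card_Un_le[of Jp Jm] finJ unfolding Jp_def Jm_def by auto
      moreover have "real (card Jp) \<le> real N * (2 * (\<kappa> * real m) / e + 2)"
      proof (rule card_le_of_increments[where a = a])
        show "0 \<le> \<kappa> * real m" using \<kappa> by simp
        fix i j assume ij: "i \<in> Jp" "j \<in> Jp" "i + N \<le> j"
        then have "j < m" "i \<le> j" "j - i \<in> {N..m}" unfolding Jp_def J_def by auto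
        moreover have "1 + eps N < norm (\<A> (fst (T i z)) (j - i) (snd (T i z)))"
          using ij(1) \<open>j - i \<in> {N..m}\<close> unfolding Jp_def by blast
        ultimately have "1 + eps N < exp (a j - a i)" using ratio[of i j] by simp
        then have "ln (1 + eps N) < ln (exp (a j - a i))" using eps[of N] by (subst ln_less_cancel_iff) auto
        then show "a i + e \<le> a j" unfolding e_def by simp
      qed (use finJ e a_bd in \<open>auto simp: Jp_def J_def\<close>)
      moreover have "real (card Jm) \<le> real N * (2 * (\<kappa> * real m) / e + 2)"
      proof (rule card_le_of_increments[where a = "\<lambda>j. - a j"])
        show "0 \<le> \<kappa> * real m" using \<kappa> by simp
        fix i j assume ij: "i \<in> Jm" "j \<in> Jm" "i + N \<le> j"
        then have "j < m" "i \<le> j" "j - i \<in> {N..m}" unfolding Jm_def J_def by auto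
        moreover have "norm (\<A> (fst (T i z)) (j - i) (snd (T i z))) < 1 - eps N"
          using ij(1) \<open>j - i \<in> {N..m}\<close> unfolding Jm_def by blast
        ultimately have "exp (a j - a i) < 1 - eps N" using ratio[of i j] by simp
        then have "ln (exp (a j - a i)) < ln (1 - eps N)" using eps[of N] by (subst ln_less_cancel_iff) auto
        then show "- a i + e \<le> - a j" using e' by simp
      qed (use finJ e a_bd in \<open>auto simp: Jm_def J_def\<close>)
      ultimately have "real (card J) \<le> 2 * (real N * (2 * (\<kappa> * real m) / e + 2))" by linarith
      also have "\<dots> \<le> 2 * ((real N + 1) * (2 * (\<kappa> * real m) / e + 2))"
        using \<kappa> e by (intro mult_left_mono mult_right_mono) auto
      also have "\<dots> = \<beta> * real m / 16 + 4 * (real N + 1)"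
      proof -
        have "2 * (q * (2 * (\<beta> * e / (64 * q) * real m) / e + 2)) = \<beta> * real m / 16 + 4 * q" if "q \<noteq> 0" for q
          using e that by (simp add: field_simps)
        moreover have "real N + 1 \<noteq> 0" by linarith
        ultimately show ?thesis unfolding \<kappa>_def by blast
      qed
      also have "4 * (real N + 1) \<le> \<beta> * real m / 16"
      proof -
        have "64 * (real N + 1) \<le> \<beta> * real m0" using m0 \<beta> by (simp add: field_simps)
        also have "\<dots> \<le> \<beta> * real m" using m \<beta> by (intro mult_left_mono) auto
        finally show ?thesis by simp
      qed
      finally have "real (card J) \<le> real m * \<beta> / 8" by (simp add: mult.commute)
      moreover have "real m * \<beta> / 4 \<le> real (card J)" using z(1) cJ unfolding H_def by simp
      moreover have "0 < real m * \<beta>" using m \<beta> by simp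
      ultimately show False by linarith
    qed
    then have "mu H \<le> mu (R m)" by (intro mu_mono HS gdelta_sets gR)
    then show ?thesis using H_large by simp
  qed
  have "\<exists>k. mu (R (k + Suc m0)) < \<beta> / 4"
    by (rule bounded_convergence[OF gR clR finR]) (use \<beta> in simp)
  then show False using R_large by (auto simp: not_less[symmetric])
qed

text \<open>\<open>balanced_meets\<close>, applied to the complement of a hull of the projection,
  shows this complement to be null; hence the section is balanced on a set of probability 1.\<close>

theorem measurable_balanced_vector:
  "\<exists>v\<in>borel_measurable M. AE w in M. (w, v w) \<in> balanced"
proof -
  obtain v B where vB: "v \<in> borel_measurable M" "B \<in> sets M" "\<And>w. w \<in> B \<Longrightarrow> (w, v w) \<in> balanced"
    "outer M (fst ` balanced) = prob B"
    using measurable_section[OF gdelta_balanced space_M] by metis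
  obtain H where H: "H \<in> sets M" "fst ` balanced \<subseteq> H" "prob H = outer M (fst ` balanced)"
    using outer_hull[of "fst ` balanced"] space_M by auto
  have "prob (UNIV - H) = 0"
  proof (rule ccontr)
    assume "prob (UNIV - H) \<noteq> 0"
    then have "0 < prob (UNIV - H)" by (simp add: zero_less_measure_iff)
    moreover have "UNIV - H \<in> sets M" using sets.Diff[OF sets.top H(1)] by (simp add: space_M)
    ultimately obtain w u where "w \<in> UNIV - H" "(w, u) \<in> balanced" using balanced_meets by blast
    then show False using H(2) by force
  qed
  then have "prob B = 1" using prob_compl[OF H(1)] H(3) vB(4) by (simp add: space_M)
  then have "AE w in M. w \<in> B" using vB(2) by (simp add: prob_eq_1)
  then show ?thesis using vB(1,3) by (intro bexI[of _ v]) auto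
qed

end

section \<open>Passage to lower and upper limits\<close>

lemma liminf_le_one:
  fixes x :: "nat \<Rightarrow> real"
  assumes "\<And>m. \<exists>k\<ge>m. x k < 1 + inverse (real (Suc m))"
  shows "liminf (\<lambda>n. ereal (x n)) \<le> 1"
proof (rule ccontr)
  assume "\<not> ?thesis"
  then have "ereal 1 < liminf (\<lambda>n. ereal (x n))" by (simp add: one_ereal_def)
  then obtain c where c: "ereal 1 < ereal c" "ereal c < liminf (\<lambda>n. ereal (x n))"
    using ereal_dense2 by blast
  have "eventually (\<lambda>n. ereal c < ereal (x n)) sequentially" by (rule less_LiminfD[OF c(2)])
  then obtain n0 where n0: "\<And>n. n0 \<le> n \<Longrightarrow> c < x n" unfolding eventually_sequentially by auto
  obtain m where m: "inverse (real (Suc m)) < c - 1" using reals_Archimedean[of "c - 1"] c(1) by auto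
  obtain k where k: "max n0 m \<le> k" "x k < 1 + inverse (real (Suc (max n0 m)))" using assms by blast
  have "inverse (real (Suc (max n0 m))) \<le> inverse (real (Suc m))" by (intro le_imp_inverse_le) auto
  moreover have "n0 \<le> k" using k(1) by simp
  ultimately show False using n0[of k] k(2) m by linarith
qed

lemma limsup_ge_one:
  fixes x :: "nat \<Rightarrow> real"
  assumes "\<And>m. \<exists>k\<ge>m. 1 - inverse (real (Suc m)) < x k"
  shows "1 \<le> limsup (\<lambda>n. ereal (x n))"
proof (rule ccontr)
  assume "\<not> ?thesis"
  then have "limsup (\<lambda>n. ereal (x n)) < ereal 1" by (simp add: one_ereal_def)
  then obtain c where c: "limsup (\<lambda>n. ereal (x n)) < ereal c" "ereal c < ereal 1"
    using ereal_dense2 by blast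
  have "eventually (\<lambda>n. ereal (x n) < ereal c) sequentially" by (rule Limsup_lessD[OF c(1)])
  then obtain n0 where n0: "\<And>n. n0 \<le> n \<Longrightarrow> x n < c" unfolding eventually_sequentially by auto
  obtain m where m: "inverse (real (Suc m)) < 1 - c" using reals_Archimedean[of "1 - c"] c(2) by auto
  obtain k where k: "max n0 m \<le> k" "1 - inverse (real (Suc (max n0 m))) < x k" using assms by blast
  have "inverse (real (Suc (max n0 m))) \<le> inverse (real (Suc m))" by (intro le_imp_inverse_le) auto
  moreover have "n0 \<le> k" using k(1) by simp
  ultimately show False using n0[of k] k(2) m by linarith
qed

lemma (in neutral_cocycle) exists_balanced_vector:
  "\<exists>v\<in>borel_measurable M. AE w in M. norm (v w) = 1 \<and>
     liminf (\<lambda>n. ereal (norm (\<A> w n (v w)))) \<le> 1 \<and> 1 \<le> limsup (\<lambda>n. ereal (norm (\<A> w n (v w))))"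
proof -
  obtain Y v C where "cocycle_section M \<sigma> \<A> \<eta> Y v C"
    by (rule exists_section) (blast intro: cocycle_section.intro neutral_cocycle_axioms cocycle_section_axioms.intro)
  then interpret cs: cocycle_section M \<sigma> \<A> \<eta> Y v C .
  obtain \<Lambda> where "tight_mean M \<sigma> \<A> \<eta> \<Lambda>" using cs.exists_tight_mean by blast
  then interpret tm: tight_mean M \<sigma> \<A> \<eta> \<Lambda> .
  obtain v where v: "v \<in> borel_measurable M" "AE w in M. (w, v w) \<in> tm.balanced"
    using tm.measurable_balanced_vector by blast
  from v(2) have "AE w in M. norm (v w) = 1 \<and>
     liminf (\<lambda>n. ereal (norm (\<A> w n (v w)))) \<le> 1 \<and> 1 \<le> limsup (\<lambda>n. ereal (norm (\<A> w n (v w))))"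
  proof eventually_elim
    case (elim w)
    then have "norm (v w) = 1" "\<And>m. \<exists>k\<ge>m. norm (\<A> w k (v w)) < 1 + inverse (real (Suc m))"
      "\<And>m. \<exists>k\<ge>m. 1 - inverse (real (Suc m)) < norm (\<A> w k (v w))"
      unfolding tm.balanced_def by auto
    then show ?case by (intro conjI liminf_le_one limsup_ge_one)
  qed
  then show ?thesis using v(1) by blast
qed

theorem lemma15:
  fixes M :: "'w::polish_space measure"
    and \<sigma> :: "'w \<Rightarrow> 'w"
    and \<A> :: "'w \<Rightarrow> nat \<Rightarrow> 'x::{banach, second_countable_topology} \<Rightarrow>\<^sub>L 'x"
  assumes "ergodic_automorphism M \<sigma>"
    and "aperiodic M \<sigma>"
    and "linear_cocycle M \<sigma> \<A>"
    and "compact_cocycle \<A>"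
    and "integrable M (\<lambda>w. log_plus (norm (\<A> w 1)))"
    and "lyapunov_exponent M \<sigma> \<A> 0"
  shows "\<exists>v \<in> borel_measurable M. AE w in M.
           norm (v w) = 1 \<and>
           liminf (\<lambda>n. ereal (norm (\<A> w n (v w)))) \<le> 1 \<and>
           1 \<le> limsup (\<lambda>n. ereal (norm (\<A> w n (v w))))"
proof -
  interpret ergodic_automorphism M \<sigma> by fact
  interpret linear_cocycle M \<sigma> \<A> by fact
  obtain N lam \<Omega>' E V i where os: "oseledets_splitting M \<sigma> \<A> N lam \<Omega>' E V" and i: "enat i < N" "lam i = 0"
    using assms(6) unfolding lyapunov_exponent_def by blast
  interpret sp: splitting M \<sigma> \<A> N lam \<Omega>' E V by unfold_locales (rule os)
  obtain \<eta> where \<eta>: "0 < \<eta>" "\<And>w. w \<in> \<Omega>' \<Longrightarrow> neutral_growth \<eta> (\<A> w)"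
    by (rule sp.growth_near_zero_exponent[OF cocycle_add i]) blast
  have "\<Omega>' \<in> sets M" "emeasure M \<Omega>' = 1" using os unfolding oseledets_splitting_def by simp_all
  then have ae: "AE w in M. w \<in> \<Omega>'" by (simp add: prob_eq_1[symmetric] emeasure_eq_measure)
  interpret neutral_cocycle M \<sigma> \<A> \<eta>
  proof
    show "AE w in M. neutral_growth \<eta> (\<A> w)" using ae by eventually_elim (rule \<eta>(2))
  qed (use assms \<eta>(1) in auto)
  show ?thesis by (rule exists_balanced_vector)
qed

end
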